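(* Let $N\ge1$, let $f\in\mathfrak{LC}(\mathbb R^{2N},\mathbb R^N)$, and let $D'\subset\mathbb R^N$ and $D\subset\mathbb R^{2N}$ be any countable dense subsets. For a topology $\mathcal T$ on $\mathfrak{LC}=\mathfrak{LC}(\mathbb R^{2N},\mathbb R^N)$ let $$\mathcal U_{(\mathfrak{LC},\mathcal T)}=\{(t,g,\phi): g\in\mathrm{Hull}_{(\mathfrak{LC},\mathcal T)}(f),\ \phi\in\mathcal C^{1,1},\ t\in I_{g,\phi},\ t\ge0\}$$ and consider the map $$\Phi:\mathcal U_{(\mathfrak{LC},\mathcal T)}\to\mathrm{Hull}_{(\mathfrak{LC},\mathcal T)}(f)\times\mathcal C^{1,1},\qquad(t,g,\phi)\mapsto\big(g_t,x_t(\cdot,g,\phi)\big).$$ (i) If $f$ has $L^1_{loc}$-equicontinuous $m$-bounds and $L^1_{loc}$-bounded $l_2$-bounds, let $\Theta=\{\theta^I_j\}$ be the suitable set of moduli of continuity given by the $m$-bounds, $\theta^I_j(s)=\sup_{t\in\mathbb R}\int_t^{t+s}m^j_f(u)\,du$. Then the map $\Phi$ defines a continuous skew-product semiflow for $\mathcal T=\mathcal T_{\Theta D'}$. (ii) If $f$ has $L^1_{loc}$-bounded $l$-bounds, then the map $\Phi$ defines a continuous skew-product semiflow for $\mathcal T=\mathcal T_D$.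
   Context: $B_j$ is the closed ball of radius $j$ centered at the origin; $C(I,W)$ is the space of continuous functions $I\to W$. $L^1_{loc}$ is the set of real functions on $\mathbb R$ belonging to $L^1(I)$ for every compact interval $I$. For a compact interval $I$, $\mathcal C^{1,1}(I)$ is the Sobolev space of (absolutely) continuous functions $x:I\to\mathbb R^N$ with $\dot x\in L^1(I)$, normed by $\|x\|_{\mathcal C^{1,1}(I)}=\|x\|_{L^\infty(I)}+\|\dot x\|_{L^1(I)}$; $\mathcal C^{1,1}=\mathcal C^{1,1}([-1,0])$. $\mathfrak{LC}(\mathbb R^{2N},\mathbb R^N)$ is the set of functions $f:\mathbb R\times\mathbb R^{2N}\to\mathbb R^N$ such that: $f$ is Borel measurable; for every compact $K\subset\mathbb R^{2N}$ there are $m^K,l^K\in L^1_{loc}$ such that for a.e. $t\in\mathbb R$, $|f(t,z)|\le m^K(t)$ and $|f(t,z_1)-f(t,z_2)|\le l^K(t)|z_1-z_2|$ for all $z,z_1,z_2\in K$. Functions differing only on a negligible set are identified. Points of $\mathbb R^{2N}$ are written $(x,u)$. Time translation: $f_t(s,z)=f(s+t,z)$. $\mathrm{Hull}_{(\mathfrak{LC},\mathcal T)}(f)$ is the closure of $\{f_t: t\in\mathbb R\}$ in $(\mathfrak{LC},\mathcal T)$, with the induced topology. Optimal bounds of $g$ on $B_j\subset\mathbb R^{2N}$: $m^j_g(t)=\sup_{z\in B_j}|g(t,z)|$, $l^j_g(t)=\sup_{z_1\neq z_2\in B_j}|g(t,z_1)-g(t,z_2)|/|z_1-z_2|$, $l^j_{2,g}(t)=\sup|g(t,x,u_1)-g(t,x,u_2)|/|u_1-u_2|$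 over $(x,u_1),(x,u_2)\in B_j$, $u_1\ne u_2$. $f$ has $L^1_{loc}$-equicontinuous $m$-bounds if for every $j\in\mathbb N$, $r,\varepsilon>0$ there is $\delta>0$ with $\sup_{\tau\in\mathbb R}\int_s^t m^j_{f_\tau}(u)\,du<\varepsilon$ whenever $-r\le s\le t\le r$, $t-s<\delta$. $f$ has $L^1_{loc}$-bounded $l$-bounds (resp. $l_2$-bounds) if $\sup_{\tau\in\mathbb R}\int_{-r}^r l^j_{f_\tau}(t)\,dt<\infty$ (resp. $\sup_{\tau\in\mathbb R}\int_{-r}^r l^j_{2,f_\tau}(t)\,dt<\infty$) for every $j\in\mathbb N$, $r>0$. A suitable set of moduli of continuity is a countable set $\{\theta^I_j: j\in\mathbb N,\ I=[q_1,q_2],\ q_1,q_2\in\mathbb Q\}$ of non-decreasing continuous functions $[0,\infty)\to[0,\infty)$ with $\theta^I_j(0)=0$ and $\theta^{I_1}_{j_1}\le\theta^{I_2}_{j_2}$ whenever $I_1\subseteq I_2$, $j_1\le j_2$. $\mathcal K^I_j$ is the set of $x\in C(I,B_j)$, $B_j\subset\mathbb R^N$, with $|x(t)-x(s)|\le\theta^I_j(|t-s|)$ for all $t,s\in I$. Topologies, generated by the following seminorms over all $I=[q_1,q_2]$, $q_1,q_2\in\mathbb Q$, $j\in\mathbb N$: - $\mathcal T_{\Theta D'}$: $\sup_{x\in\mathcal K^I_j}\int_I|f(t,x(t),u)|\,dt$, $u\in D'$; - $\mathcal T_D$: $\int_I|f(t,z)|\,dt$, $z\in D$. For $g\in\mathfrak{LC}(\mathbb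 R^{2N},\mathbb R^N)$ and $\phi\in C([-1,0],\mathbb R^N)$, $x(\cdot,g,\phi)$ denotes the unique maximal continuous (Carathéodory) solution, with maximal interval of definition $I_{g,\phi}=[-1,b_{g,\phi})$, of $\dot x=g(t,x(t),x(t-1))$ for $t>0$, $x(t)=\phi(t)$ for $t\in[-1,0]$. For $t\ge0$, $x_t(\cdot,g,\phi)$ is the function $s\mapsto x(t+s,g,\phi)$, $s\in[-1,0]$ (it belongs to $\mathcal C^{1,1}$ if $\phi\in\mathcal C^{1,1}$). Since solutions may blow up, "continuous semiflow" is understood locally: a continuous map $\Phi:\mathcal U\to X$, with $\mathcal U\subset[0,\infty)\times X$ relatively open and containing $\{0\}\times X$, such that $\Phi(0,x)=x$ and $\Phi(t+s,x)=\Phi(t,\Phi(s,x))$ whenever $(s,x)\in\mathcal U$ and $(t,\Phi(s,x))\in\mathcal U$. It is a skew-product semiflow if $X=Y\times Z$ and the $Y$-component of $\Phi(t,y,z)$ depends only on $(t,y)$. *)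

theory Defs
  imports "HOL-Analysis.Analysis"
begin

definition L1_loc :: "(real \<Rightarrow> real) \<Rightarrow> bool" where
  "L1_loc h \<longleftrightarrow> (\<forall>a b. h absolutely_integrable_on {a..b})"

text \<open>Functions \<open>f (t, x, u)\<close> are curried in \<open>t\<close>. The norm of the product type
  \<open>(real^'n) \<times> (real^'n)\<close> is the Euclidean norm of \<open>\<real>\<^sup>2\<^sup>N\<close>.\<close>

definition LC_fun :: "(real \<Rightarrow> (real^'n) \<times> (real^'n) \<Rightarrow> real^'n) set" where
  "LC_fun = {f. (\<lambda>(t, z). f t z) \<in> borel_measurable borel \<and>
     (\<forall>K. compact K \<longrightarrow>
        (\<exists>m l. L1_loc m \<and> L1_loc l \<and>
           (AE t in lebesgue.
              (\<forall>z\<in>K. norm (f t z) \<le> m t) \<and>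
              (\<forall>z1\<in>K. \<forall>z2\<in>K. norm (f t z1 - f t z2) \<le> l t * norm (z1 - z2)))))}"

definition LC_eq :: "(real \<Rightarrow> (real^'n) \<times> (real^'n) \<Rightarrow> real^'n) \<Rightarrow>
    (real \<Rightarrow> (real^'n) \<times> (real^'n) \<Rightarrow> real^'n) \<Rightarrow> bool" where
  "LC_eq f g \<longleftrightarrow> f \<in> LC_fun \<and> g \<in> LC_fun \<and> negligible {(t, z). f t z \<noteq> g t z}"

lemma LC_eq_part_equivp: "part_equivp LC_eq"
proof (rule part_equivpI)
  have "(\<lambda>_ _. 0) \<in> LC_fun"
    unfolding LC_fun_def L1_loc_def by (auto intro!: exI[of _ "\<lambda>_. 0"])
  then show "\<exists>f. LC_eq f f"
    by (auto simp: LC_eq_def)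
  show "symp LC_eq"
    by (auto simp: symp_def LC_eq_def eq_commute)
  show "transp LC_eq"
  proof (rule transpI)
    fix f g h :: "real \<Rightarrow> (real^'n) \<times> (real^'n) \<Rightarrow> real^'n"
    assume fg: "LC_eq f g" and gh: "LC_eq g h"
    have "negligible ({(t, z). f t z \<noteq> g t z} \<union> {(t, z). g t z \<noteq> h t z})"
      using fg gh by (auto simp: LC_eq_def intro: negligible_Un)
    then have "negligible {(t, z). f t z \<noteq> h t z}"
      by (rule negligible_subset) auto
    then show "LC_eq f h"
      using fg gh by (auto simp: LC_eq_def)
  qed
qed

quotient_type 'n LC =
  "real \<Rightarrow> (real^'n) \<times> (real^'n) \<Rightarrow> real^'n" / partial: LC_eq
  morphisms rep_LC abs_LC
  by (rule LC_eq_part_equivp)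

definition time_shift :: "real \<Rightarrow> (real \<Rightarrow> 'z \<Rightarrow> 'w) \<Rightarrow> real \<Rightarrow> 'z \<Rightarrow> 'w" where
  "time_shift t f = (\<lambda>s z. f (s + t) z)"

lemma absolutely_integrable_shift:
  fixes h :: "real \<Rightarrow> real"
  assumes "h absolutely_integrable_on {a + t..b + t}"
  shows "(\<lambda>s. h (s + t)) absolutely_integrable_on {a..b}"
proof -
  have *: "(\<lambda>s. k (s + t)) integrable_on {a..b}" if "k integrable_on {a + t..b + t}"
    for k :: "real \<Rightarrow> real"
    using integrable_shift_cbox[of k "a + t" "b + t" t] that by simp
  show ?thesis
    using assms *[of h] *[of "\<lambda>s. norm (h s)"] by (auto simp: absolutely_integrable_on_def)
qed

lemma AE_lebesgue_shift:
  assumes "AE s in lebesgue. P (s :: real)"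
  shows "AE s in lebesgue. P (s + t)"
proof -
  obtain N where "N \<in> null_sets lebesgue" and "{s. \<not> P s} \<subseteq> N"
    using assms by (auto simp: eventually_ae_filter)
  then have "negligible {s. \<not> P s}"
    using negligible_iff_null_sets negligible_subset by blast
  then have "negligible ((+) (- t) ` {s. \<not> P s})"
    by (rule negligible_translation)
  also have "(+) (- t) ` {s. \<not> P s} = {s. \<not> P (s + t)}"
    by (auto simp: image_iff intro!: exI[of _ "_ + t"])
  finally show ?thesis
    by (auto simp: negligible_iff_null_sets eventually_ae_filter)
qed

lemma time_shift_LC_fun:
  assumes "f \<in> LC_fun"
  shows "time_shift t f \<in> LC_fun"
proof -
  have "(\<lambda>p. (\<lambda>(s, z). f s z) (fst p + t, snd p)) \<in> borel_measurable borel"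
    by (rule measurable_compose[where N = borel])
       (use assms in \<open>auto simp: LC_fun_def intro!: borel_measurable_continuous_onI continuous_intros\<close>)
  moreover have "\<exists>m l. L1_loc m \<and> L1_loc l \<and>
           (AE s in lebesgue.
              (\<forall>z\<in>K. norm (f (s + t) z) \<le> m s) \<and>
              (\<forall>z1\<in>K. \<forall>z2\<in>K. norm (f (s + t) z1 - f (s + t) z2) \<le> l s * norm (z1 - z2)))"
    if K: "compact K" for K
  proof -
    obtain m l where ml: "L1_loc m" "L1_loc l" and ae: "AE s in lebesgue.
              (\<forall>z\<in>K. norm (f s z) \<le> m s) \<and>
              (\<forall>z1\<in>K. \<forall>z2\<in>K. norm (f s z1 - f s z2) \<le> l s * norm (z1 - z2))"
      using assms K unfolding LC_fun_def by blast
    show ?thesis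
      using ml AE_lebesgue_shift[OF ae, of t]
      by (intro exI[of _ "\<lambda>s. m (s + t)"] exI[of _ "\<lambda>s. l (s + t)"])
         (auto simp: L1_loc_def intro!: absolutely_integrable_shift)
  qed
  ultimately show ?thesis
    by (auto simp: LC_fun_def time_shift_def case_prod_unfold)
qed

lift_definition translate_LC :: "real \<Rightarrow> 'n::finite LC \<Rightarrow> 'n LC" is time_shift
proof -
  fix t :: real and f g :: "real \<Rightarrow> (real^'n) \<times> (real^'n) \<Rightarrow> real^'n"
  assume fg: "LC_eq f g"
  then have "negligible ((+) (- t, 0) ` {(s, z). f s z \<noteq> g s z})"
    by (auto simp: LC_eq_def intro: negligible_translation)
  also have "(+) (- t, 0) ` {(s, z). f s z \<noteq> g s z} =
      {(s, z). time_shift t f s z \<noteq> time_shift t g s z}"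
    by (force simp: time_shift_def image_iff)
  finally show "LC_eq (time_shift t f) (time_shift t g)"
    using fg by (auto simp: LC_eq_def time_shift_LC_fun)
qed

text \<open>Suprema and integrals of the optimal bounds are taken in \<open>ennreal\<close>, so that an infinite
  value is really infinite.\<close>

definition m_bound :: "(real \<Rightarrow> (real^'n) \<times> (real^'n) \<Rightarrow> real^'n) \<Rightarrow> nat \<Rightarrow> real \<Rightarrow> ennreal" where
  "m_bound g j t = (SUP z\<in>cball 0 (real j). ennreal (norm (g t z)))"

definition l_bound :: "(real \<Rightarrow> (real^'n) \<times> (real^'n) \<Rightarrow> real^'n) \<Rightarrow> nat \<Rightarrow> real \<Rightarrow> ennreal" where
  "l_bound g j t =
     (SUP (z1, z2)\<in>{(z1, z2). z1 \<in> cball 0 (real j) \<and> z2 \<in> cball 0 (real j) \<and> z1 \<noteq> z2}.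
        ennreal (norm (g t z1 - g t z2) / norm (z1 - z2)))"

definition l2_bound :: "(real \<Rightarrow> (real^'n) \<times> (real^'n) \<Rightarrow> real^'n) \<Rightarrow> nat \<Rightarrow> real \<Rightarrow> ennreal" where
  "l2_bound g j t =
     (SUP (x, u1, u2)\<in>{(x, u1, u2). (x, u1) \<in> cball 0 (real j) \<and> (x, u2) \<in> cball 0 (real j) \<and> u1 \<noteq> u2}.
        ennreal (norm (g t (x, u1) - g t (x, u2)) / norm (u1 - u2)))"

definition equicontinuous_m_bounds :: "(real \<Rightarrow> (real^'n) \<times> (real^'n) \<Rightarrow> real^'n) \<Rightarrow> bool" where
  "equicontinuous_m_bounds f \<longleftrightarrow>
     (\<forall>j r e. r > 0 \<and> e > 0 \<longrightarrow>
       (\<exists>d>0. \<forall>s t. - r \<le> s \<and> s \<le> t \<and> t \<le> r \<and> t - s < d \<longrightarrow>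
          (SUP \<tau>. \<integral>\<^sup>+u\<in>{s..t}. m_bound (time_shift \<tau> f) j u \<partial>lebesgue) < ennreal e))"

definition bounded_l_bounds :: "(real \<Rightarrow> (real^'n) \<times> (real^'n) \<Rightarrow> real^'n) \<Rightarrow> bool" where
  "bounded_l_bounds f \<longleftrightarrow>
     (\<forall>j r. r > 0 \<longrightarrow>
        (SUP \<tau>. \<integral>\<^sup>+t\<in>{- r..r}. l_bound (time_shift \<tau> f) j t \<partial>lebesgue) < \<infinity>)"

definition bounded_l2_bounds :: "(real \<Rightarrow> (real^'n) \<times> (real^'n) \<Rightarrow> real^'n) \<Rightarrow> bool" where
  "bounded_l2_bounds f \<longleftrightarrow>
     (\<forall>j r. r > 0 \<longrightarrow>
        (SUP \<tau>. \<integral>\<^sup>+t\<in>{- r..r}. l2_bound (time_shift \<tau> f) j t \<partial>lebesgue) < \<infinity>)"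

definition rat_intervals :: "real set set" where
  "rat_intervals = {{q1..q2} | q1 q2. q1 \<in> \<rat> \<and> q2 \<in> \<rat> \<and> q1 \<le> q2}"

definition suitable_moduli :: "(real set \<Rightarrow> nat \<Rightarrow> real \<Rightarrow> real) \<Rightarrow> bool" where
  "suitable_moduli \<theta> \<longleftrightarrow>
     (\<forall>I\<in>rat_intervals. \<forall>j.
        \<theta> I j \<in> {0..} \<rightarrow> {0..} \<and> mono_on {0..} (\<theta> I j) \<and> continuous_on {0..} (\<theta> I j) \<and> \<theta> I j 0 = 0) \<and>
     (\<forall>I1\<in>rat_intervals. \<forall>I2\<in>rat_intervals. \<forall>j1 j2. I1 \<subseteq> I2 \<and> j1 \<le> j2 \<longrightarrow>
        (\<forall>s\<ge>0. \<theta> I1 j1 s \<le> \<theta> I2 j2 s))"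

text \<open>The supremum below is finite when \<open>f\<close> has equicontinuous m-bounds. The moduli do not depend
  on the interval.\<close>

definition m_moduli :: "(real \<Rightarrow> (real^'n) \<times> (real^'n) \<Rightarrow> real^'n) \<Rightarrow> real set \<Rightarrow> nat \<Rightarrow> real \<Rightarrow> real" where
  "m_moduli f I j s = enn2real (SUP t. \<integral>\<^sup>+u\<in>{t..t + s}. m_bound f j u \<partial>lebesgue)"

definition moduli_set :: "(real set \<Rightarrow> nat \<Rightarrow> real \<Rightarrow> real) \<Rightarrow> real set \<Rightarrow> nat \<Rightarrow> (real \<Rightarrow> real^'n) set" where
  "moduli_set \<theta> I j = {x. continuous_on I x \<and> x ` I \<subseteq> cball 0 (real j) \<and>
     (\<forall>t\<in>I. \<forall>s\<in>I. norm (x t - x s) \<le> \<theta> I j \<bar>t - s\<bar>)}"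

text \<open>The topology generated by the balls \<open>{G. p (G - H) < e}\<close>. Here, as for the solutions of the
  delay equation below, the choice of the representatives \<open>rep_LC\<close> is immaterial: by continuity in
  \<open>z\<close>, equivalent functions agree for almost every \<open>t\<close> at all \<open>z\<close> simultaneously.\<close>

definition seminorm_topology ::
    "((real \<Rightarrow> (real^'n) \<times> (real^'n) \<Rightarrow> real^'n) \<Rightarrow> ennreal) set \<Rightarrow> 'n LC topology" where
  "seminorm_topology P = topology_generated_by
     {{G. p (\<lambda>t z. rep_LC G t z - rep_LC H t z) < ennreal e} | p H e. p \<in> P \<and> e > 0}"

definition T_Theta :: "(real set \<Rightarrow> nat \<Rightarrow> real \<Rightarrow> real) \<Rightarrow> (real^'n) set \<Rightarrow> 'n LC topology" where
  "T_Theta \<theta> D' = seminorm_topology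
     {\<lambda>f. SUP x\<in>moduli_set \<theta> I j. \<integral>\<^sup>+t\<in>I. ennreal (norm (f t (x t, u))) \<partial>lebesgue
        | I j u. I \<in> rat_intervals \<and> u \<in> D'}"

definition T_D :: "((real^'n) \<times> (real^'n)) set \<Rightarrow> 'n LC topology" where
  "T_D D = seminorm_topology
     {\<lambda>f. \<integral>\<^sup>+t\<in>I. ennreal (norm (f t z)) \<partial>lebesgue | I z. I \<in> rat_intervals \<and> z \<in> D}"

definition Hull :: "'n::finite LC topology \<Rightarrow> 'n LC \<Rightarrow> 'n LC set" where
  "Hull T F = T closure_of (range (\<lambda>t. translate_LC t F))"

definition abs_continuous_on :: "real \<Rightarrow> real \<Rightarrow> (real \<Rightarrow> 'a::real_normed_vector) \<Rightarrow> bool" where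
  "abs_continuous_on a b x \<longleftrightarrow>
     (\<forall>e>0. \<exists>d>0. \<forall>(n::nat) s t.
        (\<forall>i<n. a \<le> s i \<and> s i \<le> t i \<and> t i \<le> b) \<and>
        disjoint_family_on (\<lambda>i. {s i<..<t i}) {..<n} \<and>
        (\<Sum>i<n. t i - s i) < d \<longrightarrow>
        (\<Sum>i<n. norm (x (t i) - x (s i))) < e)"

text \<open>Functions on \<open>[-1, 0]\<close> are represented extensionally, so that equality in \<open>C11\<close> is
  equality on \<open>[-1, 0]\<close>.\<close>

definition C11 :: "(real \<Rightarrow> real^'n) set" where
  "C11 = {x \<in> extensional {-1..0}. abs_continuous_on (-1) 0 x \<and>
     (\<exists>y. y absolutely_integrable_on {-1..0} \<and>
        (AE t in lebesgue. t \<in> {-1..0} \<longrightarrow> (x has_vector_derivative y t) (at t within {-1..0})))}"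

definition C11_norm :: "(real \<Rightarrow> real^'n) \<Rightarrow> real" where
  "C11_norm x = (SUP t\<in>{-1..0}. norm (x t)) +
     (LINT t:{-1..0}|lebesgue. norm (vector_derivative x (at t within {-1..0})))"

definition C11_topology :: "(real \<Rightarrow> real^'n) topology" where
  "C11_topology = topology_generated_by
     {{y \<in> C11. C11_norm (\<lambda>t. y t - x t) < e} | x e. x \<in> C11 \<and> e > 0}"

text \<open>Caratheodory solutions of \<open>x'(t) = g (t, x(t), x(t-1))\<close>, \<open>x = \<phi>\<close> on \<open>[-1, 0]\<close>, with
  interval of definition \<open>[-1, b)\<close>, \<open>0 < b \<le> \<infinity>\<close>.\<close>

definition dde_solution :: "(real \<Rightarrow> (real^'n) \<times> (real^'n) \<Rightarrow> real^'n) \<Rightarrow> (real \<Rightarrow> real^'n) \<Rightarrow>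
    ereal \<Rightarrow> (real \<Rightarrow> real^'n) \<Rightarrow> bool" where
  "dde_solution g \<phi> b x \<longleftrightarrow> 0 < b \<and>
     continuous_on {t. -1 \<le> t \<and> ereal t < b} x \<and>
     (\<forall>t\<in>{-1..0}. x t = \<phi> t) \<and>
     (\<forall>c\<ge>0. ereal c < b \<longrightarrow> abs_continuous_on 0 c x) \<and>
     (AE t in lebesgue. 0 < t \<and> ereal t < b \<longrightarrow>
        (x has_vector_derivative g t (x t, x (t - 1))) (at t))"

definition maximal_dde_solution :: "(real \<Rightarrow> (real^'n) \<times> (real^'n) \<Rightarrow> real^'n) \<Rightarrow>
    (real \<Rightarrow> real^'n) \<Rightarrow> ereal \<Rightarrow> (real \<Rightarrow> real^'n) \<Rightarrow> bool" where
  "maximal_dde_solution g \<phi> b x \<longleftrightarrow> dde_solution g \<phi> b x \<and>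
     (\<forall>c y. dde_solution g \<phi> c y \<and> b \<le> c \<and> (\<forall>t\<ge>-1. ereal t < b \<longrightarrow> y t = x t) \<longrightarrow> c = b)"

definition sol_end :: "'n::finite LC \<Rightarrow> (real \<Rightarrow> real^'n) \<Rightarrow> ereal" where
  "sol_end G \<phi> = (THE b. \<exists>x. maximal_dde_solution (rep_LC G) \<phi> b x)"

text \<open>The maximal solution is determined only on \<open>[-1, sol_end G \<phi>)\<close>; its values elsewhere are
  arbitrary.\<close>

definition sol :: "'n::finite LC \<Rightarrow> (real \<Rightarrow> real^'n) \<Rightarrow> real \<Rightarrow> real^'n" where
  "sol G \<phi> = (SOME x. maximal_dde_solution (rep_LC G) \<phi> (sol_end G \<phi>) x)"

definition sol_segment :: "'n::finite LC \<Rightarrow> (real \<Rightarrow> real^'n) \<Rightarrow> real \<Rightarrow> real \<Rightarrow> real^'n" where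
  "sol_segment G \<phi> t = (\<lambda>s\<in>{-1..0}. sol G \<phi> (t + s))"

definition flow_domain :: "'n::finite LC topology \<Rightarrow> 'n LC \<Rightarrow>
    (real \<times> 'n LC \<times> (real \<Rightarrow> real^'n)) set" where
  "flow_domain T F = {(t, G, \<phi>). G \<in> Hull T F \<and> \<phi> \<in> C11 \<and> 0 \<le> t \<and> ereal t < sol_end G \<phi>}"

definition flow_map :: "real \<times> 'n::finite LC \<times> (real \<Rightarrow> real^'n) \<Rightarrow> 'n LC \<times> (real \<Rightarrow> real^'n)" where
  "flow_map = (\<lambda>(t, G, \<phi>). (translate_LC t G, sol_segment G \<phi> t))"

text \<open>In the semigroup law, \<open>(t + s, x) \<in> U\<close> is part of the claim: the left-hand side has to be
  defined.\<close>

definition continuous_semiflow :: "'x topology \<Rightarrow> (real \<times> 'x) set \<Rightarrow> (real \<times> 'x \<Rightarrow> 'x) \<Rightarrow> bool" where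
  "continuous_semiflow X U \<Phi> \<longleftrightarrow>
     openin (prod_topology (top_of_set {0..}) X) U \<and>
     {0} \<times> topspace X \<subseteq> U \<and>
     continuous_map (subtopology (prod_topology (top_of_set {0..}) X) U) X \<Phi> \<and>
     (\<forall>x\<in>topspace X. \<Phi> (0, x) = x) \<and>
     (\<forall>t s x. (s, x) \<in> U \<and> (t, \<Phi> (s, x)) \<in> U \<longrightarrow>
        (t + s, x) \<in> U \<and> \<Phi> (t + s, x) = \<Phi> (t, \<Phi> (s, x)))"

definition continuous_skew_product_semiflow ::
    "'y topology \<Rightarrow> 'z topology \<Rightarrow> (real \<times> 'y \<times> 'z) set \<Rightarrow> (real \<times> 'y \<times> 'z \<Rightarrow> 'y \<times> 'z) \<Rightarrow> bool" where
  "continuous_skew_product_semiflow Y Z U \<Phi> \<longleftrightarrow>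
     continuous_semiflow (prod_topology Y Z) U \<Phi> \<and>
     (\<forall>t y z z'. (t, y, z) \<in> U \<and> (t, y, z') \<in> U \<longrightarrow> fst (\<Phi> (t, y, z)) = fst (\<Phi> (t, y, z')))"

end

theory Submission
  imports Defs
begin

text \<open>The equation is rewritten as an integral equation: absolutely continuous functions are primitives
  of their derivatives, by a Cousin covering argument and Lebesgue's differentiation theorem. Clipping
  the space variables to a ball makes the right-hand side globally Lipschitz, so a contraction argument
  in an exponentially weighted norm gives global solutions of the clipped equation, and from these one gets
  local existence, uniqueness and the maximal interval.

  For continuous dependence, let \<open>x0\<close> solve the equation of \<open>G0\<close> and let \<open>y\<close> be the clipped solution for a
  nearby \<open>G\<close>. Gronwall's inequality with the Lipschitz bound of \<open>G0\<close> alone reduces the estimate of \<open>y - x0\<close> to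
  that of the integral of \<open>norm (G - G0)\<close> along \<open>(y(t), y(t - 1))\<close>; if it is small, then \<open>y\<close> stays in the ball and is
  the solution for \<open>G\<close>. The bounds of \<open>f\<close> pass to the hull. By the integral Lipschitz bounds, in case (ii)
  the point \<open>(y(t), y(t - 1))\<close> may be replaced by the points of a finite net of \<open>D\<close>. In case (i) this works only
  for \<open>y(t - 1)\<close>, with a net of \<open>D'\<close>, but \<open>y\<close> itself has the moduli of continuity given by the m-bounds, so the
  seminorms control the curves \<open>(y(t), u)\<close>.\<close>


text \<open>The order of quantifiers is the obstacle. A neighbourhood of \<open>G0\<close> has to be
  fixed before \<open>G\<close>, and hence its solution \<open>y\<close>, is known, so every
  estimate must be uniform over all candidates for \<open>y\<close>. Clipping supplies candidates on
  the whole time interval, with values in a fixed ball, before anything is known about blow-up. In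
  case (i) no Lipschitz bound in the current state is assumed to be common to the hull; comparing
  with the fixed \<open>G0\<close> and keeping all of \<open>G - G0\<close> as an error integral
  avoids the need for one. Bounding this integral is isolated as
  \<open>mean_continuous_along_solutions\<close>, and the two cases differ only in how they do it.
  Both topologies are generated by suprema of mean values along families of curves, constant curves
  in case (ii), so continuity of translations and invariance of the hull are proved once, for
  \<open>curve_topology\<close>. The norm of \<open>C11\<close> also asks for closeness of
  velocities in mean. Therefore the comparison bounds the velocities in L1 besides the values, and
  continuity in time rests on the continuity of translations in L1.\<close>

section \<open>Integrals and null sets on compact intervals\<close>

lemma abs_integrable_iff_lebesgue_on:
  fixes f :: "real \<Rightarrow> 'a::euclidean_space"
  shows "f absolutely_integrable_on {a..b} \<longleftrightarrow> integrable (lebesgue_on {a..b}) f"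
  by (simp add: integrable_restrict_space set_integrable_def)

lemma integral_lebesgue_on:
  fixes f :: "real \<Rightarrow> 'a::euclidean_space"
  assumes "f absolutely_integrable_on {a..b}"
  shows "integral\<^sup>L (lebesgue_on {a..b}) f = integral {a..b} f"
  using assms by (simp add: abs_integrable_iff_lebesgue_on lebesgue_integral_eq_integral)

lemma AE_lebesgue_on_Icc:
  "(AE t in lebesgue_on {a..b::real}. P t) \<longleftrightarrow> (AE t in lebesgue. t \<in> {a..b} \<longrightarrow> P t)"
  by (simp add: AE_restrict_space_iff)

lemma AE_lebesgue_negligible:
  assumes "AE t in lebesgue. P (t::'a::euclidean_space)"
  obtains N where "negligible N" "\<And>t. t \<notin> N \<Longrightarrow> P t"
proof -
  obtain N where "N \<in> null_sets lebesgue" "{s. \<not> P s} \<subseteq> N"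
    using assms by (auto simp: eventually_ae_filter)
  then show ?thesis
    using that[of N] by (auto simp: negligible_iff_null_sets)
qed

lemma negligible_AE_lebesgue:
  assumes "negligible N" "\<And>t. t \<notin> N \<Longrightarrow> P (t::'a::euclidean_space)"
  shows "AE t in lebesgue. P t"
  using assms by (auto simp: eventually_ae_filter negligible_iff_null_sets intro!: bexI[of _ N])

lemma absolutely_integrable_bound_AE:
  fixes f :: "real \<Rightarrow> 'a::euclidean_space" and m :: "real \<Rightarrow> real"
  assumes "f \<in> borel_measurable (lebesgue_on {a..b})" "m absolutely_integrable_on {a..b}"
    and "AE t in lebesgue. t \<in> {a..b} \<longrightarrow> norm (f t) \<le> m t"
  shows "f absolutely_integrable_on {a..b}"
  unfolding abs_integrable_iff_lebesgue_on
  by (rule Bochner_Integration.integrable_bound[of _ m])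
     (use assms in \<open>auto simp: abs_integrable_iff_lebesgue_on[symmetric] AE_lebesgue_on_Icc\<close>)

lemma integral_mono_AE_Icc:
  fixes f g :: "real \<Rightarrow> real"
  assumes "f integrable_on {a..b}" "g integrable_on {a..b}"
    and "AE t in lebesgue. t \<in> {a..b} \<longrightarrow> f t \<le> g t"
  shows "integral {a..b} f \<le> integral {a..b} g"
proof -
  obtain N where N: "negligible N" "\<And>t. t \<notin> N \<Longrightarrow> t \<in> {a..b} \<longrightarrow> f t \<le> g t"
    using AE_lebesgue_negligible[OF assms(3)] by blast
  \<comment> \<open>Changing \<open>g\<close> on the exceptional null set turns the
    almost-everywhere inequality into a pointwise one and keeps the integral.\<close>
  define h where "h t = (if t \<in> N then f t else g t)" for t
  have "h integrable_on {a..b}" "integral {a..b} h = integral {a..b} g"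
    using N(1) assms(2) by (auto simp: h_def intro: integrable_spike integral_spike)
  moreover have "integral {a..b} f \<le> integral {a..b} h"
    using assms(1) calculation(1) N by (intro integral_le) (auto simp: h_def)
  ultimately show ?thesis by simp
qed

lemma integral_cong_AE_Icc:
  fixes f g :: "real \<Rightarrow> 'a::euclidean_space"
  assumes "AE t in lebesgue. t \<in> {a..b} \<longrightarrow> f t = g t"
  shows "integral {a..b} f = integral {a..b} g"
  using AE_lebesgue_negligible[OF assms] by (metis (no_types, lifting) DiffE integral_spike)

lemma set_nn_integral_eq_integral_norm:
  fixes f :: "real \<Rightarrow> 'a::euclidean_space"
  assumes "f absolutely_integrable_on {a..b}"
  shows "(\<integral>\<^sup>+t\<in>{a..b}. ennreal (norm (f t)) \<partial>lebesgue) = ennreal (integral {a..b} (\<lambda>t. norm (f t)))"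
proof -
  have "((\<lambda>t. norm (f t)) has_integral integral {a..b} (\<lambda>t. norm (f t))) {a..b}"
    using assms by (simp add: absolutely_integrable_on_def integrable_integral)
  from nn_integral_has_integral_lebesgue'[OF _ this] show ?thesis
    by (simp add: nn_integral_completion)
qed

lemma norm_integral_le_integral_norm:
  fixes f :: "real \<Rightarrow> 'a::euclidean_space"
  assumes "f absolutely_integrable_on {a..b}"
  shows "norm (integral {a..b} f) \<le> integral {a..b} (\<lambda>t. norm (f t))"
  using assms by (intro integral_norm_bound_integral) (auto simp: absolutely_integrable_on_def)

lemma absolutely_integrable_subinterval_Icc:
  fixes f :: "real \<Rightarrow> 'a::euclidean_space"
  assumes "f absolutely_integrable_on {a..b}" "{c..d} \<subseteq> {a..b}"
  shows "f absolutely_integrable_on {c..d}"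
  using absolutely_integrable_on_subinterval[OF assms] .

subsection \<open>Translations in the mean\<close>

text \<open>The nearest-point map of a ball is nonexpansive because the ball is convex. It bounds
  functions without spoiling continuity, Lipschitz constants or moduli of continuity; it serves both
  the density argument below and the truncated delay equation.\<close>

abbreviation clip :: "real \<Rightarrow> 'a::euclidean_space \<Rightarrow> 'a" where
  "clip r \<equiv> closest_point (cball 0 r)"

lemma clip_in: "0 \<le> r \<Longrightarrow> clip r x \<in> cball 0 r"
  by (intro closest_point_in_set) auto

lemma norm_clip: "0 \<le> r \<Longrightarrow> norm (clip r x) \<le> r"
  using clip_in[of r x] by simp

lemma clip_self: "norm x \<le> r \<Longrightarrow> clip r x = x"
  by (intro closest_point_self) auto

lemma clip_lipschitz: "0 \<le> r \<Longrightarrow> norm (clip r x - clip r y) \<le> norm (x - y)"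
  using closest_point_lipschitz[of "cball 0 r" x y] by (simp add: dist_norm)

lemma continuous_clip: "0 \<le> r \<Longrightarrow> continuous_on S (clip r)"
  by (intro continuous_on_closest_point) auto

lemma norm_diff_clip: "0 \<le> r \<Longrightarrow> norm (x - clip r x) \<le> norm x"
  using closest_point_le[of "cball 0 r" 0 x] by (simp add: dist_norm)

text \<open>Density of continuous functions by two dominated convergences: first \<open>h\<close> is
  clipped at level \<open>n\<close>, dominated by \<open>norm h\<close>; then the bounded function
  is approached almost everywhere by the continuous functions that the definition of
  \<open>measurable_on\<close> supplies.\<close>

lemma absolutely_integrable_continuous_approx:
  fixes h :: "real \<Rightarrow> 'a::euclidean_space"
  assumes h: "h absolutely_integrable_on {a..b}" and "e > 0"
  obtains g where "continuous_on UNIV g" "integral {a..b} (\<lambda>t. norm (h t - g t)) < e"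
proof -
  let ?M = "lebesgue_on {a..b}"
  have hM: "integrable ?M h"
    using h by (simp add: abs_integrable_iff_lebesgue_on)
  then have [measurable]: "h \<in> borel_measurable ?M" by auto
  have [measurable]: "clip (real n) \<in> borel_measurable (borel :: 'a measure)" for n
    by (intro borel_measurable_continuous_onI continuous_clip) auto
  have "(\<lambda>n. LINT t|?M. norm (h t - clip (real n) (h t))) \<longlonglongrightarrow> (LINT t|?M. 0)"
  proof (rule integral_dominated_convergence[where w = "\<lambda>t. norm (h t)"])
    show "AE t in ?M. (\<lambda>n. norm (h t - clip (real n) (h t))) \<longlonglongrightarrow> 0"
    proof (intro AE_I2 tendsto_eventually)
      fix t
      obtain k :: nat where "norm (h t) \<le> real k" using real_arch_simple by blast
      then show "\<forall>\<^sub>F n in sequentially. norm (h t - clip (real n) (h t)) = 0"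
        unfolding eventually_sequentially
        by (intro exI[of _ k]) (auto simp: clip_self)
    qed
  qed (use hM in \<open>auto intro!: norm_diff_clip AE_I2\<close>)
  then obtain n where n: "(LINT t|?M. norm (h t - clip (real n) (h t))) < e / 2"
    using \<open>e > 0\<close> order_tendstoD(2)[of _ 0 sequentially "e/2"]
    by (force simp: eventually_sequentially)
  let ?k = "\<lambda>t. clip (real n) (h t)"
  have kM: "integrable ?M ?k"
    by (rule integrableI_bounded_set[where A = "{a..b}" and B = "real n"])
       (auto simp: norm_clip emeasure_restrict_space emeasure_lborel_Icc_eq)
  have "?k measurable_on {a..b}"
    by (simp add: measurable_on_iff_borel_measurable)
  then obtain N g where N: "negligible N" and cg: "\<And>m. continuous_on UNIV (g m)"
    and g: "\<And>x. x \<notin> N \<Longrightarrow> (\<lambda>m. g m x) \<longlonglongrightarrow> (if x \<in> {a..b} then ?k x else 0)"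
    unfolding measurable_on_def by metis
  \<comment> \<open>The approximants are clipped at the same level \<open>n\<close>: they stay
    continuous, and \<open>2 * real n\<close> becomes a dominating constant.\<close>
  have cg': "continuous_on UNIV (\<lambda>t. clip (real n) (g m t))" for m
    by (rule continuous_on_compose2[OF continuous_clip[of _ UNIV] cg]) auto
  have [measurable]: "(\<lambda>t. clip (real n) (g m t)) \<in> borel_measurable ?M" for m
    by (intro measurable_restrict_space1 measurable_completion)
       (simp add: borel_measurable_continuous_onI cg')
  have "(\<lambda>m. LINT t|?M. norm (?k t - clip (real n) (g m t))) \<longlonglongrightarrow> (LINT t|?M. 0)"
  proof (rule integral_dominated_convergence[where w = "\<lambda>t. 2 * real n"])
    have "(\<lambda>m. norm (?k t - clip (real n) (g m t))) \<longlonglongrightarrow> 0" if "t \<notin> N" "t \<in> {a..b}" for t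
    proof -
      have "(\<lambda>m. clip (real n) (g m t)) \<longlonglongrightarrow> clip (real n) (?k t)"
        using g[of t] that
        by (intro continuous_on_tendsto_compose[OF continuous_clip[of _ UNIV]]) auto
      moreover have "clip (real n) (?k t) = ?k t"
        by (simp add: clip_self norm_clip)
      ultimately show ?thesis
        using tendsto_norm_zero[OF LIM_zero] by (fastforce simp: norm_minus_commute)
    qed
    then show "AE t in ?M. (\<lambda>m. norm (?k t - clip (real n) (g m t))) \<longlonglongrightarrow> 0"
      unfolding AE_lebesgue_on_Icc by (intro negligible_AE_lebesgue[OF N]) auto
    show "AE t in ?M. norm (norm (?k t - clip (real n) (g m t))) \<le> 2 * real n" for m
    proof (intro AE_I2)
      fix t
      have "norm (?k t) \<le> real n" "norm (clip (real n) (g m t)) \<le> real n" by (simp_all add: norm_clip)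
      then show "norm (norm (?k t - clip (real n) (g m t))) \<le> 2 * real n"
        using norm_triangle_ineq4[of "?k t" "clip (real n) (g m t)"] by simp
    qed
    show "integrable ?M (\<lambda>t. 2 * real n)"
      unfolding abs_integrable_iff_lebesgue_on[symmetric]
      by (intro absolutely_integrable_continuous_real continuous_intros)
  qed auto
  then obtain m where m: "(LINT t|?M. norm (?k t - clip (real n) (g m t))) < e / 2"
    using \<open>e > 0\<close> order_tendstoD(2)[of _ 0 sequentially "e/2"]
    by (force simp: eventually_sequentially)
  let ?g = "\<lambda>t. clip (real n) (g m t)"
  have gM: "integrable ?M ?g"
    by (rule integrableI_bounded_set[where A = "{a..b}" and B = "real n"])
       (auto simp: norm_clip emeasure_restrict_space emeasure_lborel_Icc_eq)
  have "(LINT t|?M. norm (h t - ?g t)) \<le> (LINT t|?M. norm (h t - ?k t) + norm (?k t - ?g t))"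
  proof (rule integral_mono)
    show "norm (h t - ?g t) \<le> norm (h t - ?k t) + norm (?k t - ?g t)" for t
      by (rule order_trans[OF _ norm_triangle_ineq]) simp
  qed (use hM kM gM in auto)
  also have "\<dots> = (LINT t|?M. norm (h t - ?k t)) + (LINT t|?M. norm (?k t - ?g t))"
    using hM kM gM by (intro Bochner_Integration.integral_add) auto
  also have "\<dots> < e" using n m by simp
  also have "(LINT t|?M. norm (h t - ?g t)) = integral {a..b} (\<lambda>t. norm (h t - ?g t))"
    using hM gM by (intro integral_lebesgue_on) (auto simp: abs_integrable_iff_lebesgue_on)
  finally show ?thesis using that cg' by blast
qed

lemma absolutely_integrable_translate:
  fixes h :: "real \<Rightarrow> 'a::euclidean_space"
  assumes "h absolutely_integrable_on {a + t..b + t}"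
  shows "(\<lambda>s. h (s + t)) absolutely_integrable_on {a..b}"
  using assms integrable_shift_real_ivl[of h "a + t" "b + t" t]
    integrable_shift_real_ivl[of "\<lambda>s. norm (h s)" "a + t" "b + t" t]
  by (simp add: absolutely_integrable_on_def)

lemma integral_translate_Icc:
  fixes h :: "real \<Rightarrow> 'a::euclidean_space"
  shows "integral {a..b} (\<lambda>s. h (s + t)) = integral {a + t..b + t} h"
  using integral_shift_real_ivl[of "a + t" t "b + t" h] by simp

lemma abs_integrable_norm_Icc:
  fixes h :: "real \<Rightarrow> 'a::euclidean_space"
  assumes "h absolutely_integrable_on {a..b}"
  shows "(\<lambda>t. norm (h t)) integrable_on {a..b}"
  using assms by (simp add: absolutely_integrable_on_def)

lemma continuous_abs_integrable_Icc:
  fixes h :: "real \<Rightarrow> 'a::euclidean_space"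
  shows "continuous_on UNIV h \<Longrightarrow> h absolutely_integrable_on {a..b}"
  by (meson absolutely_integrable_continuous_real continuous_on_subset top_greatest)

lemma integral_norm_triangle:
  fixes f g h :: "real \<Rightarrow> 'a::euclidean_space"
  assumes "f absolutely_integrable_on {a..b}" "g absolutely_integrable_on {a..b}"
    "h absolutely_integrable_on {a..b}"
  shows "integral {a..b} (\<lambda>t. norm (f t - h t)) \<le>
    integral {a..b} (\<lambda>t. norm (f t - g t)) + integral {a..b} (\<lambda>t. norm (g t - h t))"
proof -
  have i: "(\<lambda>t. norm (f t - h t)) integrable_on {a..b}" "(\<lambda>t. norm (f t - g t)) integrable_on {a..b}"
    "(\<lambda>t. norm (g t - h t)) integrable_on {a..b}"
    using assms by (intro abs_integrable_norm_Icc set_integral_diff; simp)+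
  then show ?thesis
    unfolding Henstock_Kurzweil_Integration.integral_add[OF i(2,3), symmetric]
    by (intro integral_le integrable_add i norm_diff_triangle_le[OF order_refl order_refl])
qed

lemma integral_subset_Icc_nonneg:
  fixes f :: "real \<Rightarrow> real"
  assumes "f integrable_on {a..b}" "{c..d} \<subseteq> {a..b}" "\<And>t. 0 \<le> f t"
  shows "integral {c..d} f \<le> integral {a..b} f"
  using assms integrable_on_subinterval[OF assms(1,2)] by (intro integral_subset_le) auto

text \<open>For continuous functions this is uniform continuity, and density gives the rest by a
  three-term estimate. The margin 1 on both sides keeps the translates inside the interval of
  integrability, which is the reason for \<open>d \<le> 1\<close>.\<close>

lemma translation_continuous_L1:
  fixes h :: "real \<Rightarrow> 'a::euclidean_space"
  assumes h: "h absolutely_integrable_on {a - 1..b + 1}" and e: "e > 0"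
  obtains d where "0 < d" "d \<le> 1"
    "\<And>t. \<bar>t\<bar> < d \<Longrightarrow> integral {a..b} (\<lambda>s. norm (h (s + t) - h s)) < e"
proof (cases "a \<le> b")
  case False
  then show ?thesis using that[of 1] e by simp
next
  case ab: True
  obtain g where g: "continuous_on UNIV g"
    and hg: "integral {a - 1..b + 1} (\<lambda>t. norm (h t - g t)) < e / 3"
    using absolutely_integrable_continuous_approx[OF h, of "e / 3"] e by auto
  have "uniformly_continuous_on {a - 1..b + 1} g"
    using g by (intro compact_uniformly_continuous) (auto intro: continuous_on_subset)
  \<comment> \<open>The \<open>+ 1\<close> covers \<open>a = b\<close> and makes the total error
    strictly less than \<open>e / 3\<close>.\<close>
  moreover define k where "k = e / (3 * (b - a + 1))"
  have k: "k > 0" using e ab by (simp add: k_def)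
  ultimately obtain d where d: "d > 0" and gd: "\<And>x y. x \<in> {a - 1..b + 1} \<Longrightarrow> y \<in> {a - 1..b + 1} \<Longrightarrow>
      dist x y < d \<Longrightarrow> dist (g x) (g y) < k"
    unfolding uniformly_continuous_on_def by metis
  show ?thesis
  proof (rule that[of "min d 1"])
    fix t :: real assume t: "\<bar>t\<bar> < min d 1"
    have ai: "h absolutely_integrable_on {a..b}" "(\<lambda>s. h (s + t)) absolutely_integrable_on {a..b}"
      using t by (auto intro!: absolutely_integrable_translate absolutely_integrable_subinterval_Icc[OF h])
    have cg: "g absolutely_integrable_on {c..d}" "(\<lambda>s. g (s + t)) absolutely_integrable_on {c..d}" for c d
      by (intro continuous_abs_integrable_Icc g continuous_on_compose2[OF g, where s = UNIV] continuous_intros; simp)+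
    have hgi: "(\<lambda>s. norm (h s - g s)) integrable_on {a - 1..b + 1}"
      using h cg by (intro abs_integrable_norm_Icc set_integral_diff) auto
    have 1: "integral {a..b} (\<lambda>s. norm (h (s + t) - g (s + t))) < e / 3"
      unfolding integral_translate_Icc[of a b "\<lambda>s. norm (h s - g s)"]
      by (rule le_less_trans[OF integral_subset_Icc_nonneg[OF hgi] hg]) (use t in auto)
    have "integral {a..b} (\<lambda>s. norm (h s - g s)) < e / 3"
      by (rule le_less_trans[OF integral_subset_Icc_nonneg[OF hgi] hg]) auto
    then have 2: "integral {a..b} (\<lambda>s. norm (g s - h s)) < e / 3"
      by (simp add: norm_minus_commute)
    have "integral {a..b} (\<lambda>s. norm (g (s + t) - g s)) \<le> integral {a..b} (\<lambda>s. k)"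
    proof (intro integral_le abs_integrable_norm_Icc set_integral_diff cg)
      show "norm (g (s + t) - g s) \<le> k" if "s \<in> {a..b}" for s
        using gd[of "s + t" s] that t by (simp add: dist_norm abs_less_iff)
    qed auto
    also have "\<dots> = (b - a) * k" using ab by simp
    also have "\<dots> < (b - a + 1) * k" using k by (simp add: algebra_simps)
    also have "\<dots> = e / 3"
      using ab unfolding k_def by (simp add: field_simps)
    finally have 3: "integral {a..b} (\<lambda>s. norm (g (s + t) - g s)) < e / 3" .
    show "integral {a..b} (\<lambda>s. norm (h (s + t) - h s)) < e"
      using integral_norm_triangle[OF ai(2) cg(2) ai(1)]
        integral_norm_triangle[OF cg(2) cg(1) ai(1)] 1 2 3 by linarith
  qed (use d in auto)
qed

subsection \<open>Absolute continuity\<close>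

text \<open>The definition of absolute continuity uses families indexed by an initial segment of the
  naturals. Tagged divisions are finite sets, so the index type is freed here; below it is the type
  of tagged intervals.\<close>

lemma abs_continuous_on_finite:
  assumes "abs_continuous_on a b x" "e > 0"
  shows "\<exists>d>0. \<forall>(J::'i set) s t. finite J \<and> (\<forall>i\<in>J. a \<le> s i \<and> s i \<le> t i \<and> t i \<le> b) \<and>
    disjoint_family_on (\<lambda>i. {s i<..<t i}) J \<and> (\<Sum>i\<in>J. t i - s i) < d \<longrightarrow>
    (\<Sum>i\<in>J. norm (x (t i) - x (s i))) < e"
proof -
  obtain d where d: "d > 0" and *: "\<forall>(n::nat) s t. (\<forall>i<n. a \<le> s i \<and> s i \<le> t i \<and> t i \<le> b) \<and>
        disjoint_family_on (\<lambda>i. {s i<..<t i}) {..<n} \<and> (\<Sum>i<n. t i - s i) < d \<longrightarrow>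
        (\<Sum>i<n. norm (x (t i) - x (s i))) < e"
    using assms(1)[unfolded abs_continuous_on_def, rule_format, OF assms(2)] by blast
  show ?thesis
  proof (intro exI[of _ d] conjI allI impI)
    fix J :: "'i set" and s t
    assume "finite J \<and> (\<forall>i\<in>J. a \<le> s i \<and> s i \<le> t i \<and> t i \<le> b) \<and>
      disjoint_family_on (\<lambda>i. {s i<..<t i}) J \<and> (\<Sum>i\<in>J. t i - s i) < d"
    then have J: "finite J" "\<And>i. i \<in> J \<Longrightarrow> a \<le> s i \<and> s i \<le> t i \<and> t i \<le> b"
      "disjoint_family_on (\<lambda>i. {s i<..<t i}) J" "(\<Sum>i\<in>J. t i - s i) < d"
      by auto
    obtain h where h: "bij_betw h {..<card J} J"
      using ex_bij_betw_nat_finite[OF J(1)] by (auto simp: atLeast0LessThan)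
    have eq: "(\<Sum>i<card J. F (h i)) = sum F J" for F :: "'i \<Rightarrow> real"
      by (rule sum.reindex_bij_betw[OF h])
    have "(\<Sum>i<card J. norm (x (t (h i)) - x (s (h i)))) < e"
    proof (rule *[rule_format], intro conjI)
      show "\<forall>i<card J. a \<le> s (h i) \<and> s (h i) \<le> t (h i) \<and> t (h i) \<le> b"
        using J(2) bij_betwE[OF h] by auto
      show "disjoint_family_on (\<lambda>i. {s (h i)<..<t (h i)}) {..<card J}"
        unfolding disjoint_family_on_def
      proof (intro ballI impI)
        fix i k assume "i \<in> {..<card J}" "k \<in> {..<card J}" "i \<noteq> k"
        then have "h i \<in> J" "h k \<in> J" "h i \<noteq> h k"
          using h by (auto simp: bij_betw_def inj_on_def)
        then show "{s (h i)<..<t (h i)} \<inter> {s (h k)<..<t (h k)} = {}"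
          using J(3) by (auto simp: disjoint_family_on_def)
      qed
      show "(\<Sum>i<card J. t (h i) - s (h i)) < d"
        using J(4) eq[of "\<lambda>i. t i - s i"] by simp
    qed
    then show "(\<Sum>i\<in>J. norm (x (t i) - x (s i))) < e"
      using eq[of "\<lambda>i. norm (x (t i) - x (s i))"] by simp
  qed (rule d)
qed

lemma abs_continuous_on_diff:
  fixes x y :: "real \<Rightarrow> 'a::real_normed_vector"
  assumes "abs_continuous_on a b x" "abs_continuous_on a b y"
  shows "abs_continuous_on a b (\<lambda>t. x t - y t)"
  unfolding abs_continuous_on_def
proof (intro allI impI)
  fix e :: real assume "e > 0"
  then have "e / 2 > 0" by simp
  obtain d1 where d1: "d1 > 0" "\<forall>(n::nat) s t. (\<forall>i<n. a \<le> s i \<and> s i \<le> t i \<and> t i \<le> b) \<and>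
        disjoint_family_on (\<lambda>i. {s i<..<t i}) {..<n} \<and> (\<Sum>i<n. t i - s i) < d1 \<longrightarrow>
        (\<Sum>i<n. norm (x (t i) - x (s i))) < e / 2"
    using assms(1)[unfolded abs_continuous_on_def, rule_format, OF \<open>e / 2 > 0\<close>] by blast
  obtain d2 where d2: "d2 > 0" "\<forall>(n::nat) s t. (\<forall>i<n. a \<le> s i \<and> s i \<le> t i \<and> t i \<le> b) \<and>
        disjoint_family_on (\<lambda>i. {s i<..<t i}) {..<n} \<and> (\<Sum>i<n. t i - s i) < d2 \<longrightarrow>
        (\<Sum>i<n. norm (y (t i) - y (s i))) < e / 2"
    using assms(2)[unfolded abs_continuous_on_def, rule_format, OF \<open>e / 2 > 0\<close>] by blast
  show "\<exists>d>0. \<forall>(n::nat) s t. (\<forall>i<n. a \<le> s i \<and> s i \<le> t i \<and> t i \<le> b) \<and>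
        disjoint_family_on (\<lambda>i. {s i<..<t i}) {..<n} \<and> (\<Sum>i<n. t i - s i) < d \<longrightarrow>
        (\<Sum>i<n. norm (x (t i) - y (t i) - (x (s i) - y (s i)))) < e"
  proof (intro exI[of _ "min d1 d2"] conjI allI impI)
    fix n :: nat and s t :: "nat \<Rightarrow> real"
    assume *: "(\<forall>i<n. a \<le> s i \<and> s i \<le> t i \<and> t i \<le> b) \<and>
        disjoint_family_on (\<lambda>i. {s i<..<t i}) {..<n} \<and> (\<Sum>i<n. t i - s i) < min d1 d2"
    have "(\<Sum>i<n. norm (x (t i) - y (t i) - (x (s i) - y (s i)))) \<le>
        (\<Sum>i<n. norm (x (t i) - x (s i)) + norm (y (t i) - y (s i)))"
    proof (rule sum_mono)
      fix i
      show "norm (x (t i) - y (t i) - (x (s i) - y (s i))) \<le> norm (x (t i) - x (s i)) + norm (y (t i) - y (s i))"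
        using norm_triangle_ineq4[of "x (t i) - x (s i)" "y (t i) - y (s i)"] by (simp add: algebra_simps)
    qed
    also have "\<dots> < e"
      using d1(2)[rule_format, of n s t] d2(2)[rule_format, of n s t] * by (simp add: sum.distrib)
    finally show "(\<Sum>i<n. norm (x (t i) - y (t i) - (x (s i) - y (s i)))) < e" .
  qed (use d1 d2 in auto)
qed

lemma abs_continuous_on_subinterval:
  assumes "abs_continuous_on a b x" "a \<le> c" "d \<le> b"
  shows "abs_continuous_on c d x"
  unfolding abs_continuous_on_def
proof (intro allI impI)
  fix e :: real assume e: "e > 0"
  obtain \<delta> where "\<delta> > 0" and *: "\<forall>(n::nat) s t. (\<forall>i<n. a \<le> s i \<and> s i \<le> t i \<and> t i \<le> b) \<and>
        disjoint_family_on (\<lambda>i. {s i<..<t i}) {..<n} \<and> (\<Sum>i<n. t i - s i) < \<delta> \<longrightarrow>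
        (\<Sum>i<n. norm (x (t i) - x (s i))) < e"
    using assms(1)[unfolded abs_continuous_on_def, rule_format, OF e] by blast
  show "\<exists>\<delta>>0. \<forall>(n::nat) s t. (\<forall>i<n. c \<le> s i \<and> s i \<le> t i \<and> t i \<le> d) \<and>
        disjoint_family_on (\<lambda>i. {s i<..<t i}) {..<n} \<and> (\<Sum>i<n. t i - s i) < \<delta> \<longrightarrow>
        (\<Sum>i<n. norm (x (t i) - x (s i))) < e"
  proof (intro exI[of _ \<delta>] conjI allI impI)
    fix n :: nat and s t :: "nat \<Rightarrow> real"
    assume st: "(\<forall>i<n. c \<le> s i \<and> s i \<le> t i \<and> t i \<le> d) \<and>
        disjoint_family_on (\<lambda>i. {s i<..<t i}) {..<n} \<and> (\<Sum>i<n. t i - s i) < \<delta>"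
    then have "\<forall>i<n. a \<le> s i \<and> s i \<le> t i \<and> t i \<le> b"
      using assms(2,3) by (meson order_trans)
    with st show "(\<Sum>i<n. norm (x (t i) - x (s i))) < e"
      by (intro *[rule_format]) blast
  qed (use \<open>\<delta> > 0\<close> in auto)
qed

text \<open>At points with zero derivative a gauge can be so small that each tagged interval changes
  \<open>x\<close> by at most \<open>e\<close> times its length. Intervals tagged in the exceptional
  null set lie in an open set of measure below \<open>d\<close>, and absolute continuity bounds
  their total contribution by \<open>e\<close>.\<close>

lemma abs_continuous_zero_derivative_const:
  fixes x :: "real \<Rightarrow> 'a::euclidean_space"
  assumes ac: "abs_continuous_on a b x" and ab: "a \<le> b"
    and der: "AE t in lebesgue. t \<in> {a<..<b} \<longrightarrow> (x has_vector_derivative 0) (at t)"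
  shows "x b = x a"
proof -
  obtain N0 where "negligible N0" and N0: "\<And>t. t \<notin> N0 \<Longrightarrow> t \<in> {a<..<b} \<longrightarrow> (x has_vector_derivative 0) (at t)"
    using AE_lebesgue_negligible[OF der] by blast
  \<comment> \<open>The derivative is known only in the open interval, so the endpoints join the
    null set.\<close>
  define N where "N = N0 \<union> {a, b}"
  have N: "negligible N" using \<open>negligible N0\<close> by (simp add: N_def negligible_Un)
  have "norm (x b - x a) \<le> e * (b - a) + e" if e: "e > 0" for e
  proof -
    obtain d where d: "d > 0" and acd: "\<forall>(J::(real \<times> real set) set) s t. finite J \<and>
        (\<forall>i\<in>J. a \<le> s i \<and> s i \<le> t i \<and> t i \<le> b) \<and>
        disjoint_family_on (\<lambda>i. {s i<..<t i}) J \<and> (\<Sum>i\<in>J. t i - s i) < d \<longrightarrow>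
        (\<Sum>i\<in>J. norm (x (t i) - x (s i))) < e"
      using abs_continuous_on_finite[OF ac e, where ?'i = "real \<times> real set"] by blast
    obtain T where T: "open T" "N \<subseteq> T" "emeasure lebesgue (T - N) < ennreal d"
      using sets_lebesgue_outer_open[OF negligible_imp_sets[OF N] d] by metis
    have "emeasure lebesgue T \<le> emeasure lebesgue ((T - N) \<union> N)"
      using T N by (intro emeasure_mono) (auto simp: negligible_imp_sets)
    also have "\<dots> \<le> emeasure lebesgue (T - N) + emeasure lebesgue N"
      using T N by (intro emeasure_subadditive) (auto simp: negligible_imp_sets)
    also have "emeasure lebesgue N = 0"
      using N by (meson negligible_iff_null_sets null_setsD1)
    finally have Td: "emeasure lebesgue T < ennreal d" using T by simp
    have "\<exists>r>0. \<forall>s. \<bar>s - t\<bar> < r \<longrightarrow> norm (x s - x t) \<le> e * \<bar>s - t\<bar>" if "t \<in> {a..b}" "t \<notin> N" for t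
    proof -
      have "(x has_derivative (\<lambda>_. 0)) (at t)"
        using N0[of t] that by (auto simp: N_def has_vector_derivative_def)
      then show ?thesis
        using e unfolding has_derivative_within_alt by (auto simp: norm_minus_commute)
    qed
    then obtain r where r: "\<And>t. t \<in> {a..b} \<Longrightarrow> t \<notin> N \<Longrightarrow> r t > 0"
      "\<And>t s. t \<in> {a..b} \<Longrightarrow> t \<notin> N \<Longrightarrow> \<bar>s - t\<bar> < r t \<Longrightarrow> norm (x s - x t) \<le> e * \<bar>s - t\<bar>"
      by metis
    \<comment> \<open>Exceptional points share the thin open set \<open>T\<close>; the others get a
      radius on which the difference quotient is at most \<open>e\<close>. The last branch completes
      the gauge off the interval.\<close>
    define \<gamma> where "\<gamma> t = (if t \<in> N then T else if t \<in> {a..b} then ball t (r t) else ball t 1)" for t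
    have "gauge \<gamma>"
      using T r by (auto simp: gauge_def \<gamma>_def)
    then obtain p where p: "p tagged_division_of {a..b}" and fp: "\<gamma> fine p"
      by (rule fine_division_exists_real)
    have fin: "finite p" using p by auto
    have K: "\<exists>u v. u \<le> v \<and> a \<le> u \<and> v \<le> b \<and> K = {u..v} \<and> t \<in> {u..v} \<and> K \<subseteq> \<gamma> t" if tK: "(t, K) \<in> p" for t K
    proof -
      obtain u v where "K = cbox u v"
        using tagged_division_ofD(4)[OF p tK] by blast
      moreover have "t \<in> K" "K \<subseteq> {a..b}"
        using tagged_division_ofD(2,3)[OF p tK] by auto
      moreover have "K \<subseteq> \<gamma> t" using fp tK by (auto simp: fine_def)
      ultimately show ?thesis by (intro exI[of _ u] exI[of _ v]) auto
    qed
    let ?D = "\<lambda>(t, K). norm (x (Sup K) - x (Inf K))"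
    let ?l = "\<lambda>i. Inf (snd i)" and ?r = "\<lambda>i. Sup (snd i)"
    define p1 where "p1 = {i \<in> p. fst i \<in> N}"
    define p2 where "p2 = {i \<in> p. fst i \<notin> N}"
    have p12: "p = p1 \<union> p2" "p1 \<inter> p2 = {}" "finite p1" "finite p2"
      using fin by (auto simp: p1_def p2_def)
    have "(\<Sum>(t, K)\<in>p. x (Sup K) - x (Inf K)) = x b - x a"
      by (rule additive_tagged_division_1[OF ab p])
    then have "norm (x b - x a) \<le> sum ?D p"
      by (metis (mono_tags, lifting) norm_sum order_trans sum_mono case_prod_unfold order_refl)
    also have "\<dots> = sum ?D p1 + sum ?D p2"
      using p12 by (simp add: sum.union_disjoint)
    also have "sum ?D p2 \<le> (\<Sum>i\<in>p2. e * (?r i - ?l i))"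
    proof (rule sum_mono, clarify)
      fix t K assume "(t, K) \<in> p2"
      then have tK: "(t, K) \<in> p" "t \<notin> N" by (auto simp: p2_def)
      obtain u v where uv: "u \<le> v" "a \<le> u" "v \<le> b" "K = {u..v}" "t \<in> {u..v}" "K \<subseteq> \<gamma> t"
        using K[OF tK(1)] by blast
      then have t: "t \<in> {a..b}" by auto
      have "u \<in> ball t (r t)" "v \<in> ball t (r t)"
        using uv t tK by (auto simp: \<gamma>_def subset_iff)
      then have "norm (x u - x t) \<le> e * \<bar>u - t\<bar>" "norm (x v - x t) \<le> e * \<bar>v - t\<bar>"
        using r(2)[OF t tK(2), of u] r(2)[OF t tK(2), of v]
        by (auto simp: dist_real_def abs_minus_commute)
      moreover have "norm (x v - x u) \<le> norm (x v - x t) + norm (x u - x t)"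
        using norm_triangle_ineq4[of "x v - x t" "x u - x t"] by simp
      ultimately have "norm (x v - x u) \<le> e * (v - t) + e * (t - u)"
        using uv by auto
      then show "norm (x (Sup K) - x (Inf K)) \<le> e * (?r (t, K) - ?l (t, K))"
        using uv by (simp add: algebra_simps)
    qed
    also have "\<dots> \<le> (\<Sum>i\<in>p. e * (?r i - ?l i))"
    proof (rule sum_mono2)
      fix i assume "i \<in> p - p2"
      then show "0 \<le> e * (?r i - ?l i)"
        using K[of "fst i" "snd i"] e by (cases i) auto
    qed (use p12 fin in auto)
    also have "\<dots> = e * (b - a)"
      using additive_tagged_division_1[OF ab p, of "\<lambda>t. t"]
      by (simp add: sum_distrib_left[symmetric] case_prod_unfold)
    also have "sum ?D p1 < e"
    proof -
      have "(\<Sum>i\<in>p1. norm (x (?r i) - x (?l i))) < e"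
      proof (rule acd[rule_format], intro conjI)
        show b1: "\<forall>i\<in>p1. a \<le> ?l i \<and> ?l i \<le> ?r i \<and> ?r i \<le> b"
        proof
          fix i assume "i \<in> p1"
          then show "a \<le> ?l i \<and> ?l i \<le> ?r i \<and> ?r i \<le> b"
            using K[of "fst i" "snd i"] by (auto simp: p1_def)
        qed
        show dj: "disjoint_family_on (\<lambda>i. {?l i<..<?r i}) p1"
          unfolding disjoint_family_on_def
        proof (intro ballI impI)
          fix i k assume ik: "i \<in> p1" "k \<in> p1" "i \<noteq> k"
          then have "interior (snd i) \<inter> interior (snd k) = {}"
            using tagged_division_ofD(5)[OF p, of "fst i" "snd i" "fst k" "snd k"] by (auto simp: p1_def prod_eq_iff)
          moreover have "interior (snd i) = {?l i<..<?r i}" if "i \<in> p1" for i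
            using K[of "fst i" "snd i"] that by (auto simp: p1_def)
          ultimately show "{?l i<..<?r i} \<inter> {?l k<..<?r k} = {}"
            using ik by simp
        qed
        have sub: "{?l i<..<?r i} \<subseteq> T" if "i \<in> p1" for i
          using K[of "fst i" "snd i"] that by (auto simp: p1_def \<gamma>_def subset_iff)
        have "ennreal (\<Sum>i\<in>p1. ?r i - ?l i) = (\<Sum>i\<in>p1. emeasure lebesgue {?l i<..<?r i})"
          using b1 by (subst sum_ennreal[symmetric]) (auto intro!: sum.cong)
        also have "\<dots> = emeasure lebesgue (\<Union>i\<in>p1. {?l i<..<?r i})"
          using p12 dj by (intro sum_emeasure) auto
        also have "\<dots> \<le> emeasure lebesgue T"
          using sub T by (intro emeasure_mono) auto
        also have "\<dots> < ennreal d" by (rule Td)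
        finally show "(\<Sum>i\<in>p1. ?r i - ?l i) < d"
          by (meson ennreal_leI leD leI)
      qed (use p12 in auto)
      then show ?thesis by (simp add: case_prod_unfold)
    qed
    finally show ?thesis by simp
  qed
  note * = this
  have "norm (x b - x a) \<le> 0"
  proof (rule field_le_epsilon)
    fix e :: real assume "e > 0"
    \<comment> \<open>Rescaling \<open>e\<close> makes the two errors add up to exactly
      \<open>e\<close>; the \<open>+ 1\<close> stands for the contribution of the null set.\<close>
    then have "norm (x b - x a) \<le> e / (b - a + 1) * (b - a) + e / (b - a + 1)"
      using ab by (intro *) simp
    also have "\<dots> = e / (b - a + 1) * (b - a + 1)"
      by (simp only: distrib_left mult_1_right)
    also have "\<dots> = e" using ab by simp
    finally show "norm (x b - x a) \<le> 0 + e" by simp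
  qed
  then show ?thesis by simp
qed

text \<open>Replacing \<open>h\<close> by a continuous \<open>g\<close> close to it in mean splits
  each increment into a piece of the integral of \<open>norm (h - g)\<close>, small in total over
  any disjoint family, and a piece at most \<open>B\<close> times the length. The constant
  \<open>c\<close> lets the integral form of the equation be plugged in directly.\<close>

lemma abs_continuous_indefinite_integral:
  fixes h :: "real \<Rightarrow> 'a::euclidean_space"
  assumes h: "h absolutely_integrable_on {a..b}"
    and x: "\<And>t. t \<in> {a..b} \<Longrightarrow> x t = c + integral {a..t} h"
  shows "abs_continuous_on a b x"
  unfolding abs_continuous_on_def
proof (intro allI impI)
  fix e :: real assume e: "e > 0"
  obtain g where g: "continuous_on UNIV g" and hg: "integral {a..b} (\<lambda>t. norm (h t - g t)) < e / 2"
    using absolutely_integrable_continuous_approx[OF h, of "e / 2"] e by auto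
  have "bounded (g ` {a..b})"
    using g by (intro compact_imp_bounded compact_continuous_image continuous_on_subset[OF g]) auto
  then obtain B where B: "B > 0" "\<And>t. t \<in> {a..b} \<Longrightarrow> norm (g t) \<le> B"
    by (auto simp: bounded_pos)
  have ai: "h absolutely_integrable_on {s..t}" "g absolutely_integrable_on {s..t}" if "a \<le> s" "t \<le> b" for s t
    using that by (auto intro: absolutely_integrable_subinterval_Icc[OF h] continuous_abs_integrable_Icc[OF g])
  have hgi: "(\<lambda>t. norm (h t - g t)) integrable_on {s..t}" if "a \<le> s" "t \<le> b" for s t
    using ai[OF that] by (intro abs_integrable_norm_Icc set_integral_diff)
  show "\<exists>d>0. \<forall>(n::nat) s t. (\<forall>i<n. a \<le> s i \<and> s i \<le> t i \<and> t i \<le> b) \<and>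
        disjoint_family_on (\<lambda>i. {s i<..<t i}) {..<n} \<and> (\<Sum>i<n. t i - s i) < d \<longrightarrow>
        (\<Sum>i<n. norm (x (t i) - x (s i))) < e"
  proof (intro exI[of _ "e / (2 * B)"] conjI allI impI)
    fix n :: nat and s t :: "nat \<Rightarrow> real"
    assume *: "(\<forall>i<n. a \<le> s i \<and> s i \<le> t i \<and> t i \<le> b) \<and>
        disjoint_family_on (\<lambda>i. {s i<..<t i}) {..<n} \<and> (\<Sum>i<n. t i - s i) < e / (2 * B)"
    have "(\<Sum>i<n. norm (x (t i) - x (s i))) \<le>
        (\<Sum>i<n. integral {s i..t i} (\<lambda>r. norm (h r - g r)) + B * (t i - s i))"
    proof (rule sum_mono)
      fix i assume "i \<in> {..<n}"
      then have st: "a \<le> s i" "s i \<le> t i" "t i \<le> b" using * by auto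
      have hi: "h integrable_on {a..t i}"
        using ai(1)[of a "t i"] st by (simp add: absolutely_integrable_on_def)
      have "x (t i) - x (s i) = integral {s i..t i} h"
        using st Henstock_Kurzweil_Integration.integral_combine[OF st(1,2) hi] by (simp add: x algebra_simps)
      also have "norm \<dots> \<le> integral {s i..t i} (\<lambda>r. norm (h r - g r) + B)"
      proof (rule integral_norm_bound_integral)
        show "norm (h r) \<le> norm (h r - g r) + B" if "r \<in> {s i..t i}" for r
          using B(2)[of r] that st norm_triangle_sub[of "h r" "g r"] by auto
      qed (use st ai(1)[of "s i" "t i"] hgi[of "s i" "t i"] in \<open>auto simp: absolutely_integrable_on_def intro!: integrable_add\<close>)
      also have "\<dots> = integral {s i..t i} (\<lambda>r. norm (h r - g r)) + B * (t i - s i)"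
        using hgi[of "s i" "t i"] st by (subst Henstock_Kurzweil_Integration.integral_add) auto
      finally show "norm (x (t i) - x (s i)) \<le> integral {s i..t i} (\<lambda>r. norm (h r - g r)) + B * (t i - s i)" .
    qed
    also have "\<dots> = (\<Sum>i<n. integral {s i..t i} (\<lambda>r. norm (h r - g r))) + B * (\<Sum>i<n. t i - s i)"
      by (simp add: sum.distrib sum_distrib_left)
    also have "B * (\<Sum>i<n. t i - s i) < e / 2"
      using * B(1) by (simp add: field_simps)
    also have "(\<Sum>i<n. integral {s i..t i} (\<lambda>r. norm (h r - g r))) \<le> integral {a..b} (\<lambda>r. norm (h r - g r))"
    proof -
      let ?U = "\<Union>i\<in>{..<n}. {s i<..<t i}"
      have "((\<lambda>r. norm (h r - g r)) has_integral (\<Sum>i<n. integral {s i..t i} (\<lambda>r. norm (h r - g r)))) ?U"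
      proof (rule has_integral_UN)
        show "((\<lambda>r. norm (h r - g r)) has_integral integral {s i..t i} (\<lambda>r. norm (h r - g r))) {s i<..<t i}"
          if "i \<in> {..<n}" for i
          using integrable_integral[OF hgi[of "s i" "t i"]] * that
          by (simp add: has_integral_Icc_iff_Ioo)
        show "pairwise (\<lambda>i i'. negligible ({s i<..<t i} \<inter> {s i'<..<t i'})) {..<n}"
          using * by (auto simp: pairwise_def disjoint_family_on_def)
      qed auto
      then show ?thesis
        using hgi[of a b] * by (intro has_integral_subset_le[of ?U "{a..b}"]) 
          (fastforce intro!: integrable_integral)+
    qed
    also have "\<dots> < e / 2" by (rule hg)
    finally show "(\<Sum>i<n. norm (x (t i) - x (s i))) < e" by simp
  qed (use e B in auto)
qed

text \<open>The differentiation theorem invoked here averages over cubes with \<open>t\<close> as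
  lower corner and so yields right derivatives. Left derivatives come from the same theorem for the
  reflected function, at the price of a reflected null set.\<close>

lemma AE_derivative_indefinite_integral:
  fixes h :: "real \<Rightarrow> 'a::euclidean_space"
  assumes h: "h absolutely_integrable_on {a..b}"
  shows "AE t in lebesgue. t \<in> {a<..<b} \<longrightarrow> ((\<lambda>t. integral {a..t} h) has_vector_derivative h t) (at t)"
proof -
  \<comment> \<open>Extension by zero makes the function integrable over every box, before and after
    reflection.\<close>
  define k where "k t = (if t \<in> {a..b} then h t else 0)" for t
  have "k integrable_on UNIV"
    using h unfolding k_def absolutely_integrable_on_def integrable_restrict_UNIV by simp
  then have ki: "k integrable_on cbox u v" for u v
    by (rule integrable_on_subcbox) auto
  have ki': "(\<lambda>t. k (- t)) integrable_on cbox u v" for u v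
    using ki[of "-v" "-u"] integrable_reflect[of "\<lambda>t. k (- t)" v u] by simp
  obtain N where N: "negligible N" "\<And>t e. t \<notin> N \<Longrightarrow> 0 < e \<Longrightarrow>
      \<exists>d>0. \<forall>s. 0 < s \<and> s < d \<longrightarrow> norm (integral (cbox t (t + s *\<^sub>R One)) k /\<^sub>R s ^ DIM(real) - k t) < e"
    using integrable_ccontinuous_explicit[OF ki] by metis
  obtain N' where N': "negligible N'" "\<And>t e. t \<notin> N' \<Longrightarrow> 0 < e \<Longrightarrow>
      \<exists>d>0. \<forall>s. 0 < s \<and> s < d \<longrightarrow> norm (integral (cbox t (t + s *\<^sub>R One)) (\<lambda>t. k (- t)) /\<^sub>R s ^ DIM(real) - k (- t)) < e"
    using integrable_ccontinuous_explicit[OF ki'] by metis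
  have "negligible (N \<union> uminus ` N')"
    using N(1) N'(1)
    by (intro negligible_Un negligible_differentiable_image_negligible) (auto intro!: differentiable_on_minus)
  then show ?thesis
  proof (rule negligible_AE_lebesgue)
    fix t assume t: "t \<notin> N \<union> uminus ` N'"
    have tN': "- t \<notin> N'" using t by (metis UnCI image_eqI minus_minus)
    show "t \<in> {a<..<b} \<longrightarrow> ((\<lambda>t. integral {a..t} h) has_vector_derivative h t) (at t)"
    proof
      assume tab: "t \<in> {a<..<b}"
      have kh: "integral {u..v} k = integral {u..v} h" if "a \<le> u" "v \<le> b" for u v
        using that by (intro integral_cong) (auto simp: k_def)
      have hi: "h integrable_on {u..v}" if "a \<le> u" "v \<le> b" for u v
        using absolutely_integrable_subinterval_Icc[OF h, of u v] that by (auto simp: absolutely_integrable_on_def)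
      show "((\<lambda>t. integral {a..t} h) has_vector_derivative h t) (at t)"
        unfolding has_vector_derivative_def has_derivative_within_alt
      proof (intro conjI allI impI)
        fix e :: real assume e: "0 < e"
        obtain d1 where d1: "d1 > 0" "\<And>s. 0 < s \<Longrightarrow> s < d1 \<Longrightarrow> norm (integral {t..t + s} k /\<^sub>R s - k t) < e"
          using N(2)[of t e] t e by auto
        obtain d2 where d2: "d2 > 0" "\<And>s. 0 < s \<Longrightarrow> s < d2 \<Longrightarrow>
            norm (integral {-t..-t + s} (\<lambda>t. k (- t)) /\<^sub>R s - k t) < e"
          using N'(2)[OF tN' e] by auto
        have kt: "k t = h t" using tab by (simp add: k_def)
        have scale: "norm (I - s *\<^sub>R c) \<le> e * s" if "norm (I /\<^sub>R s - c) < e" "s > 0" for I c :: 'a and s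
        proof -
          have "I - s *\<^sub>R c = s *\<^sub>R (I /\<^sub>R s - c)" using that by (simp add: scaleR_diff_right)
          then show ?thesis using that by (simp add: mult.commute)
        qed
        show "\<exists>d>0. \<forall>y\<in>UNIV. norm (y - t) < d \<longrightarrow>
            norm (integral {a..y} h - integral {a..t} h - (y - t) *\<^sub>R h t) \<le> e * norm (y - t)"
        proof (intro exI[of _ "min (min d1 d2) (min (t - a) (b - t))"] conjI ballI impI)
          fix y assume y: "norm (y - t) < min (min d1 d2) (min (t - a) (b - t))"
          consider "y = t" | "y > t" | "y < t" by linarith
          then show "norm (integral {a..y} h - integral {a..t} h - (y - t) *\<^sub>R h t) \<le> e * norm (y - t)"
          proof cases
            case 2
            then have "integral {a..y} h - integral {a..t} h = integral {t..y} h"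
              using Henstock_Kurzweil_Integration.integral_combine[of a t y h] tab y hi[of a y] by (simp add: algebra_simps)
            also have "\<dots> = integral {t..y} k" using tab y by (intro kh[symmetric]) auto
            finally show ?thesis
              using scale[OF d1(2)[of "y - t"]] 2 y kt by simp
          next
            case 3
            then have "integral {a..t} h - integral {a..y} h = integral {y..t} h"
              using Henstock_Kurzweil_Integration.integral_combine[of a y t h] tab y hi[of a t] by (simp add: algebra_simps)
            also have "\<dots> = integral {y..t} k" using tab y by (intro kh[symmetric]) auto
            also have "\<dots> = integral {-t..-t + (t - y)} (\<lambda>t. k (- t))" by simp
            finally have "norm ((integral {a..t} h - integral {a..y} h) - (t - y) *\<^sub>R h t) \<le> e * (t - y)"
              using scale[OF d2(2)[of "t - y"]] 3 y kt by simp
            then show ?thesis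
              using 3 by (simp add: norm_minus_commute algebra_simps)
          qed auto
        qed (use d1 d2 tab in auto)
      qed (rule bounded_linear_scaleR_left)
    qed
  qed
qed

text \<open>Subtracting the primitive of \<open>h\<close> leaves an absolutely continuous function
  whose derivative vanishes almost everywhere.\<close>

lemma abs_continuous_on_FTC:
  fixes x :: "real \<Rightarrow> 'a::euclidean_space"
  assumes ac: "abs_continuous_on a b x" and h: "h absolutely_integrable_on {a..b}"
    and der: "AE t in lebesgue. t \<in> {a<..<b} \<longrightarrow> (x has_vector_derivative h t) (at t)"
    and t: "t \<in> {a..b}"
  shows "x t = x a + integral {a..t} h"
proof -
  let ?y = "\<lambda>t. x t - integral {a..t} h"
  have "abs_continuous_on a b (\<lambda>t. integral {a..t} h)"
    by (rule abs_continuous_indefinite_integral[OF h, where c = 0]) simp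
  then have "abs_continuous_on a t ?y"
    using t by (intro abs_continuous_on_subinterval[OF abs_continuous_on_diff[OF ac]]) auto
  moreover have "AE s in lebesgue. s \<in> {a<..<t} \<longrightarrow> (?y has_vector_derivative 0) (at s)"
    using der AE_derivative_indefinite_integral[OF h]
  proof eventually_elim
    case (elim s)
    then show ?case
      using t has_vector_derivative_diff[of x "h s" "at s" "\<lambda>t. integral {a..t} h" "h s"] by auto
  qed
  ultimately have "?y t = ?y a"
    using t by (intro abs_continuous_zero_derivative_const) auto
  then show ?thesis by (simp add: algebra_simps)
qed

section \<open>Exponential weights and Gronwall's inequality with delay\<close>

text \<open>The exponential is Lipschitz on the bounded range of its argument, so the composition
  stays absolutely continuous, and the chain rule, valid almost everywhere, can be integrated. Such
  weights turn integrals against \<open>l\<close> into exact differences; they appear with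
  \<open>c = 4\<close> in Gronwall's inequality and with \<open>c = 8\<close> in the
  contraction.\<close>

lemma integral_exp_weight:
  fixes l :: "real \<Rightarrow> real"
  assumes l: "l absolutely_integrable_on {0..T}" and t: "t \<in> {0..T}"
  shows "((\<lambda>s. c * l s * exp (c * integral {0..s} l)) has_integral exp (c * integral {0..t} l) - 1) {0..t}"
proof -
  let ?L = "\<lambda>s. integral {0..s} l"
  let ?E = "\<lambda>s. exp (c * ?L s)"
  have acL: "abs_continuous_on 0 T ?L"
    by (rule abs_continuous_indefinite_integral[OF l, where c = 0]) simp
  have cL: "continuous_on {0..T} ?L"
    using l by (intro indefinite_integral_continuous_1) (simp add: absolutely_integrable_on_def)
  have h: "(\<lambda>s. c * l s * ?E s) absolutely_integrable_on {0..T}"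
  proof -
    have "bounded (?E ` {0..T})"
      by (intro compact_imp_bounded compact_continuous_image continuous_intros cL) auto
    then have "(\<lambda>s. ?E s * l s) absolutely_integrable_on {0..T}"
      by (intro absolutely_integrable_bounded_measurable_product_real l
        continuous_imp_measurable_on_sets_lebesgue continuous_intros cL) auto
    from set_integrable_mult_right[OF this, of c] show ?thesis
      by (simp add: mult_ac)
  qed
  have "bounded ((\<lambda>s. c * ?L s) ` {0..T})"
    by (intro compact_imp_bounded compact_continuous_image continuous_intros cL) auto
  then obtain B where B: "B > 0" "\<And>s. s \<in> {0..T} \<Longrightarrow> \<bar>c * ?L s\<bar> \<le> B"
    by (auto simp: bounded_pos)
  have lip: "\<bar>exp u - exp v\<bar> \<le> exp B * \<bar>u - v\<bar>" if "\<bar>u\<bar> \<le> B" "\<bar>v\<bar> \<le> B" for u v :: real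
    using field_differentiable_bound[of "{-B..B}" exp exp "exp B" u v] that
    by (auto simp: abs_le_iff minus_le_iff intro: has_field_derivative_at_within[OF DERIV_exp])
  have acE: "abs_continuous_on 0 T ?E"
    unfolding abs_continuous_on_def
  proof (intro allI impI)
    fix e :: real assume e: "e > 0"
    \<comment> \<open>\<open>\<bar>c\<bar> + 1\<close> instead of \<open>\<bar>c\<bar>\<close> keeps
      \<open>?k\<close> positive for \<open>c = 0\<close>.\<close>
    let ?k = "exp B * (\<bar>c\<bar> + 1)"
    have k: "?k > 0" by (simp add: add_nonneg_pos)
    then have "e / ?k > 0" using e by simp
    then obtain d where d: "d > 0" "\<forall>(n::nat) s t. (\<forall>i<n. 0 \<le> s i \<and> s i \<le> t i \<and> t i \<le> T) \<and>
        disjoint_family_on (\<lambda>i. {s i<..<t i}) {..<n} \<and> (\<Sum>i<n. t i - s i) < d \<longrightarrow>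
        (\<Sum>i<n. norm (?L (t i) - ?L (s i))) < e / ?k"
      using acL[unfolded abs_continuous_on_def, rule_format] by blast
    show "\<exists>d>0. \<forall>(n::nat) s t. (\<forall>i<n. 0 \<le> s i \<and> s i \<le> t i \<and> t i \<le> T) \<and>
        disjoint_family_on (\<lambda>i. {s i<..<t i}) {..<n} \<and> (\<Sum>i<n. t i - s i) < d \<longrightarrow>
        (\<Sum>i<n. norm (?E (t i) - ?E (s i))) < e"
    proof (intro exI[of _ d] conjI allI impI d(1))
      fix n :: nat and s t :: "nat \<Rightarrow> real"
      assume *: "(\<forall>i<n. 0 \<le> s i \<and> s i \<le> t i \<and> t i \<le> T) \<and>
        disjoint_family_on (\<lambda>i. {s i<..<t i}) {..<n} \<and> (\<Sum>i<n. t i - s i) < d"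
      have "(\<Sum>i<n. norm (?E (t i) - ?E (s i))) \<le> (\<Sum>i<n. ?k * norm (?L (t i) - ?L (s i)))"
      proof (rule sum_mono)
        fix i assume "i \<in> {..<n}"
        then have "\<bar>?E (t i) - ?E (s i)\<bar> \<le> exp B * \<bar>c * ?L (t i) - c * ?L (s i)\<bar>"
          using * by (intro lip B(2)) force+
        also have "\<dots> = exp B * (\<bar>c\<bar> * \<bar>?L (t i) - ?L (s i)\<bar>)"
          by (simp add: right_diff_distrib[symmetric] abs_mult)
        also have "\<dots> \<le> exp B * ((\<bar>c\<bar> + 1) * \<bar>?L (t i) - ?L (s i)\<bar>)"
          by (intro mult_left_mono mult_right_mono) auto
        finally show "norm (?E (t i) - ?E (s i)) \<le> ?k * norm (?L (t i) - ?L (s i))"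
          by (simp add: mult.assoc)
      qed
      also have "\<dots> = ?k * (\<Sum>i<n. norm (?L (t i) - ?L (s i)))"
        by (simp add: sum_distrib_left)
      also have "\<dots> < ?k * (e / ?k)"
        using k d(2)[rule_format, OF *] by (rule mult_strict_left_mono[rotated])
      also have "\<dots> = e" using k by simp
      finally show "(\<Sum>i<n. norm (?E (t i) - ?E (s i))) < e" .
    qed
  qed
  have "?E t = ?E 0 + integral {0..t} (\<lambda>s. c * l s * ?E s)"
  proof (rule abs_continuous_on_FTC[OF acE h _ t])
    show "AE s in lebesgue. s \<in> {0<..<T} \<longrightarrow> (?E has_vector_derivative c * l s * ?E s) (at s)"
      using AE_derivative_indefinite_integral[OF l]
    proof eventually_elim
      case (elim s)
      show ?case
      proof
        assume "s \<in> {0<..<T}"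
        with elim have "(?L has_field_derivative l s) (at s)"
          by (simp add: has_real_derivative_iff_has_vector_derivative)
        then have "(?E has_field_derivative c * l s * ?E s) (at s)"
          by (auto intro!: derivative_eq_intros)
        then show "(?E has_vector_derivative c * l s * ?E s) (at s)"
          by (simp add: has_real_derivative_iff_has_vector_derivative)
      qed
    qed
  qed
  moreover have "(\<lambda>s. c * l s * ?E s) integrable_on {0..t}"
    using absolutely_integrable_subinterval_Icc[OF h, of 0 t] t by (simp add: absolutely_integrable_on_def)
  ultimately show ?thesis
    by (metis (no_types, lifting) add_diff_cancel_left' exp_zero integrable_integral integral_refl interval_cbox mult_zero_right box_real(2))
qed

lemma abs_integrable_mult_continuous:
  fixes l v :: "real \<Rightarrow> real"
  assumes "l absolutely_integrable_on {a..b}" "continuous_on {a..b} v"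
  shows "(\<lambda>s. l s * v s) absolutely_integrable_on {a..b}"
proof -
  have "bounded (v ` {a..b})"
    using assms by (intro compact_imp_bounded compact_continuous_image) auto
  then have "(\<lambda>s. v s * l s) absolutely_integrable_on {a..b}"
    by (intro absolutely_integrable_bounded_measurable_product_real
      continuous_imp_measurable_on_sets_lebesgue assms) auto
  then show ?thesis by (simp add: mult.commute)
qed

text \<open>For negative \<open>t\<close> the interval is empty and the integral is 0. Weights built
  from it are therefore constant up to time 0 and can be evaluated at delayed times.\<close>

lemma continuous_indefinite_integral_extended:
  fixes l :: "real \<Rightarrow> 'a::euclidean_space"
  assumes "l absolutely_integrable_on {0..T}" "0 \<le> T"
  shows "continuous_on {..T} (\<lambda>t. integral {0..t} l)"
proof -
  have "continuous_on {0..T} (\<lambda>t. integral {0..t} l)"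
    using assms by (intro indefinite_integral_continuous_1) (simp add: absolutely_integrable_on_def)
  then have "continuous_on {..T} (\<lambda>t. integral {0..max 0 t} l)"
    by (rule continuous_on_compose2) (use assms in \<open>auto intro!: continuous_intros\<close>)
  moreover have "integral {0..max 0 t} l = integral {0..t} l" for t
    by (auto simp: max_def)
  ultimately show ?thesis by simp
qed

lemma delay_gronwall:
  fixes u l :: "real \<Rightarrow> real"
  assumes T: "0 \<le> T" and cu: "continuous_on {-1..T} u" and u0: "\<And>t. t \<in> {-1..T} \<Longrightarrow> 0 \<le> u t"
    and l: "l absolutely_integrable_on {0..T}" and l0: "\<And>t. 0 \<le> l t"
    and init: "\<And>t. t \<in> {-1..0} \<Longrightarrow> u t \<le> C"
    and ineq: "\<And>t. t \<in> {0..T} \<Longrightarrow> u t \<le> C + integral {0..t} (\<lambda>s. l s * (u s + u (s - 1)))"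
    and t: "t \<in> {-1..T}"
  shows "u t \<le> 2 * C * exp (4 * integral {0..T} l)"
proof -
  \<comment> \<open>In the integral of \<open>ineq\<close> the values \<open>u s\<close> and
    \<open>u (s - 1)\<close> count once each, which gives a factor 2; the other factor 2 leaves half
    of the maximum on the left-hand side.\<close>
  let ?E = "\<lambda>t. exp (4 * integral {0..t} l)"
  have cE: "continuous_on {-1..T} ?E"
    by (intro continuous_intros continuous_on_subset[OF continuous_indefinite_integral_extended[OF l T]]) auto
  have li: "l integrable_on {0..t}" if "t \<le> T" for t
    using absolutely_integrable_subinterval_Icc[OF l, of 0 t] that by (simp add: absolutely_integrable_on_def)
  have E1: "?E t = 1" if "t \<le> 0" for t
    using that by (cases "t = 0") auto
  have Emono: "?E s \<le> ?E t" if "s \<le> t" "t \<le> T" for s t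
    using integral_subset_Icc_nonneg[OF li[of t], of 0 s] that l0 by simp
  have C0: "0 \<le> C" using init[of 0] u0[of 0] T by simp
  \<comment> \<open>Since \<open>?E\<close> is the integral of \<open>4 * l * ?E\<close>, at a maximum of \<open>u / ?E\<close> the integral term of \<open>ineq\<close>
    is at most half of \<open>u\<close>.\<close>
  obtain \<tau> where \<tau>: "\<tau> \<in> {-1..T}" and max: "\<And>t. t \<in> {-1..T} \<Longrightarrow> u t / ?E t \<le> u \<tau> / ?E \<tau>"
  proof -
    have "continuous_on {-1..T} (\<lambda>t. u t / ?E t)"
      by (intro continuous_intros cu cE) auto
    then show ?thesis
      using continuous_attains_sup[of "{-1..T}" "\<lambda>t. u t / ?E t"] that T by auto
  qed
  define M where "M = u \<tau> / ?E \<tau>"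
  have M0: "0 \<le> M" using u0[OF \<tau>] by (simp add: M_def)
  have uM: "u t \<le> M * ?E t" if "t \<in> {-1..T}" for t
    using max[OF that] by (simp add: M_def[symmetric] pos_divide_le_eq)
  have "M \<le> 2 * C"
  proof (cases "\<tau> \<le> 0")
    case True
    then have "M \<le> C" using init[of \<tau>] \<tau> by (simp add: M_def E1)
    then show ?thesis using C0 by simp
  next
    case False
    then have \<tau>': "\<tau> \<in> {0..T}" using \<tau> by simp
    have lT: "l absolutely_integrable_on {0..\<tau>}"
      using \<tau>' by (intro absolutely_integrable_subinterval_Icc[OF l]) auto
    have "u \<tau> \<le> C + integral {0..\<tau>} (\<lambda>s. l s * (u s + u (s - 1)))"
      by (rule ineq[OF \<tau>'])
    also have "integral {0..\<tau>} (\<lambda>s. l s * (u s + u (s - 1))) \<le> integral {0..\<tau>} (\<lambda>s. M / 2 * (4 * l s * ?E s))"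
    proof (rule integral_le)
      have "(\<lambda>s. l s * (u s + u (s - 1))) absolutely_integrable_on {0..\<tau>}"
        using \<tau>' by (intro abs_integrable_mult_continuous lT continuous_intros
            continuous_on_subset[OF cu] continuous_on_compose2[OF cu]) auto
      then show "(\<lambda>s. l s * (u s + u (s - 1))) integrable_on {0..\<tau>}"
        by (simp add: absolutely_integrable_on_def)
      show "(\<lambda>s. M / 2 * (4 * l s * ?E s)) integrable_on {0..\<tau>}"
        using integral_exp_weight[OF l \<tau>', of 4] by (intro integrable_on_mult_right) (auto simp: integrable_on_def)
      \<comment> \<open>The weight is non-decreasing because \<open>l\<close> is nonnegative, so the
        delayed value obeys the same bound as the current one.\<close>
      show "l s * (u s + u (s - 1)) \<le> M / 2 * (4 * l s * ?E s)" if "s \<in> {0..\<tau>}" for s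
      proof -
        have "u (s - 1) \<le> M * ?E (s - 1)" using that \<tau>' by (intro uM) auto
        also have "\<dots> \<le> M * ?E s" using that \<tau>' M0 by (intro mult_left_mono Emono) auto
        finally have "u s + u (s - 1) \<le> 2 * M * ?E s"
          using uM[of s] that \<tau>' by auto
        from mult_left_mono[OF this l0[of s]] show ?thesis by (simp add: algebra_simps)
      qed
    qed
    also have "\<dots> = M / 2 * (?E \<tau> - 1)"
      using integral_unique[OF has_integral_mult_right[OF integral_exp_weight[OF l \<tau>', of 4], of "M / 2"]] by simp
    finally have "M * ?E \<tau> \<le> C + M / 2 * (?E \<tau> - 1)"
      by (simp add: M_def)
    then have "M / 2 * ?E \<tau> \<le> C" using M0 by (simp add: algebra_simps)
    moreover have "M / 2 * 1 \<le> M / 2 * ?E \<tau>"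
      using M0 Emono[of 0 \<tau>] \<tau>' by (intro mult_left_mono) auto
    ultimately show ?thesis by simp
  qed
  then have "M * ?E t \<le> 2 * C * ?E T"
    using M0 C0 Emono[of t T] t by (intro mult_mono) auto
  then show ?thesis using uM[OF t] by linarith
qed

subsection \<open>Caratheodory functions along continuous curves\<close>

text \<open>Passing to the absolute value makes \<open>l\<close> nonnegative, which the monotone
  weights in Gronwall's inequality and in the contraction require.\<close>

lemma LC_bounds:
  assumes "g \<in> LC_fun" "compact K"
  shows "\<exists>m l. (\<forall>a b. m absolutely_integrable_on {a..b}) \<and> (\<forall>a b. l absolutely_integrable_on {a..b}) \<and>
    (\<forall>t. 0 \<le> l t) \<and> (AE t in lebesgue. \<forall>z\<in>K. norm (g t z) \<le> m t) \<and>
    (AE t in lebesgue. \<forall>z1\<in>K. \<forall>z2\<in>K. norm (g t z1 - g t z2) \<le> l t * norm (z1 - z2))"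
proof -
  obtain m l where ml: "L1_loc m" "L1_loc l" and ae: "AE s in lebesgue.
              (\<forall>z\<in>K. norm (g s z) \<le> m s) \<and>
              (\<forall>z1\<in>K. \<forall>z2\<in>K. norm (g s z1 - g s z2) \<le> l s * norm (z1 - z2))"
    using assms unfolding LC_fun_def by blast
  have "(\<lambda>t. \<bar>l t\<bar>) absolutely_integrable_on {a..b}" for a b
    using absolutely_integrable_norm[where f = l and S = "{a..b}"] ml by (simp add: L1_loc_def o_def)
  moreover have "AE t in lebesgue. \<forall>z1\<in>K. \<forall>z2\<in>K. norm (g t z1 - g t z2) \<le> \<bar>l t\<bar> * norm (z1 - z2)"
    using ae
  proof eventually_elim
    case (elim t)
    then show ?case
      by (meson abs_ge_self mult_right_mono norm_ge_zero order_trans)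
  qed
  moreover have "AE t in lebesgue. \<forall>z\<in>K. norm (g t z) \<le> m t"
    using ae by eventually_elim blast
  ultimately show ?thesis
    using ml by (intro exI[of _ m] exI[of _ "\<lambda>t. \<bar>l t\<bar>"]) (auto simp: L1_loc_def)
qed

lemma LC_fun_slice_measurable:
  assumes "g \<in> LC_fun" and [measurable]: "z \<in> borel_measurable borel"
  shows "(\<lambda>t. g t (z t)) \<in> borel_measurable borel"
proof -
  have "(\<lambda>t. (\<lambda>(t, z). g t z) (t, z t)) \<in> borel_measurable borel"
    by (rule measurable_compose[where N = borel]) (use assms in \<open>auto simp: LC_fun_def\<close>)
  then show ?thesis by simp
qed

lemma LC_fun_curve_measurable:
  assumes "g \<in> LC_fun" "continuous_on {a..b} z"
  shows "(\<lambda>t. g t (z t)) \<in> borel_measurable (lebesgue_on {a..b})"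
proof -
  \<comment> \<open>Extension by zero gives a Borel curve on the whole line, to which the joint
    Borel measurability of \<open>g\<close> applies.\<close>
  let ?z = "\<lambda>t. if t \<in> {a..b} then z t else 0"
  have "?z \<in> borel_measurable borel"
    using assms(2) by (intro borel_measurable_continuous_on_if) auto
  then have "(\<lambda>t. g t (?z t)) \<in> borel_measurable (lebesgue_on {a..b})"
    using LC_fun_slice_measurable[OF assms(1)]
    by (intro measurable_restrict_space1 measurable_completion) simp
  then show ?thesis
    by (rule measurable_cong[THEN iffD1, rotated]) (auto simp: space_restrict_space)
qed

lemma LC_fun_curve_integrable:
  assumes "g \<in> LC_fun" "continuous_on {a..b} z"
  shows "(\<lambda>t. g t (z t)) absolutely_integrable_on {a..b}"
proof -
  have "compact (z ` {a..b})" using assms(2) by (intro compact_continuous_image) auto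
  from LC_bounds[OF assms(1) this] obtain m where m: "m absolutely_integrable_on {a..b}"
    "AE t in lebesgue. \<forall>w\<in>z ` {a..b}. norm (g t w) \<le> m t" by blast
  show ?thesis
    by (rule absolutely_integrable_bound_AE[OF LC_fun_curve_measurable[OF assms] m(1)])
      (use m(2) in \<open>auto elim!: eventually_mono\<close>)
qed

text \<open>Local Lipschitz bounds hold off a null set that depends on the ball; countably many open
  balls exhaust the space, and continuity on open sets glues.\<close>

lemma LC_fun_AE_continuous:
  assumes "g \<in> LC_fun"
  shows "AE t in lebesgue. continuous_on UNIV (g t)"
proof -
  have "AE t in lebesgue. \<forall>n::nat. continuous_on (ball 0 (real n)) (g t)"
    unfolding AE_all_countable
  proof
    fix n :: nat
    obtain l where l: "\<forall>t. 0 \<le> l t" "AE t in lebesgue. \<forall>z1\<in>cball 0 (real n). \<forall>z2\<in>cball 0 (real n).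
      norm (g t z1 - g t z2) \<le> l t * norm (z1 - z2)"
      using LC_bounds[OF assms compact_cball[of 0 "real n"]] by blast
    from l(2) show "AE t in lebesgue. continuous_on (ball 0 (real n)) (g t)"
    proof eventually_elim
      case (elim t)
      then have "(l t)-lipschitz_on (ball 0 (real n)) (g t)"
        using l(1) by (intro lipschitz_onI) (auto simp: dist_norm)
      then show ?case by (rule lipschitz_on_continuous_on)
    qed
  qed
  then show ?thesis
  proof eventually_elim
    case (elim t)
    have "continuous_on (\<Union>n::nat. ball 0 (real n)) (g t)"
      using elim by (intro continuous_on_open_UN) auto
    moreover have "(\<Union>n::nat. ball (0::(real^'a) \<times> (real^'a)) (real n)) = UNIV"
      by (auto simp: reals_Archimedean2)
    ultimately show ?case by simp
  qed
qed

text \<open>Fubini gives, for almost every \<open>t\<close>, equality for almost every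
  \<open>z\<close>. For continuous slices the set of disagreement is open, and an open null set is
  empty. Hence solutions and mean values along curves do not depend on the representative.\<close>

lemma LC_eq_AE:
  assumes "LC_eq f g"
  shows "AE t in lebesgue. \<forall>z. f t z = g t z"
proof -
  have fg: "f \<in> LC_fun" "g \<in> LC_fun" and neg: "negligible {(t, z). f t z \<noteq> g t z}"
    using assms by (auto simp: LC_eq_def)
  have [measurable]: "(\<lambda>p. f (fst p) (snd p)) \<in> borel_measurable borel"
    "(\<lambda>p. g (fst p) (snd p)) \<in> borel_measurable borel"
    using fg by (auto simp: LC_fun_def case_prod_unfold)
  have "{p. f (fst p) (snd p) \<noteq> g (fst p) (snd p)} \<in> sets borel"
    by measurable
  moreover have "{p. f (fst p) (snd p) \<noteq> g (fst p) (snd p)} \<in> null_sets lebesgue"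
    using neg by (simp add: negligible_iff_null_sets case_prod_unfold)
  \<comment> \<open>Fubini is applied to the uncompleted product measure; Borel measurability of the
    disagreement set allows the passage from \<open>lebesgue\<close> to
    \<open>lborel\<close>.\<close>
  ultimately have "{p. f (fst p) (snd p) \<noteq> g (fst p) (snd p)} \<in> null_sets lborel"
    by (simp add: null_sets_def)
  then have "AE p in lborel. f (fst p) (snd p) = g (fst p) (snd p)"
    by (intro AE_I') auto
  then have "AE p in lborel \<Otimes>\<^sub>M lborel. f (fst p) (snd p) = g (fst p) (snd p)"
    unfolding lborel_prod .
  from lborel_pair.AE_pair[OF this] have "AE t in lborel. AE z in lborel. f t z = g t z"
    by simp
  then have "AE t in lebesgue. AE z in lborel. f t z = g t z"
    by (rule AE_completion)
  then show ?thesis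
    using LC_fun_AE_continuous[OF fg(1)] LC_fun_AE_continuous[OF fg(2)]
  proof eventually_elim
    case (elim t)
    let ?S = "{z. f t z \<noteq> g t z}"
    have "open ?S"
      using elim(2,3) by (intro open_Collect_neq) (auto simp: continuous_on_eq_continuous_at)
    moreover have "negligible ?S"
      using AE_completion[OF elim(1)]
      by (rule AE_lebesgue_negligible) (erule negligible_subset, blast)
    ultimately have "?S = {}" using open_not_negligible by blast
    then show ?case by auto
  qed
qed

subsection \<open>The integral equation\<close>

text \<open>The interval is closed at \<open>c\<close>, while the maximal interval is half-open:
  solving up to \<open>c\<close> is a problem on a compact interval, and the maximal end becomes the
  supremum of the solvable \<open>c\<close>, which is never attained.\<close>

definition isol :: "(real \<Rightarrow> (real^'n) \<times> (real^'n) \<Rightarrow> real^'n) \<Rightarrow> (real \<Rightarrow> real^'n) \<Rightarrow> real \<Rightarrow>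
    (real \<Rightarrow> real^'n) \<Rightarrow> bool" where
  "isol g \<phi> c x \<longleftrightarrow> continuous_on {-1..c} x \<and> (\<forall>t\<in>{-1..0}. x t = \<phi> t) \<and>
     (\<forall>t\<in>{0..c}. x t = \<phi> 0 + integral {0..t} (\<lambda>s. g s (x s, x (s - 1))))"

lemma isol_continuous: "isol g \<phi> c x \<Longrightarrow> continuous_on {-1..c} x"
  by (simp add: isol_def)

lemma isol_mono: "isol g \<phi> c x \<Longrightarrow> d \<le> c \<Longrightarrow> isol g \<phi> d x"
  by (auto simp: isol_def intro: continuous_on_subset)

lemma isol_cong:
  assumes "isol g \<phi> c x" "\<And>t. t \<in> {-1..c} \<Longrightarrow> y t = x t" "0 \<le> c"
  shows "isol g \<phi> c y"
  unfolding isol_def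
proof (intro conjI ballI)
  show "continuous_on {-1..c} y"
    using assms continuous_on_cong[of "{-1..c}" "{-1..c}" y x] by (simp add: isol_def)
  show "y t = \<phi> t" if "t \<in> {-1..0}" for t
    using assms that by (auto simp: isol_def)
  show "y t = \<phi> 0 + integral {0..t} (\<lambda>s. g s (y s, y (s - 1)))" if "t \<in> {0..c}" for t
  proof -
    have "integral {0..t} (\<lambda>s. g s (y s, y (s - 1))) = integral {0..t} (\<lambda>s. g s (x s, x (s - 1)))"
      using that assms(2) by (intro integral_cong) auto
    then show ?thesis using assms that by (auto simp: isol_def)
  qed
qed

lemma isol_cong_AE:
  assumes "isol g \<phi> c x" "AE t in lebesgue. t \<in> {0..c} \<longrightarrow> h t (x t, x (t - 1)) = g t (x t, x (t - 1))"
  shows "isol h \<phi> c x"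
proof -
  have "integral {0..t} (\<lambda>s. h s (x s, x (s - 1))) = integral {0..t} (\<lambda>s. g s (x s, x (s - 1)))"
    if "t \<in> {0..c}" for t
    using assms(2) that by (intro integral_cong_AE_Icc) (auto elim!: eventually_mono)
  with assms(1) show ?thesis by (simp add: isol_def)
qed

lemma isol_curve_continuous:
  fixes x :: "real \<Rightarrow> 'a::topological_space"
  assumes "continuous_on {-1..c} x"
  shows "continuous_on {0..c} (\<lambda>t. (x t, x (t - 1)))"
proof (rule continuous_on_Pair)
  show "continuous_on {0..c} x"
    by (rule continuous_on_subset[OF assms]) auto
  show "continuous_on {0..c} (\<lambda>t. x (t - 1))"
    by (rule continuous_on_compose2[OF assms]) (auto intro!: continuous_intros)
qed

lemma isol_integrable:
  assumes "g \<in> LC_fun" "continuous_on {-1..c} x"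
  shows "(\<lambda>s. g s (x s, x (s - 1))) absolutely_integrable_on {0..c}"
  using LC_fun_curve_integrable[OF assms(1) isol_curve_continuous[OF assms(2)]] .

lemma norm_Pair_diff_le: "norm ((a, b) - (c, d)) \<le> norm (a - c) + norm (b - d)"
  using norm_Pair_le[of "a - c" "b - d"] by simp

lemma delay_comparison:
  fixes x y :: "real \<Rightarrow> 'a::euclidean_space"
  assumes T: "0 \<le> T" and cx: "continuous_on {-1..T} x" and cy: "continuous_on {-1..T} y"
    and xa: "\<And>t. t \<in> {0..T} \<Longrightarrow> x t = x 0 + integral {0..t} a" "a absolutely_integrable_on {0..T}"
    and yb: "\<And>t. t \<in> {0..T} \<Longrightarrow> y t = y 0 + integral {0..t} b" "b absolutely_integrable_on {0..T}"
    and l: "l absolutely_integrable_on {0..T}" "\<And>t. 0 \<le> l t"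
    and e: "e absolutely_integrable_on {0..T}" "\<And>t. 0 \<le> e t" "integral {0..T} e \<le> \<epsilon>"
    and init: "\<And>t. t \<in> {-1..0} \<Longrightarrow> norm (y t - x t) \<le> \<eta>"
    and ab: "AE t in lebesgue. t \<in> {0..T} \<longrightarrow>
      norm (b t - a t) \<le> l t * (norm (y t - x t) + norm (y (t - 1) - x (t - 1))) + e t"
  shows "t \<in> {-1..T} \<Longrightarrow> norm (y t - x t) \<le> 2 * (\<eta> + \<epsilon>) * exp (4 * integral {0..T} l)"
    and "integral {0..T} (\<lambda>t. norm (b t - a t)) \<le>
      4 * (\<eta> + \<epsilon>) * exp (4 * integral {0..T} l) * integral {0..T} l + \<epsilon>"
proof -
  let ?u = "\<lambda>t. norm (y t - x t)"
  have cu: "continuous_on {-1..T} ?u" by (intro continuous_intros cx cy)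
  have \<epsilon>: "0 \<le> \<epsilon>" using e(2,3) integral_nonneg[of e "{0..T}"] e(1)
    by (auto simp: absolutely_integrable_on_def)
  have \<eta>: "0 \<le> \<eta>" using order_trans[OF norm_ge_zero init[of 0]] by simp
  have lu: "(\<lambda>s. l s * (?u s + ?u (s - 1))) absolutely_integrable_on {0..T}"
    by (intro abs_integrable_mult_continuous l continuous_on_add continuous_on_subset[OF cu]
        continuous_on_compose2[OF cu] continuous_intros) auto
  have sub: "f integrable_on {0..t}" if "f absolutely_integrable_on {0..T}" "t \<in> {0..T}"
    for f :: "real \<Rightarrow> 'b::euclidean_space" and t
    using absolutely_integrable_subinterval_Icc[OF that(1), of 0 t] that(2)
    by (simp add: absolutely_integrable_on_def)
  have ba: "(\<lambda>t. b t - a t) absolutely_integrable_on {0..T}"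
    using xa yb by (intro set_integral_diff) auto
  have key: "integral {0..t} (\<lambda>s. norm (b s - a s)) \<le> integral {0..t} (\<lambda>s. l s * (?u s + ?u (s - 1))) + \<epsilon>"
    if t: "t \<in> {0..T}" for t
  proof -
    have "integral {0..t} (\<lambda>s. norm (b s - a s)) \<le> integral {0..t} (\<lambda>s. l s * (?u s + ?u (s - 1)) + e s)"
      using t ab by (intro integral_mono_AE_Icc integrable_add sub[OF lu] sub[OF e(1)]
          abs_integrable_norm_Icc absolutely_integrable_subinterval_Icc[OF ba]) (auto elim!: eventually_mono)
    also have "\<dots> = integral {0..t} (\<lambda>s. l s * (?u s + ?u (s - 1))) + integral {0..t} e"
      by (intro Henstock_Kurzweil_Integration.integral_add sub[OF lu t] sub[OF e(1) t])
    also have "integral {0..t} e \<le> integral {0..T} e"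
      using t T by (intro integral_subset_Icc_nonneg sub[OF e(1)] e) auto
    finally show ?thesis using e(3) by linarith
  qed
  have bound: "?u t \<le> 2 * (\<eta> + \<epsilon>) * exp (4 * integral {0..T} l)" if "t \<in> {-1..T}" for t
  proof (rule delay_gronwall[OF T cu _ l _ _ that])
    show "?u t \<le> \<eta> + \<epsilon>" if "t \<in> {-1..0}" for t using init[OF that] \<epsilon> by simp
    show "?u t \<le> \<eta> + \<epsilon> + integral {0..t} (\<lambda>s. l s * (?u s + ?u (s - 1)))" if t: "t \<in> {0..T}" for t
    proof -
      have "y t - x t = (y 0 - x 0) + integral {0..t} (\<lambda>s. b s - a s)"
        using xa(1)[OF t] yb(1)[OF t] Henstock_Kurzweil_Integration.integral_diff[OF sub[OF yb(2) t] sub[OF xa(2) t]]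
        by (simp add: algebra_simps)
      then have "?u t \<le> norm (y 0 - x 0) + norm (integral {0..t} (\<lambda>s. b s - a s))"
        using norm_triangle_ineq by metis
      also have "norm (integral {0..t} (\<lambda>s. b s - a s)) \<le> integral {0..t} (\<lambda>s. norm (b s - a s))"
        using t by (intro norm_integral_le_integral_norm absolutely_integrable_subinterval_Icc[OF ba]) auto
      finally show ?thesis using key[OF t] init[of 0] by simp
    qed
  qed auto
  then show "t \<in> {-1..T} \<Longrightarrow> norm (y t - x t) \<le> 2 * (\<eta> + \<epsilon>) * exp (4 * integral {0..T} l)" .
  let ?B = "2 * (\<eta> + \<epsilon>) * exp (4 * integral {0..T} l)"
  have "integral {0..T} (\<lambda>s. l s * (?u s + ?u (s - 1))) \<le> integral {0..T} (\<lambda>s. l s * (2 * ?B))"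
  proof (rule integral_le)
    show "l s * (?u s + ?u (s - 1)) \<le> l s * (2 * ?B)" if "s \<in> {0..T}" for s
      using bound[of s] bound[of "s - 1"] that l(2) by (intro mult_left_mono) auto
  qed (use T lu l in \<open>auto intro!: integrable_on_mult_left simp: absolutely_integrable_on_def\<close>)
  then have "integral {0..T} (\<lambda>s. l s * (?u s + ?u (s - 1))) \<le> integral {0..T} l * (2 * ?B)"
    by simp
  moreover have "integral {0..T} l * (2 * ?B) = 4 * (\<eta> + \<epsilon>) * exp (4 * integral {0..T} l) * integral {0..T} l"
    by (simp add: algebra_simps)
  ultimately show "integral {0..T} (\<lambda>t. norm (b t - a t)) \<le>
      4 * (\<eta> + \<epsilon>) * exp (4 * integral {0..T} l) * integral {0..T} l + \<epsilon>"
    using key[OF atLeastAtMost_iff[THEN iffD2, OF conjI[OF T order_refl]]] by linarith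
qed

text \<open>The ranges of both curves are compact, so one integrable Lipschitz bound covers them;
  the comparison with zero initial difference and zero error leaves no difference.\<close>

lemma isol_unique:
  assumes g: "g \<in> LC_fun" and x: "isol g \<phi> c x" and y: "isol g \<phi> c y" and t: "t \<in> {-1..c}"
  shows "y t = x t"
proof (cases "0 \<le> c")
  case False
  then show ?thesis using assms by (auto simp: isol_def)
next
  case True
  let ?K = "(\<lambda>t. (x t, x (t - 1))) ` {0..c} \<union> (\<lambda>t. (y t, y (t - 1))) ` {0..c}"
  have cx: "continuous_on {-1..c} x" and cy: "continuous_on {-1..c} y" using x y by (auto simp: isol_def)
  have "compact ?K"
    by (intro compact_Un compact_continuous_image isol_curve_continuous cx cy) auto
  from LC_bounds[OF g this] obtain l where l: "l absolutely_integrable_on {0..c}" "\<And>t. 0 \<le> l t"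
    "AE t in lebesgue. \<forall>z1\<in>?K. \<forall>z2\<in>?K. norm (g t z1 - g t z2) \<le> l t * norm (z1 - z2)"
    by blast
  have "norm (y t - x t) \<le> 2 * (0 + 0) * exp (4 * integral {0..c} l)"
  proof (rule delay_comparison(1)[OF True cx cy _ _ _ _ l(1,2), where e = "\<lambda>_. 0" and
        a = "\<lambda>s. g s (x s, x (s - 1))" and b = "\<lambda>s. g s (y s, y (s - 1))"])
    show "x t = x 0 + integral {0..t} (\<lambda>s. g s (x s, x (s - 1)))"
      "y t = y 0 + integral {0..t} (\<lambda>s. g s (y s, y (s - 1)))" if "t \<in> {0..c}" for t
      using x y that by (auto simp: isol_def)
    show "norm (y t - x t) \<le> 0" if "t \<in> {-1..0}" for t
      using x y that by (auto simp: isol_def)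
    show "AE t in lebesgue. t \<in> {0..c} \<longrightarrow> norm (g t (y t, y (t - 1)) - g t (x t, x (t - 1)))
      \<le> l t * (norm (y t - x t) + norm (y (t - 1) - x (t - 1))) + 0"
      using l(3)
    proof eventually_elim
      case (elim t)
      show ?case
      proof
        assume "t \<in> {0..c}"
        then have "norm (g t (y t, y (t - 1)) - g t (x t, x (t - 1))) \<le>
            l t * norm ((y t, y (t - 1)) - (x t, x (t - 1)))"
          using elim by blast
        also have "\<dots> \<le> l t * (norm (y t - x t) + norm (y (t - 1) - x (t - 1)))"
          by (intro mult_left_mono norm_Pair_diff_le l)
        finally show "norm (g t (y t, y (t - 1)) - g t (x t, x (t - 1)))
          \<le> l t * (norm (y t - x t) + norm (y (t - 1) - x (t - 1))) + 0" by simp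
      qed
    qed
  qed (use t isol_integrable[OF g cx] isol_integrable[OF g cy] in auto)
  then show ?thesis by simp
qed

section \<open>Global existence for globally Lipschitz right-hand sides\<close>

lemma delay_equation_global_existence:
  fixes h :: "real \<Rightarrow> (real^'n) \<times> (real^'n) \<Rightarrow> real^'n"
  assumes h: "h \<in> LC_fun" and T: "0 \<le> T" and \<phi>: "continuous_on {-1..0} \<phi>"
    and l: "l absolutely_integrable_on {0..T}" "\<And>t. 0 \<le> l t"
    and lip: "AE t in lebesgue. \<forall>z1 z2. norm (h t z1 - h t z2) \<le> l t * norm (z1 - z2)"
  shows "\<exists>x. continuous_on UNIV x \<and> isol h \<phi> T x"
proof -
  \<comment> \<open>Times are clamped to \<open>{0..T}\<close>, so that the contraction acts on
    bounded continuous functions on the whole line, which form a complete metric type.\<close>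
  let ?c = "\<lambda>t. max 0 (min T t)"
  let ?E = "\<lambda>t. exp (8 * integral {0..t} l)"
  have cE: "continuous_on {..T} ?E"
    by (intro continuous_intros continuous_indefinite_integral_extended[OF l(1) T])
  have li: "l integrable_on {0..t}" if "t \<le> T" for t
    using absolutely_integrable_subinterval_Icc[OF l(1), of 0 t] that by (simp add: absolutely_integrable_on_def)
  have Emono: "?E s \<le> ?E t" if "s \<le> t" "t \<le> T" for s t
    using integral_subset_Icc_nonneg[OF li[of t], of 0 s] that l(2) by simp
  \<comment> \<open>\<open>w\<close> stands for \<open>(x - x(0)) / ?E\<close>, which makes the equation a contraction in the sup norm. Subtracting
    \<open>w 0\<close> keeps \<open>Y w\<close> continuous at \<open>0\<close> for every \<open>w\<close>; the fixed point has \<open>w 0 = 0\<close>.\<close>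
  define Y :: "(real \<Rightarrow>\<^sub>C (real^'n)) \<Rightarrow> real \<Rightarrow> real^'n" where
    "Y w t = \<phi> (max (-1) (min 0 t)) + ?E (?c t) *\<^sub>R (w (?c t) - w 0)" for w t
  have cY: "continuous_on UNIV (Y w)" for w
    unfolding Y_def
    by (intro continuous_on_add continuous_on_scaleR continuous_on_diff continuous_on_const
        continuous_on_compose2[OF \<phi>] continuous_on_compose2[OF cE]
        continuous_on_compose2[OF continuous_on_apply_bcontfun[of UNIV w]] continuous_intros)
      (use T in auto)
  have hi: "(\<lambda>s. h s (Y w s, Y w (s - 1))) absolutely_integrable_on {a..b}" for w a b
    by (intro LC_fun_curve_integrable[OF h] continuous_intros continuous_on_subset[OF cY]
        continuous_on_compose2[OF cY]) auto
  define F where "F w t = (1 / ?E t) *\<^sub>R integral {0..t} (\<lambda>s. h s (Y w s, Y w (s - 1)))" for w t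
  have cF: "continuous_on {0..T} (F w)" for w
    unfolding F_def
    by (intro continuous_intros continuous_on_subset[OF cE]
        continuous_on_subset[OF continuous_indefinite_integral_extended[OF hi T]]) auto
  have bF: "(\<lambda>t. F w (?c t)) \<in> bcontfun" for w
  proof -
    have "continuous_on UNIV (\<lambda>t. F w (?c t))"
      by (rule continuous_on_compose2[OF cF]) (use T in \<open>auto intro!: continuous_intros\<close>)
    moreover have "bounded (F w ` {0..T})"
      by (intro compact_imp_bounded compact_continuous_image cF) auto
    then have "bounded (range (\<lambda>t. F w (?c t)))"
      by (rule bounded_subset) (use T in auto)
    ultimately show ?thesis by (simp add: bcontfun_def)
  qed
  define \<Psi> where "\<Psi> w = Bcontfun (\<lambda>t. F w (?c t))" for w
  have \<Psi>: "apply_bcontfun (\<Psi> w) t = F w (?c t)" for w t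
    using bF[of w] by (simp add: \<Psi>_def Bcontfun_inverse)
  have "\<exists>!w. \<Psi> w = w"
  \<comment> \<open>Since \<open>v\<close> and \<open>w\<close> differ by at most \<open>?d\<close>
    both at the current time and at 0, the curves \<open>Y\<close> differ by at most
    \<open>2 * ?d * ?E\<close>. Both components together give \<open>4 * l * ?d * ?E\<close>, which
    is \<open>?d / 2\<close> times the integrand \<open>8 * l * ?E\<close> of the weight.\<close>
  proof (rule banach_fix_type[where c = "1 / 2"])
    show "\<forall>v w. dist (\<Psi> v) (\<Psi> w) \<le> 1 / 2 * dist v w"
    proof (intro allI dist_bound)
      fix v w :: "real \<Rightarrow>\<^sub>C (real^'n)" and t
      let ?d = "dist v w"
      have t: "?c t \<in> {0..T}" using T by auto
      have vw: "norm (v s - w s) \<le> ?d" for s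
        using dist_bounded[of v s w] by (simp add: dist_norm)
      have Yd: "norm (Y v s - Y w s) \<le> 2 * ?d * ?E r" if "s \<le> r" "r \<in> {0..T}" for s r
      proof -
        have "Y v s - Y w s = ?E (?c s) *\<^sub>R ((v (?c s) - w (?c s)) - (v 0 - w 0))"
          by (simp add: Y_def algebra_simps)
        also have "norm \<dots> = ?E (?c s) * norm ((v (?c s) - w (?c s)) - (v 0 - w 0))" by simp
        also have "\<dots> \<le> ?E r * (2 * ?d)"
        proof (rule mult_mono)
          show "?E (?c s) \<le> ?E r" using that by (intro Emono) auto
          show "norm ((v (?c s) - w (?c s)) - (v 0 - w 0)) \<le> 2 * ?d"
            using norm_triangle_ineq4[of "v (?c s) - w (?c s)" "v 0 - w 0"] vw[of "?c s"] vw[of 0] by simp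
        qed auto
        finally show ?thesis by (simp add: mult_ac)
      qed
      let ?I = "integral {0..?c t} (\<lambda>s. h s (Y v s, Y v (s - 1)) - h s (Y w s, Y w (s - 1)))"
      have "norm ?I \<le> integral {0..?c t} (\<lambda>s. norm (h s (Y v s, Y v (s - 1)) - h s (Y w s, Y w (s - 1))))"
        by (intro norm_integral_le_integral_norm set_integral_diff hi)
      also have "\<dots> \<le> integral {0..?c t} (\<lambda>s. ?d / 2 * (8 * l s * ?E s))"
      proof (rule integral_mono_AE_Icc)
        show "(\<lambda>s. ?d / 2 * (8 * l s * ?E s)) integrable_on {0..?c t}"
          using integral_exp_weight[OF l(1) t, of 8] by (intro integrable_on_mult_right) (auto simp: integrable_on_def)
        show "AE s in lebesgue. s \<in> {0..?c t} \<longrightarrow>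
          norm (h s (Y v s, Y v (s - 1)) - h s (Y w s, Y w (s - 1))) \<le> ?d / 2 * (8 * l s * ?E s)"
          using lip
        proof eventually_elim
          case (elim s)
          show ?case
          proof
            assume "s \<in> {0..?c t}"
            then have s: "s \<in> {0..T}" using t by auto
            have "norm (h s (Y v s, Y v (s - 1)) - h s (Y w s, Y w (s - 1))) \<le>
              l s * norm ((Y v s, Y v (s - 1)) - (Y w s, Y w (s - 1)))"
              using elim by blast
            also have "\<dots> \<le> l s * (2 * ?d * ?E s + 2 * ?d * ?E s)"
              using Yd[of s s] Yd[of "s - 1" s] s
              by (intro mult_left_mono l order_trans[OF norm_Pair_diff_le] add_mono) auto
            finally show "norm (h s (Y v s, Y v (s - 1)) - h s (Y w s, Y w (s - 1))) \<le> ?d / 2 * (8 * l s * ?E s)"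
              by simp
          qed
        qed
      qed (intro abs_integrable_norm_Icc set_integral_diff hi)
      also have "\<dots> = ?d / 2 * (?E (?c t) - 1)"
        using integral_unique[OF has_integral_mult_right[OF integral_exp_weight[OF l(1) t, of 8], of "?d / 2"]] by simp
      also have "\<dots> \<le> ?d / 2 * ?E (?c t)" by (intro mult_left_mono) auto
      finally have "norm ?I / ?E (?c t) \<le> ?d / 2"
        by (simp add: pos_divide_le_eq)
      moreover have "F v (?c t) - F w (?c t) = (1 / ?E (?c t)) *\<^sub>R ?I"
        unfolding F_def scaleR_diff_right[symmetric]
        by (subst Henstock_Kurzweil_Integration.integral_diff) (use hi in \<open>auto simp: absolutely_integrable_on_def\<close>)
      ultimately show "dist (\<Psi> v t) (\<Psi> w t) \<le> 1 / 2 * dist v w"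
        by (simp add: \<Psi> dist_norm)
    qed
  qed auto
  then obtain w where w: "\<Psi> w = w" by auto
  have wF: "w t = F w (?c t)" for t using \<Psi>[of w t] w by simp
  have w0: "w 0 = 0" using wF[of 0] T by (simp add: F_def)
  have "isol h \<phi> T (Y w)"
    unfolding isol_def
  proof (intro conjI ballI)
    show "continuous_on {-1..T} (Y w)" using cY continuous_on_subset by blast
    show "Y w t = \<phi> t" if "t \<in> {-1..0}" for t
    proof -
      have "max (-1) (min 0 t) = t" "?c t = 0" using that T by auto
      then show ?thesis by (simp add: Y_def w0)
    qed
    show "Y w t = \<phi> 0 + integral {0..t} (\<lambda>s. h s (Y w s, Y w (s - 1)))" if "t \<in> {0..T}" for t
    proof -
      have *: "max (-1) (min 0 t) = 0" "?c t = t" using that by auto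
      have "w t = F w t" using wF[of t] * by simp
      then show ?thesis by (simp add: Y_def w0 * F_def)
    qed
  qed
  with cY show ?thesis by blast
qed

subsection \<open>Truncation, local existence and maximal solutions\<close>

text \<open>The components are clipped separately, not as a pair: the clipped current state then
  depends on the current state alone and inherits its modulus of continuity, whatever the delayed
  state does.\<close>

definition trunc :: "real \<Rightarrow> (real \<Rightarrow> 'a::euclidean_space \<times> 'a \<Rightarrow> 'b) \<Rightarrow> real \<Rightarrow> 'a \<times> 'a \<Rightarrow> 'b" where
  "trunc R g = (\<lambda>t z. g t (clip R (fst z), clip R (snd z)))"

lemma norm_Pair_clip_diff:
  "0 \<le> R \<Longrightarrow> norm ((clip R (fst z), clip R (snd z)) - (clip R (fst w), clip R (snd w))) \<le> norm (z - w)"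
  by (cases z; cases w) (auto simp: norm_Pair intro!: real_sqrt_le_mono add_mono power_mono clip_lipschitz)

lemma trunc_global_bounds:
  assumes g: "g \<in> LC_fun" and R: "0 \<le> R"
  shows "\<exists>m l. (\<forall>a b. m absolutely_integrable_on {a..b}) \<and> (\<forall>a b. l absolutely_integrable_on {a..b}) \<and>
    (\<forall>t. 0 \<le> l t) \<and> (AE t in lebesgue. \<forall>z. norm (trunc R g t z) \<le> m t) \<and>
    (AE t in lebesgue. \<forall>z1 z2. norm (trunc R g t z1 - trunc R g t z2) \<le> l t * norm (z1 - z2))"
proof -
  let ?K = "cball (0::real^'a) R \<times> cball (0::real^'a) R"
  have "compact ?K" by (intro compact_Times compact_cball)
  from LC_bounds[OF g this] obtain m l where ml: "\<forall>a b. m absolutely_integrable_on {a..b}"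
    "\<forall>a b. l absolutely_integrable_on {a..b}" "\<forall>t. 0 \<le> l t"
    "AE t in lebesgue. \<forall>z\<in>?K. norm (g t z) \<le> m t"
    "AE t in lebesgue. \<forall>z1\<in>?K. \<forall>z2\<in>?K. norm (g t z1 - g t z2) \<le> l t * norm (z1 - z2)"
    by blast
  have in_K: "(clip R (fst z), clip R (snd z)) \<in> ?K" for z :: "(real^'a) \<times> (real^'a)"
    by (intro SigmaI clip_in R)
  have "AE t in lebesgue. \<forall>z. norm (trunc R g t z) \<le> m t"
    using ml(4) by (rule eventually_mono) (metis in_K trunc_def)
  moreover have "AE t in lebesgue. \<forall>z1 z2. norm (trunc R g t z1 - trunc R g t z2) \<le> l t * norm (z1 - z2)"
    using ml(5)
  proof eventually_elim
    case (elim t)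
    show ?case
    proof (intro allI)
      fix z w
      have "norm (trunc R g t z - trunc R g t w) \<le>
          l t * norm ((clip R (fst z), clip R (snd z)) - (clip R (fst w), clip R (snd w)))"
        unfolding trunc_def using elim in_K by blast
      also have "\<dots> \<le> l t * norm (z - w)"
        using ml(3) by (intro mult_left_mono norm_Pair_clip_diff R) auto
      finally show "norm (trunc R g t z - trunc R g t w) \<le> l t * norm (z - w)" .
    qed
  qed
  ultimately show ?thesis using ml(1-3) by blast
qed

lemma trunc_LC_fun:
  assumes g: "g \<in> LC_fun" and R: "0 \<le> R"
  shows "trunc R g \<in> LC_fun"
proof -
  have 1: "(\<lambda>p::real \<times> (real^'a) \<times> (real^'a). (fst p, clip R (fst (snd p)), clip R (snd (snd p)))) \<in> borel \<rightarrow>\<^sub>M borel"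
    by (intro borel_measurable_continuous_onI continuous_on_Pair continuous_intros
        continuous_on_compose2[OF continuous_clip[OF R, of UNIV]]) auto
  have "(\<lambda>(t, z). g t z) \<in> borel \<rightarrow>\<^sub>M borel" using g by (simp add: LC_fun_def)
  from measurable_compose[OF 1 this]
  have "(\<lambda>(t, z). trunc R g t z) \<in> borel_measurable borel"
    by (simp add: trunc_def case_prod_unfold)
  moreover obtain m l where ml: "\<forall>a b. m absolutely_integrable_on {a..b}"
    "\<forall>a b. l absolutely_integrable_on {a..b}" "\<forall>t. 0 \<le> l t"
    "AE t in lebesgue. \<forall>z. norm (trunc R g t z) \<le> m t"
    "AE t in lebesgue. \<forall>z1 z2. norm (trunc R g t z1 - trunc R g t z2) \<le> l t * norm (z1 - z2)"
    using trunc_global_bounds[OF assms] by blast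
  have "AE t in lebesgue. (\<forall>z\<in>K. norm (trunc R g t z) \<le> m t) \<and>
    (\<forall>z1\<in>K. \<forall>z2\<in>K. norm (trunc R g t z1 - trunc R g t z2) \<le> l t * norm (z1 - z2))" for K
    using ml(4,5) by eventually_elim blast
  then have "\<exists>m l. L1_loc m \<and> L1_loc l \<and> (AE t in lebesgue. (\<forall>z\<in>K. norm (trunc R g t z) \<le> m t) \<and>
    (\<forall>z1\<in>K. \<forall>z2\<in>K. norm (trunc R g t z1 - trunc R g t z2) \<le> l t * norm (z1 - z2)))" for K
    using ml(1,2) unfolding L1_loc_def by blast
  ultimately show ?thesis by (simp add: LC_fun_def)
qed

lemma trunc_isol_exists:
  assumes "g \<in> LC_fun" "0 \<le> R" "0 \<le> T" "continuous_on {-1..0} \<phi>"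
  shows "\<exists>x. continuous_on UNIV x \<and> isol (trunc R g) \<phi> T x"
proof -
  obtain l where "\<forall>a b. l absolutely_integrable_on {a..b}" "\<forall>t. 0 \<le> l t"
    "AE t in lebesgue. \<forall>z1 z2. norm (trunc R g t z1 - trunc R g t z2) \<le> l t * norm (z1 - z2)"
    using trunc_global_bounds[OF assms(1,2)] by blast
  then show ?thesis
    by (intro delay_equation_global_existence[where l = l] trunc_LC_fun assms) auto
qed

lemma isol_trunc_iff:
  assumes "\<And>t. t \<in> {-1..c} \<Longrightarrow> norm (x t) \<le> R"
  shows "isol (trunc R g) \<phi> c x \<longleftrightarrow> isol g \<phi> c x"
proof -
  have "integral {0..t} (\<lambda>s. trunc R g s (x s, x (s - 1))) = integral {0..t} (\<lambda>s. g s (x s, x (s - 1)))"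
    if "t \<in> {0..c}" for t
    using that assms by (intro integral_cong) (auto simp: trunc_def clip_self)
  then show ?thesis by (auto simp: isol_def)
qed

lemma isol_bounded:
  assumes "isol g \<phi> c x"
  shows "\<exists>B>0. \<forall>t\<in>{-1..c}. norm (x t) \<le> B"
proof -
  have "bounded (x ` {-1..c})"
    using assms by (intro compact_imp_bounded compact_continuous_image) (auto simp: isol_def)
  then obtain B where "0 < B" "\<forall>y\<in>x ` {-1..c}. norm y \<le> B"
    unfolding bounded_pos by blast
  then show ?thesis by blast
qed

lemma ereal_le_less_trans: "x \<le> c \<Longrightarrow> ereal c < b \<Longrightarrow> ereal x < b"
  by (meson ereal_less_eq(3) order.strict_trans1)

text \<open>The equation truncated one above a bound of \<open>x\<close> has a solution beyond
  \<open>c\<close>. It agrees with \<open>x\<close> up to \<open>c\<close>, is strictly inside the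
  ball there, and by continuity the truncation stays inactive for some time after
  \<open>c\<close>.\<close>

lemma isol_extend:
  assumes g: "g \<in> LC_fun" and \<phi>: "continuous_on {-1..0} \<phi>" and c: "0 \<le> c" and x: "isol g \<phi> c x"
  shows "\<exists>d>c. \<exists>y. isol g \<phi> d y"
proof -
  obtain B where B: "0 < B" "\<And>t. t \<in> {-1..c} \<Longrightarrow> norm (x t) \<le> B"
    using isol_bounded[OF x] by blast
  let ?R = "B + 1"
  have R: "0 \<le> ?R" using B by simp
  obtain y where cy: "continuous_on UNIV y" and y: "isol (trunc ?R g) \<phi> (c + 1) y"
    using trunc_isol_exists[OF g R _ \<phi>, of "c + 1"] c by auto
  have "isol (trunc ?R g) \<phi> c x"
  proof (subst isol_trunc_iff)
    show "norm (x t) \<le> ?R" if "t \<in> {-1..c}" for t using B(2)[OF that] by simp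
  qed (rule x)
  then have yx: "y t = x t" if "t \<in> {-1..c}" for t
    using isol_unique[OF trunc_LC_fun[OF g R] _ isol_mono[OF y] that] by simp
  have "\<forall>\<^sub>F t in at c. norm (y t) < ?R"
  proof (rule order_tendstoD)
    show "((\<lambda>t. norm (y t)) \<longlongrightarrow> norm (y c)) (at c)"
      using cy by (intro tendsto_norm) (simp add: continuous_on_def)
    show "norm (y c) < ?R" using yx[of c] B(2)[of c] c by simp
  qed
  then obtain \<delta> where \<delta>: "\<delta> > 0" "\<And>t. t \<noteq> c \<Longrightarrow> dist t c < \<delta> \<Longrightarrow> norm (y t) < ?R"
    by (auto simp: eventually_at)
  define d where "d = c + min 1 (\<delta> / 2)"
  have "isol (trunc ?R g) \<phi> d y"
    by (rule isol_mono[OF y]) (simp add: d_def)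
  moreover have "norm (y t) \<le> ?R" if "t \<in> {-1..d}" for t
  proof (cases "t \<le> c")
    case True
    then show ?thesis using yx[of t] B(2)[of t] that by simp
  next
    case False
    then have "norm (y t) < ?R"
      using \<delta>(1) that by (intro \<delta>(2)) (auto simp: d_def dist_real_def)
    then show ?thesis by simp
  qed
  ultimately have "isol g \<phi> d y"
    using isol_trunc_iff[of d y ?R g \<phi>] by blast
  moreover have "d > c" using \<delta>(1) by (simp add: d_def)
  ultimately show ?thesis by blast
qed

section \<open>Equivalence with Caratheodory solutions; the maximal interval\<close>

lemma dde_isol:
  assumes g: "g \<in> LC_fun" and x: "dde_solution g \<phi> b x" and c: "0 \<le> c" "ereal c < b"
  shows "isol g \<phi> c x"
proof -
  have cx: "continuous_on {-1..c} x"
    using x c by (auto simp: dde_solution_def intro: ereal_le_less_trans elim!: continuous_on_subset)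
  have "x t = x 0 + integral {0..t} (\<lambda>s. g s (x s, x (s - 1)))" if "t \<in> {0..c}" for t
  proof (rule abs_continuous_on_FTC[OF _ isol_integrable[OF g cx] _ that])
    show "abs_continuous_on 0 c x" using x c by (auto simp: dde_solution_def)
    have "AE t in lebesgue. 0 < t \<and> ereal t < b \<longrightarrow> (x has_vector_derivative g t (x t, x (t - 1))) (at t)"
      using x by (simp add: dde_solution_def)
    then show "AE t in lebesgue. t \<in> {0<..<c} \<longrightarrow> (x has_vector_derivative g t (x t, x (t - 1))) (at t)"
    proof eventually_elim
      case (elim t)
      show ?case
      proof
        assume "t \<in> {0<..<c}"
        moreover then have "ereal t < b" using c by (auto intro: ereal_le_less_trans[OF less_imp_le])
        ultimately show "(x has_vector_derivative g t (x t, x (t - 1))) (at t)" using elim by simp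
      qed
    qed
  qed
  then show ?thesis using cx x by (simp add: isol_def dde_solution_def)
qed

lemma isol_dde:
  assumes g: "g \<in> LC_fun" and b: "0 < b" and x: "\<And>c. 0 \<le> c \<Longrightarrow> ereal c < b \<Longrightarrow> isol g \<phi> c x"
  shows "dde_solution g \<phi> b x"
  unfolding dde_solution_def
proof (intro conjI allI impI ballI)
  show "continuous_on {t. -1 \<le> t \<and> ereal t < b} x"
    unfolding continuous_on_eq_continuous_within
  proof
    fix t assume t: "t \<in> {t. -1 \<le> t \<and> ereal t < b}"
    then have "max (ereal t) 0 < b" using b by simp
    then obtain c where c: "max (ereal t) 0 < ereal c" "ereal c < b"
      using ereal_dense2 by blast
    then have "continuous_on {-1..c} x"
      using x[of c] by (auto simp: isol_def zero_ereal_def)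
    then have "continuous (at t within {-1..c}) x"
      using t c by (auto simp: continuous_on_eq_continuous_within)
    moreover have "at t within {t. -1 \<le> t \<and> ereal t < b} = at t within {-1..c}"
    proof (rule at_within_nhd[of t "{..<c}"])
      show "{t. -1 \<le> t \<and> ereal t < b} \<inter> {..<c} - {t} = {-1..c} \<inter> {..<c} - {t}"
        using c(2) by (auto intro: ereal_le_less_trans[OF less_imp_le])
    qed (use c in auto)
    ultimately show "continuous (at t within {t. -1 \<le> t \<and> ereal t < b}) x" by simp
  qed
  show "x t = \<phi> t" if "t \<in> {-1..0}" for t
    using x[of 0] b that by (auto simp: isol_def zero_ereal_def)
  show "abs_continuous_on 0 c x" if "0 \<le> c" "ereal c < b" for c
    using x[OF that] isol_integrable[OF g isol_continuous[OF x[OF that]]]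
    by (intro abs_continuous_indefinite_integral[where c = "\<phi> 0"]) (auto simp: isol_def)
  \<comment> \<open>Differentiability almost everywhere comes with one null set per right end.
    Rational ends suffice to reach every \<open>t < b\<close>, and their null sets have a null
    union.\<close>
  have "AE t in lebesgue. \<forall>q\<in>\<rat>. 0 \<le> q \<and> ereal q < b \<longrightarrow> t \<in> {0<..<q} \<longrightarrow>
      ((\<lambda>t. integral {0..t} (\<lambda>s. g s (x s, x (s - 1)))) has_vector_derivative g t (x t, x (t - 1))) (at t)"
    unfolding AE_ball_countable[OF countable_rat]
  proof (intro ballI)
    fix q :: real
    show "AE t in lebesgue. 0 \<le> q \<and> ereal q < b \<longrightarrow> t \<in> {0<..<q} \<longrightarrow>
      ((\<lambda>t. integral {0..t} (\<lambda>s. g s (x s, x (s - 1)))) has_vector_derivative g t (x t, x (t - 1))) (at t)"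
    proof (cases "0 \<le> q \<and> ereal q < b")
      case True
      then show ?thesis
        using AE_derivative_indefinite_integral[OF isol_integrable[OF g isol_continuous[OF x[of q]]]] by simp
    qed auto
  qed
  then show "AE t in lebesgue. 0 < t \<and> ereal t < b \<longrightarrow> (x has_vector_derivative g t (x t, x (t - 1))) (at t)"
  proof eventually_elim
    case (elim t)
    show ?case
    proof
      assume t: "0 < t \<and> ereal t < b"
      then obtain c where c: "ereal t < ereal c" "ereal c < b"
        using ereal_dense2 by blast
      then obtain q where q: "q \<in> \<rat>" "t < q" "q < c"
        using Rats_dense_in_real[of t c] by auto
      have qb: "ereal q < b" using q c by (meson ereal_less(3) less_ereal.simps(1) order.strict_trans)
      let ?F = "\<lambda>t. integral {0..t} (\<lambda>s. g s (x s, x (s - 1)))"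
      have "(?F has_vector_derivative g t (x t, x (t - 1))) (at t)"
        using elim q t qb by auto
      then have "((\<lambda>t. \<phi> 0 + ?F t) has_vector_derivative g t (x t, x (t - 1))) (at t)"
        using has_vector_derivative_add[OF has_vector_derivative_const] by fastforce
      then show "(x has_vector_derivative g t (x t, x (t - 1))) (at t)"
        using x[of q] q t qb
        by (rule_tac has_vector_derivative_transform_within_open[where S = "{0<..<q}"]) (auto simp: isol_def)
    qed
  qed
qed (rule b)

lemma isol_initial: "continuous_on {-1..0} \<phi> \<Longrightarrow> isol g \<phi> 0 \<phi>"
  by (simp add: isol_def)

text \<open>A solution on the closed interval extends past \<open>c\<close>, so the end of a maximal
  one lies strictly beyond \<open>c\<close>. This reduces questions about \<open>sol_end\<close> to
  solvability on compact intervals.\<close>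

lemma maximal_dde_solution_less_iff:
  assumes g: "g \<in> LC_fun" and \<phi>: "continuous_on {-1..0} \<phi>" and x: "maximal_dde_solution g \<phi> b x"
    and c: "0 \<le> c"
  shows "ereal c < b \<longleftrightarrow> (\<exists>y. isol g \<phi> c y)"
proof
  show "ereal c < b \<Longrightarrow> \<exists>y. isol g \<phi> c y"
    using dde_isol[OF g _ c] x by (auto simp: maximal_dde_solution_def)
  assume "\<exists>y. isol g \<phi> c y"
  then obtain d y where d: "c < d" and y: "isol g \<phi> d y"
    using isol_extend[OF g \<phi> c] by blast
  show "ereal c < b"
  proof (rule ccontr)
    assume nb: "\<not> ereal c < b"
    then have bd: "b < ereal d" using d by (meson less_ereal.simps(1) not_less order.strict_trans1)
    have "dde_solution g \<phi> (ereal d) y"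
      using d c by (intro isol_dde[OF g] isol_mono[OF y]) auto
    moreover have "y t = x t" if "-1 \<le> t" "ereal t < b" for t
    proof (rule isol_unique[OF g])
      have "ereal (max 0 t) < b"
        using x that by (auto simp: max_def maximal_dde_solution_def dde_solution_def zero_ereal_def)
      then show "isol g \<phi> (max 0 t) x"
        using x by (intro dde_isol[OF g]) (auto simp: maximal_dde_solution_def)
      have "t < d" using order.strict_trans[OF that(2) bd] by simp
      then show "isol g \<phi> (max 0 t) y"
        using c d by (intro isol_mono[OF y]) auto
    qed (use that in auto)
    ultimately have "ereal d = b"
      using x bd unfolding maximal_dde_solution_def by (meson less_imp_le)
    then show False using bd by simp
  qed
qed

text \<open>By uniqueness all solutions on compact intervals agree where they overlap, and their
  union is the maximal solution.\<close>

lemma maximal_dde_solution_exists: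
  assumes g: "g \<in> LC_fun" and \<phi>: "continuous_on {-1..0} \<phi>"
  shows "\<exists>b x. maximal_dde_solution g \<phi> b x"
proof -
  define S where "S = {c. 0 \<le> c \<and> (\<exists>x. isol g \<phi> c x)}"
  define b where "b = Sup (ereal ` S)"
  \<comment> \<open>At each time any solution that reaches it may be chosen; \<open>max 0 t\<close>
    takes care of the times in the initial interval.\<close>
  define X where "X t = (SOME x. isol g \<phi> (max 0 t) x) t" for t
  have S: "c \<in> S \<longleftrightarrow> ereal c < b" if c0: "0 \<le> c" for c
  proof
    assume "c \<in> S"
    then obtain x where "isol g \<phi> c x" by (auto simp: S_def)
    from isol_extend[OF g \<phi> c0 this] obtain d y where "c < d" "isol g \<phi> d y"
      by blast
    then have "d \<in> S" using c0 by (auto simp: S_def)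
    then have "ereal d \<le> b" by (auto simp: b_def intro: Sup_upper)
    then show "ereal c < b" using \<open>c < d\<close> by (meson less_ereal.simps(1) order.strict_trans2)
  next
    assume "ereal c < b"
    then obtain d where "d \<in> S" "c < d" by (auto simp: b_def less_Sup_iff)
    then show "c \<in> S" using c0 by (auto simp: S_def) (meson isol_mono less_imp_le)
  qed
  have X: "isol g \<phi> c X" if c: "c \<in> S" for c
  proof -
    obtain x where x: "isol g \<phi> c x" and c0: "0 \<le> c" using c by (auto simp: S_def)
    show ?thesis
    proof (rule isol_cong[OF x _ c0])
      fix t assume t: "t \<in> {-1..c}"
      have xm: "isol g \<phi> (max 0 t) x" using t c0 by (intro isol_mono[OF x]) auto
      then have "isol g \<phi> (max 0 t) (SOME x. isol g \<phi> (max 0 t) x)"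
        by (rule someI[where P = "isol g \<phi> (max 0 t)"])
      from isol_unique[OF g xm this, of t] t show "X t = x t" by (simp add: X_def)
    qed
  qed
  have "0 \<in> S" using isol_initial[OF \<phi>] by (auto simp: S_def)
  then have "0 < b" using S[of 0] by (simp add: zero_ereal_def)
  then have "dde_solution g \<phi> b X"
    using S X by (intro isol_dde[OF g]) auto
  moreover have "c = b" if "dde_solution g \<phi> c y" "b \<le> c" for c y
  proof (rule ccontr)
    assume "c \<noteq> b"
    then have "b < c" using that by simp
    then obtain d where d: "b < ereal d" "ereal d < c" using ereal_dense2 by blast
    have "0 < ereal d" using \<open>0 < b\<close> d(1) by (rule order.strict_trans)
    then have "isol g \<phi> d y" "0 \<le> d"
      using d by (auto intro!: dde_isol[OF g that(1)])
    then have "d \<in> S" by (auto simp: S_def)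
    then show False using S[OF \<open>0 \<le> d\<close>] d by auto
  qed
  ultimately have "maximal_dde_solution g \<phi> b X"
    unfolding maximal_dde_solution_def by blast
  then show ?thesis by blast
qed

lemma maximal_dde_solution_unique_end:
  assumes g: "g \<in> LC_fun" and \<phi>: "continuous_on {-1..0} \<phi>"
    and "maximal_dde_solution g \<phi> b x" "maximal_dde_solution g \<phi> b' x'"
  shows "b' = b"
proof -
  have "b' \<le> b" if 1: "maximal_dde_solution g \<phi> b x" "maximal_dde_solution g \<phi> b' x'" for b x b' x'
  proof (rule ccontr)
    assume "\<not> b' \<le> b"
    then obtain d where d: "b < ereal d" "ereal d < b'" using ereal_dense2 by (meson not_less)
    have "0 < b" using 1 by (simp add: maximal_dde_solution_def dde_solution_def)
    then have "0 < ereal d" using d(1) by (rule order.strict_trans)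
    then have "0 \<le> d" by simp
    then have "ereal d < b"
      using maximal_dde_solution_less_iff[OF g \<phi> 1(1)] maximal_dde_solution_less_iff[OF g \<phi> 1(2)] d by blast
    then show False using d by simp
  qed
  then show ?thesis using assms by (meson antisym)
qed

lemma LC_eq_rep: "LC_eq (rep_LC G) (rep_LC G)"
  by (rule Quotient_rep_reflp[OF Quotient_LC])

lemma rep_LC_LC_fun: "rep_LC G \<in> LC_fun"
  using LC_eq_rep[of G] by (simp add: LC_eq_def)

lemma sol_maximal:
  assumes "continuous_on {-1..0} \<phi>"
  shows "maximal_dde_solution (rep_LC G) \<phi> (sol_end G \<phi>) (sol G \<phi>)"
proof -
  obtain b x where bx: "maximal_dde_solution (rep_LC G) \<phi> b x"
    using maximal_dde_solution_exists[OF rep_LC_LC_fun assms] by blast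
  have "sol_end G \<phi> = b"
    unfolding sol_end_def
    by (rule the_equality) (use bx maximal_dde_solution_unique_end[OF rep_LC_LC_fun assms bx] in blast)+
  then show ?thesis
    unfolding sol_def using bx by (simp add: someI)
qed

lemma less_sol_end_iff:
  assumes "continuous_on {-1..0} \<phi>" "0 \<le> c"
  shows "ereal c < sol_end G \<phi> \<longleftrightarrow> (\<exists>x. isol (rep_LC G) \<phi> c x)"
  using maximal_dde_solution_less_iff[OF rep_LC_LC_fun assms(1) sol_maximal[OF assms(1)] assms(2)] .

lemma sol_isol:
  assumes "continuous_on {-1..0} \<phi>" "0 \<le> c" "ereal c < sol_end G \<phi>"
  shows "isol (rep_LC G) \<phi> c (sol G \<phi>)"
  using sol_maximal[OF assms(1)] assms(2,3)
  by (intro dde_isol[OF rep_LC_LC_fun]) (auto simp: maximal_dde_solution_def)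

subsection \<open>Time translation\<close>

lemma rep_translate_LC_eq: "LC_eq (rep_LC (translate_LC t G)) (time_shift t (rep_LC G))"
proof -
  have "LC_eq (time_shift t (rep_LC G)) (time_shift t (rep_LC G))"
    using time_shift_LC_fun[OF rep_LC_LC_fun] by (auto simp: LC_eq_def)
  then show ?thesis
    unfolding translate_LC_def by (simp add: Quotient_rep_abs[OF Quotient_LC])
qed

lemma rep_translate_LC_AE: "AE s in lebesgue. \<forall>z. rep_LC (translate_LC t G) s z = rep_LC G (s + t) z"
  using LC_eq_AE[OF rep_translate_LC_eq[of t G]] by (simp add: time_shift_def)

lemma rep_abs_LC_AE: "f \<in> LC_fun \<Longrightarrow> AE s in lebesgue. \<forall>z. rep_LC (abs_LC f) s z = f s z"
  by (intro LC_eq_AE Quotient_rep_abs[OF Quotient_LC]) (simp add: LC_eq_def)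

lemma translate_LC_add: "translate_LC t (translate_LC s G) = translate_LC (t + s) G"
proof (transfer)
  fix t s :: real and G :: "real \<Rightarrow> (real^'a) \<times> (real^'a) \<Rightarrow> real^'a"
  assume "LC_eq G G"
  then have "time_shift (t + s) G \<in> LC_fun" by (auto simp: LC_eq_def intro: time_shift_LC_fun)
  then show "LC_eq (time_shift t (time_shift s G)) (time_shift (t + s) G)"
    by (simp add: LC_eq_def time_shift_def add_ac)
qed

lemma translate_LC_0: "translate_LC 0 G = G"
  by transfer (simp add: time_shift_def)

text \<open>Together with uniqueness this yields the semigroup law, and it shows that
  \<open>s + t\<close> is still inside the maximal interval.\<close>

lemma isol_concat:
  assumes g: "g \<in> LC_fun" and s: "0 \<le> s" and t: "0 \<le> t" and x: "isol g \<phi> s x"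
    and \<psi>: "\<And>r. r \<in> {-1..0} \<Longrightarrow> \<psi> r = x (s + r)" and y: "isol (time_shift s g) \<psi> t y"
  shows "isol g \<phi> (s + t) (\<lambda>r. if r \<le> s then x r else y (r - s))"
proof -
  let ?z = "\<lambda>r. if r \<le> s then x r else y (r - s)"
  \<comment> \<open>The two pieces agree on the whole delay interval before \<open>s\<close>, not
    only at \<open>s\<close>; so the delayed arguments after the junction can be read off from
    \<open>y\<close>.\<close>
  have zy: "?z r = y (r - s)" if "s - 1 \<le> r" for r
    using that \<psi>[of "r - s"] y by (auto simp: isol_def)
  have cz: "continuous_on {-1..s + t} ?z"
  proof -
    have "continuous_on ({-1..s} \<union> {s..s + t}) ?z"
    proof (rule continuous_on_cases)
      show "continuous_on {-1..s} x" by (rule isol_continuous[OF x])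
      show "continuous_on {s..s + t} (\<lambda>r. y (r - s))"
        by (rule continuous_on_compose2[OF isol_continuous[OF y]]) (auto intro!: continuous_intros)
      show "\<forall>r. r \<in> {-1..s} \<and> \<not> r \<le> s \<or> r \<in> {s..s + t} \<and> r \<le> s \<longrightarrow> x r = y (r - s)"
        using zy[of s] by auto
    qed auto
    moreover have "{-1..s} \<union> {s..s + t} = {-1..s + t}" using s t by auto
    ultimately show ?thesis by simp
  qed
  have zi: "(\<lambda>q. g q (?z q, ?z (q - 1))) integrable_on {0..r}" if "r \<le> s + t" for r
    using isol_integrable[OF g continuous_on_subset[OF cz], of r] that by (simp add: absolutely_integrable_on_def)
  have 1: "?z r = \<phi> 0 + integral {0..r} (\<lambda>q. g q (?z q, ?z (q - 1)))" if "r \<in> {0..s}" for r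
  proof -
    have "integral {0..r} (\<lambda>q. g q (?z q, ?z (q - 1))) = integral {0..r} (\<lambda>q. g q (x q, x (q - 1)))"
      using that by (intro integral_cong) auto
    then show ?thesis using x that by (auto simp: isol_def)
  qed
  have 2: "?z r = \<phi> 0 + integral {0..r} (\<lambda>q. g q (?z q, ?z (q - 1)))" if "r \<in> {s..s + t}" for r
  proof -
    have "?z r = \<psi> 0 + integral {0..r - s} (\<lambda>q. g (q + s) (y q, y (q - 1)))"
      using zy[of r] y that by (auto simp: isol_def time_shift_def)
    also have "integral {0..r - s} (\<lambda>q. g (q + s) (y q, y (q - 1))) =
        integral {0..r - s} (\<lambda>q. g (q + s) (?z (q + s), ?z (q + s - 1)))"
    proof (rule integral_cong)
      fix q assume "q \<in> {0..r - s}"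
      then show "g (q + s) (y q, y (q - 1)) = g (q + s) (?z (q + s), ?z (q + s - 1))"
        using zy[of "q + s"] zy[of "q + s - 1"] by (simp add: algebra_simps)
    qed
    also have "\<dots> = integral {s..r} (\<lambda>q. g q (?z q, ?z (q - 1)))"
      using integral_translate_Icc[of 0 "r - s" "\<lambda>q. g q (?z q, ?z (q - 1))" s] by simp
    also have "\<psi> 0 = \<phi> 0 + integral {0..s} (\<lambda>q. g q (?z q, ?z (q - 1)))"
      using \<psi>[of 0] 1[of s] s by simp
    also have "\<dots> + integral {s..r} (\<lambda>q. g q (?z q, ?z (q - 1))) = \<phi> 0 + integral {0..r} (\<lambda>q. g q (?z q, ?z (q - 1)))"
      using Henstock_Kurzweil_Integration.integral_combine[OF s _ zi[of r]] that by (simp add: add.assoc)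
    finally show ?thesis .
  qed
  show ?thesis
    unfolding isol_def
  proof (intro conjI ballI cz)
    show "?z r = \<phi> r" if "r \<in> {-1..0}" for r
      using x s that by (auto simp: isol_def)
    show "?z r = \<phi> 0 + integral {0..r} (\<lambda>q. g q (?z q, ?z (q - 1)))" if "r \<in> {0..s + t}" for r
      using 1[of r] 2[of r] that by (cases "r \<le> s") auto
  qed
qed

subsection \<open>The space of absolutely continuous segments\<close>

text \<open>The derivative is carried along as a separate function \<open>k\<close>, determined only
  almost everywhere. Norm estimates then become estimates of integrals of \<open>k\<close>, without
  reference to \<open>vector_derivative\<close>.\<close>

definition primitive_of :: "(real \<Rightarrow> real^'n) \<Rightarrow> (real \<Rightarrow> real^'n) \<Rightarrow> bool" where
  "primitive_of k x \<longleftrightarrow> k absolutely_integrable_on {-1..0} \<and>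
     (\<forall>t\<in>{-1..0}. x t = x (-1) + integral {-1..t} k)"

lemma primitive_of_integrable: "primitive_of k x \<Longrightarrow> k absolutely_integrable_on {-1..0}"
  by (simp add: primitive_of_def)

lemma primitive_of_eq: "primitive_of k x \<Longrightarrow> t \<in> {-1..0} \<Longrightarrow> x t = x (-1) + integral {-1..t} k"
  unfolding primitive_of_def by blast

lemma primitive_of_continuous:
  assumes "primitive_of k x"
  shows "continuous_on {-1..0} x"
proof -
  have "continuous_on {-1..0} (\<lambda>t. x (-1) + integral {-1..t} k)"
    using primitive_of_integrable[OF assms]
    by (intro continuous_intros indefinite_integral_continuous_1) (simp add: absolutely_integrable_on_def)
  then show ?thesis
    by (rule continuous_on_eq) (rule primitive_of_eq[OF assms, symmetric])
qed

lemma primitive_of_derivative: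
  assumes "primitive_of k x"
  shows "AE t in lebesgue. t \<in> {-1..0} \<longrightarrow> (x has_vector_derivative k t) (at t within {-1..0}) \<and>
    vector_derivative x (at t within {-1..0}) = k t"
proof -
  note k = primitive_of_integrable[OF assms]
  have "AE t in lebesgue. t \<noteq> -1 \<and> t \<noteq> (0::real)"
    by (rule negligible_AE_lebesgue[of "{-1, 0}"]) auto
  with AE_derivative_indefinite_integral[OF k] show ?thesis
  proof eventually_elim
    case (elim t)
    show ?case
    proof
      assume "t \<in> {-1..0}"
      with elim(2) have t: "t \<in> {-1<..<0}" by auto
      then have "((\<lambda>t. integral {-1..t} k) has_vector_derivative k t) (at t)"
        using elim(1) by simp
      then have "((\<lambda>t. x (-1) + integral {-1..t} k) has_vector_derivative k t) (at t)"
        using has_vector_derivative_add[OF has_vector_derivative_const] by fastforce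
      then have "(x has_vector_derivative k t) (at t)"
      proof (rule has_vector_derivative_transform_within_open[where S = "{-1<..<0}"])
        show "x (-1) + integral {-1..s} k = x s" if "s \<in> {-1<..<0}" for s
          using primitive_of_eq[OF assms, of s] that by simp
      qed (use t in auto)
      moreover have "at t within {-1..0} = at t" using t by (intro at_within_Icc_at) auto
      ultimately show "(x has_vector_derivative k t) (at t within {-1..0}) \<and>
          vector_derivative x (at t within {-1..0}) = k t"
        by (simp add: vector_derivative_at)
    qed
  qed
qed

text \<open>One direction integrates the derivative by \<open>abs_continuous_on_FTC\<close>; the
  other uses absolute continuity and almost-everywhere differentiability of primitives.\<close>

lemma C11_iff: "x \<in> C11 \<longleftrightarrow> x \<in> extensional {-1..0} \<and> (\<exists>k. primitive_of k x)"
proof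
  assume x: "x \<in> C11"
  then obtain k where k: "k absolutely_integrable_on {-1..0}"
    and der: "AE t in lebesgue. t \<in> {-1..0} \<longrightarrow> (x has_vector_derivative k t) (at t within {-1..0})"
    by (auto simp: C11_def)
  have "AE t in lebesgue. t \<in> {-1<..<0} \<longrightarrow> (x has_vector_derivative k t) (at t)"
    using der
  proof eventually_elim
    case (elim t)
    show ?case
    proof
      assume t: "t \<in> {-1<..<0}"
      then have "at t within {-1..0} = at t" by (intro at_within_Icc_at) auto
      then show "(x has_vector_derivative k t) (at t)" using elim t by auto
    qed
  qed
  then have "primitive_of k x"
    using x k abs_continuous_on_FTC[OF _ k] unfolding primitive_of_def C11_def by blast
  then show "x \<in> extensional {-1..0} \<and> (\<exists>k. primitive_of k x)"
    using x by (auto simp: C11_def)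
next
  assume "x \<in> extensional {-1..0} \<and> (\<exists>k. primitive_of k x)"
  then obtain k where x: "x \<in> extensional {-1..0}" and k: "primitive_of k x" by blast
  have "abs_continuous_on (-1) 0 x"
    by (rule abs_continuous_indefinite_integral[OF primitive_of_integrable[OF k] primitive_of_eq[OF k]])
  moreover have "AE t in lebesgue. t \<in> {-1..0} \<longrightarrow> (x has_vector_derivative k t) (at t within {-1..0})"
    using primitive_of_derivative[OF k] by eventually_elim blast
  ultimately show "x \<in> C11"
    using x k unfolding C11_def primitive_of_def by blast
qed

lemma C11_continuous: "x \<in> C11 \<Longrightarrow> continuous_on {-1..0} x"
  using C11_iff primitive_of_continuous by blast

lemma C11_norm_eq:
  assumes "primitive_of k x"
  shows "C11_norm x = (SUP t\<in>{-1..0}. norm (x t)) + integral {-1..0} (\<lambda>t. norm (k t))"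
proof -
  let ?d = "\<lambda>t. vector_derivative x (at t within {-1..0})"
  note k = primitive_of_integrable[OF assms]
  obtain N where N: "negligible N" "\<And>t. t \<notin> N \<Longrightarrow> t \<in> {-1..0} \<longrightarrow> ?d t = k t"
    by (rule AE_lebesgue_negligible[OF primitive_of_derivative[OF assms]]) blast
  have nk: "(\<lambda>t. norm (k t)) absolutely_integrable_on {-1..0}"
    using absolutely_integrable_norm[OF k] by (simp add: o_def)
  have "(\<lambda>t. norm (?d t)) absolutely_integrable_on {-1..0}"
    by (rule absolutely_integrable_spike[OF nk N(1)]) (use N(2) in auto)
  then have "(LINT t:{-1..0}|lebesgue. norm (?d t)) = integral {-1..0} (\<lambda>t. norm (?d t))"
    by (rule set_lebesgue_integral_eq_integral(2))
  also have "\<dots> = integral {-1..0} (\<lambda>t. norm (k t))"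
    by (rule integral_spike[OF N(1)]) (use N(2) in auto)
  finally show ?thesis by (simp add: C11_norm_def)
qed

lemma norm_le_SUP_norm:
  assumes "continuous_on {-1..0} x" "t \<in> {-1..0::real}"
  shows "norm (x t) \<le> (SUP t\<in>{-1..0}. norm (x t))"
proof (rule cSUP_upper[OF assms(2)])
  show "bdd_above ((\<lambda>t. norm (x t)) ` {-1..0})"
    by (intro bounded_imp_bdd_above compact_imp_bounded compact_continuous_image continuous_intros assms) auto
qed

lemma primitive_of_diff:
  assumes "primitive_of k x" "primitive_of k' x'"
  shows "primitive_of (\<lambda>t. k t - k' t) (\<lambda>t. x t - x' t)"
  unfolding primitive_of_def
proof (intro conjI ballI)
  show "(\<lambda>t. k t - k' t) absolutely_integrable_on {-1..0}"
    by (intro set_integral_diff primitive_of_integrable[OF assms(1)] primitive_of_integrable[OF assms(2)])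
  fix t :: real assume t: "t \<in> {-1..0}"
  have "k integrable_on {-1..t}" "k' integrable_on {-1..t}"
    using t absolutely_integrable_subinterval_Icc[OF primitive_of_integrable[OF assms(1)], of "-1" t]
      absolutely_integrable_subinterval_Icc[OF primitive_of_integrable[OF assms(2)], of "-1" t]
    by (auto simp: absolutely_integrable_on_def)
  then show "x t - x' t = x (-1) - x' (-1) + integral {-1..t} (\<lambda>t. k t - k' t)"
    using primitive_of_eq[OF assms(1) t] primitive_of_eq[OF assms(2) t]
    by (simp only: Henstock_Kurzweil_Integration.integral_diff) (simp add: algebra_simps)
qed

lemma C11_norm_diff_le:
  assumes "primitive_of k x" "primitive_of k' x'"
    and "\<And>t. t \<in> {-1..0} \<Longrightarrow> norm (x t - x' t) \<le> A"
    and "integral {-1..0} (\<lambda>t. norm (k t - k' t)) \<le> B"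
  shows "C11_norm (\<lambda>t. x t - x' t) \<le> A + B"
  unfolding C11_norm_eq[OF primitive_of_diff[OF assms(1,2)]]
  by (intro add_mono cSUP_least assms) auto

lemma C11_norm_diff_ge:
  assumes "primitive_of k x" "primitive_of k' x'"
  shows "t \<in> {-1..0} \<Longrightarrow> norm (x t - x' t) \<le> C11_norm (\<lambda>t. x t - x' t)"
    and "integral {-1..0} (\<lambda>t. norm (k t - k' t)) \<le> C11_norm (\<lambda>t. x t - x' t)"
proof -
  note d = primitive_of_diff[OF assms]
  have i: "(\<lambda>t. norm (k t - k' t)) integrable_on {-1..0}"
    by (intro abs_integrable_norm_Icc primitive_of_integrable[OF d])
  have s: "norm (x t - x' t) \<le> (SUP t\<in>{-1..0}. norm (x t - x' t))" if "t \<in> {-1..0}" for t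
    by (rule norm_le_SUP_norm[OF primitive_of_continuous[OF d] that])
  show "norm (x t - x' t) \<le> C11_norm (\<lambda>t. x t - x' t)" if "t \<in> {-1..0}"
    using s[OF that] integral_nonneg[OF i] by (simp add: C11_norm_eq[OF d])
  show "integral {-1..0} (\<lambda>t. norm (k t - k' t)) \<le> C11_norm (\<lambda>t. x t - x' t)"
    using order_trans[OF norm_ge_zero s[of 0]] by (simp add: C11_norm_eq[OF d])
qed

lemma C11_norm_triangle:
  assumes "x \<in> C11" "y \<in> C11" "z \<in> C11"
  shows "C11_norm (\<lambda>t. x t - z t) \<le> C11_norm (\<lambda>t. x t - y t) + C11_norm (\<lambda>t. y t - z t)"
proof -
  obtain a b c where p: "primitive_of a x" "primitive_of b y" "primitive_of c z"
    using assms by (auto simp: C11_iff)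
  note xy = primitive_of_diff[OF p(1,2)] and yz = primitive_of_diff[OF p(2,3)]
  have "C11_norm (\<lambda>t. x t - z t) \<le>
      ((SUP t\<in>{-1..0}. norm (x t - y t)) + (SUP t\<in>{-1..0}. norm (y t - z t))) +
      (integral {-1..0} (\<lambda>t. norm (a t - b t)) + integral {-1..0} (\<lambda>t. norm (b t - c t)))"
  proof (rule C11_norm_diff_le[OF p(1,3)])
    show "norm (x t - z t) \<le> (SUP t\<in>{-1..0}. norm (x t - y t)) + (SUP t\<in>{-1..0}. norm (y t - z t))"
      if "t \<in> {-1..0}" for t
      using norm_le_SUP_norm[OF primitive_of_continuous[OF xy] that]
        norm_le_SUP_norm[OF primitive_of_continuous[OF yz] that]
        norm_triangle_ineq[of "x t - y t" "y t - z t"] by simp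
    show "integral {-1..0} (\<lambda>t. norm (a t - c t)) \<le>
        integral {-1..0} (\<lambda>t. norm (a t - b t)) + integral {-1..0} (\<lambda>t. norm (b t - c t))"
      by (intro integral_norm_triangle p[THEN primitive_of_integrable])
  qed
  then show ?thesis
    by (simp add: C11_norm_eq[OF xy] C11_norm_eq[OF yz])
qed

lemma C11_norm_zero: "C11_norm (\<lambda>t. 0) = 0"
proof -
  have "primitive_of (\<lambda>_. 0) (\<lambda>_. 0)" by (simp add: primitive_of_def)
  from C11_norm_eq[OF this] show ?thesis by simp
qed

lemma topspace_C11_topology: "topspace C11_topology = C11"
  unfolding C11_topology_def topology_generated_by_topspace
proof (intro subset_antisym subsetI)
  fix x :: "real \<Rightarrow> real^'a" assume x: "x \<in> C11"
  show "x \<in> \<Union> {{y \<in> C11. C11_norm (\<lambda>t. y t - x t) < e} | x e. x \<in> C11 \<and> e > 0}"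
  proof (rule UnionI)
    show "{y \<in> C11. C11_norm (\<lambda>t. y t - x t) < 1} \<in> {{y \<in> C11. C11_norm (\<lambda>t. y t - x t) < e} | x e. x \<in> C11 \<and> e > 0}"
      using x zero_less_one by blast
  qed (simp add: x C11_norm_zero)
qed blast

lemma openin_C11_ball:
  "x \<in> C11 \<Longrightarrow> e > 0 \<Longrightarrow> openin C11_topology {y \<in> C11. C11_norm (\<lambda>t. y t - x t) < e}"
  unfolding C11_topology_def by (intro topology_generated_by_Basis) blast

subsection \<open>Segments of solutions\<close>

text \<open>The derivative of a solution on all of \<open>{-1..T}\<close>: that of the initial
  function up to time 0, the right-hand side afterwards. Segments at times \<open>t < 1\<close>
  straddle both pieces.\<close>

definition velocity :: "(real \<Rightarrow> (real^'n) \<times> (real^'n) \<Rightarrow> real^'n) \<Rightarrow> (real \<Rightarrow> real^'n) \<Rightarrow>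
    (real \<Rightarrow> real^'n) \<Rightarrow> real \<Rightarrow> real^'n" where
  "velocity g k x s = (if s \<le> 0 then k s else g s (x s, x (s - 1)))"

lemma velocity_integral:
  assumes g: "g \<in> LC_fun" and k: "primitive_of k \<phi>" and x: "isol g \<phi> T x" and T: "0 \<le> T"
  shows "velocity g k x absolutely_integrable_on {-1..T}"
    and "r \<in> {-1..T} \<Longrightarrow> x r = x (-1) + integral {-1..r} (velocity g k x)"
proof -
  let ?v = "velocity g k x"
  note ik = primitive_of_integrable[OF k]
  note ig = isol_integrable[OF g isol_continuous[OF x]]
  have v1: "?v absolutely_integrable_on {-1..0}"
    by (rule absolutely_integrable_spike[OF ik negligible_empty]) (auto simp: velocity_def)
  have v2: "?v absolutely_integrable_on {0..T}"
    by (rule absolutely_integrable_spike[OF ig negligible_sing[of 0]]) (auto simp: velocity_def)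
  show v: "?v absolutely_integrable_on {-1..T}"
    using absolutely_integrable_on_combine[OF v1 v2] T by simp
  have xk: "x r = x (-1) + integral {-1..r} k" if "r \<in> {-1..0}" for r
  proof -
    have "x r = \<phi> r" "x (-1) = \<phi> (-1)" using x that by (auto simp: isol_def)
    then show ?thesis using primitive_of_eq[OF k that] by simp
  qed
  have vk: "integral {-1..r} ?v = integral {-1..r} k" if "r \<le> 0" for r
    using that by (intro integral_cong) (auto simp: velocity_def)
  assume r: "r \<in> {-1..T}"
  show "x r = x (-1) + integral {-1..r} ?v"
  proof (cases "r \<le> 0")
    case True
    then show ?thesis using xk[of r] vk[of r] r by simp
  next
    case False
    then have r0: "r \<in> {0..T}" using r by simp
    have "integral {0..r} ?v = integral {0..r} (\<lambda>s. g s (x s, x (s - 1)))"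
      by (rule integral_spike[OF negligible_sing[of 0]]) (auto simp: velocity_def)
    moreover have "x r = x 0 + integral {0..r} (\<lambda>s. g s (x s, x (s - 1)))"
      using x r0 by (auto simp: isol_def)
    moreover have "?v integrable_on {-1..r}"
      using absolutely_integrable_subinterval_Icc[OF v, of "-1" r] r by (simp add: absolutely_integrable_on_def)
    then have "integral {-1..0} ?v + integral {0..r} ?v = integral {-1..r} ?v"
      using r0 by (intro Henstock_Kurzweil_Integration.integral_combine) auto
    ultimately show ?thesis using xk[of 0] vk[of 0] by (simp add: add.assoc[symmetric])
  qed
qed

text \<open>Because the derivative of a segment is a translate of one fixed function, continuity in
  \<open>t\<close> of these derivatives is continuity of translations in L1.\<close>

lemma segment_primitive:
  assumes g: "g \<in> LC_fun" and k: "primitive_of k \<phi>" and x: "isol g \<phi> T x" and t: "0 \<le> t" "t \<le> T"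
  shows "primitive_of (\<lambda>s. velocity g k x (s + t)) (\<lambda>s\<in>{-1..0}. x (t + s))"
proof -
  let ?v = "velocity g k x"
  have T: "0 \<le> T" using t by simp
  note v = velocity_integral[OF g k x T]
  have vi: "?v absolutely_integrable_on {c..d}" if "-1 \<le> c" "d \<le> T" for c d
    using that by (intro absolutely_integrable_subinterval_Icc[OF v(1)]) auto
  show ?thesis
    unfolding primitive_of_def
  proof (intro conjI ballI)
    show "(\<lambda>s. ?v (s + t)) absolutely_integrable_on {-1..0}"
      using t by (intro absolutely_integrable_translate vi) auto
    fix s :: real assume s: "s \<in> {-1..0}"
    have "integral {-1..s} (\<lambda>s. ?v (s + t)) = integral {t - 1..t + s} ?v"
      by (simp add: integral_translate_Icc add.commute)
    moreover have "integral {-1..t - 1} ?v + integral {t - 1..t + s} ?v = integral {-1..t + s} ?v"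
      using s t vi[of "-1" "t + s"] by (intro Henstock_Kurzweil_Integration.integral_combine) (auto simp: absolutely_integrable_on_def)
    ultimately show "(\<lambda>s\<in>{-1..0}. x (t + s)) s = (\<lambda>s\<in>{-1..0}. x (t + s)) (-1) + integral {-1..s} (\<lambda>s. ?v (s + t))"
      using v(2)[of "t + s"] v(2)[of "t - 1"] s t by (simp add: add.assoc[symmetric])
  qed
qed

lemma segment_C11:
  assumes "g \<in> LC_fun" "\<phi> \<in> C11" "isol g \<phi> T x" "0 \<le> t" "t \<le> T"
  shows "(\<lambda>s\<in>{-1..0}. x (t + s)) \<in> C11"
  using assms segment_primitive[OF assms(1) _ assms(3-5)] by (auto simp: C11_iff)

subsection \<open>Continuous dependence\<close>

text \<open>All that continuous dependence needs from the topology of the hull. The pair \<open>(y, v)\<close> stands for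
  a truncated solution and its delay; the bound on \<open>y t - y s\<close> is what the equation gives, and it
  puts \<open>y\<close> into the compact sets of curves that define the first topology.\<close>

definition mean_continuous_along_solutions :: "'n::finite LC topology \<Rightarrow> 'n LC set \<Rightarrow> bool" where
  "mean_continuous_along_solutions T H \<longleftrightarrow> (\<forall>G0\<in>H. \<forall>R::nat. \<forall>c\<ge>0. \<forall>e>0.
     \<exists>V. openin T V \<and> G0 \<in> V \<and> (\<forall>G\<in>V \<inter> H. \<forall>y v. continuous_on {0..c} y \<and> continuous_on {0..c} v \<and>
       (\<forall>t\<in>{0..c}. norm (y t) \<le> real R \<and> norm (v t) \<le> real R) \<and>
       (\<forall>s t. 0 \<le> s \<and> s \<le> t \<and> t \<le> c \<longrightarrow>
          norm (y t - y s) \<le> integral {s..t} (\<lambda>r. norm (rep_LC G r (y r, v r)))) \<longrightarrow>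
       integral {0..c} (\<lambda>r. norm (rep_LC G r (y r, v r) - rep_LC G0 r (y r, v r))) \<le> e))"

text \<open>The radius \<open>R\<close> and the neighbourhood \<open>V\<close> are chosen from
  \<open>G0\<close>, \<open>x0\<close> and \<open>e\<close> alone. The truncated solution for
  \<open>G\<close> exists up to \<open>c\<close> in any case; once it is known to be within 1 of
  \<open>x0\<close>, it is bounded by \<open>R\<close> and solves the original equation. So
  existence up to \<open>c\<close> is a conclusion, and this is what makes the domain of the flow
  open.\<close>

lemma continuous_dependence:
  assumes dep: "mean_continuous_along_solutions T H" and G0: "G0 \<in> H"
    and \<phi>0: "\<phi>0 \<in> C11" and c: "0 \<le> c" and x0: "isol (rep_LC G0) \<phi>0 c x0" and e: "e > 0"
  shows "\<exists>V \<eta>. openin T V \<and> G0 \<in> V \<and> \<eta> > 0 \<and> (\<forall>G\<in>V \<inter> H. \<forall>\<phi>\<in>C11. C11_norm (\<lambda>t. \<phi> t - \<phi>0 t) < \<eta> \<longrightarrow>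
    (\<exists>x. isol (rep_LC G) \<phi> c x \<and> (\<forall>t\<in>{-1..c}. norm (x t - x0 t) \<le> e) \<and>
      integral {0..c} (\<lambda>t. norm (rep_LC G t (x t, x (t - 1)) - rep_LC G0 t (x0 t, x0 (t - 1)))) \<le> e))"
proof -
  let ?h = "rep_LC G0"
  note g0 = rep_LC_LC_fun[of G0]
  obtain B where B: "B > 0" "\<And>t. t \<in> {-1..c} \<Longrightarrow> norm (x0 t) \<le> B"
    using isol_bounded[OF x0] by blast
  obtain R :: nat where RB: "B + 1 \<le> real R" using real_arch_simple by blast
  have R: "0 \<le> real R" by simp
  obtain l where l: "\<And>a b. l absolutely_integrable_on {a..b}" "\<And>t. 0 \<le> l t"
    and lip: "AE t in lebesgue. \<forall>z1 z2. norm (trunc R ?h t z1 - trunc R ?h t z2) \<le> l t * norm (z1 - z2)"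
    using trunc_global_bounds[OF g0 R] by blast
  define \<Lambda> where "\<Lambda> = integral {0..c} l"
  have \<Lambda>: "0 \<le> \<Lambda>" unfolding \<Lambda>_def
    using l by (intro integral_nonneg) (auto simp: absolutely_integrable_on_def)
  \<comment> \<open>The bound 1 matches the margin in \<open>B + 1 \<le> real R\<close>.\<close>
  define \<mu> where "\<mu> = min e 1"
  have \<mu>: "\<mu> > 0" "\<mu> \<le> e" "\<mu> \<le> 1" using e by (auto simp: \<mu>_def)
  \<comment> \<open>With initial and integral error both at most \<open>\<delta>\<close>, the
    comparison gives \<open>4 * \<delta> * exp (4 * \<Lambda>)\<close> for the values and
    \<open>8 * \<delta> * exp (4 * \<Lambda>) * \<Lambda> + \<delta>\<close> for the velocities;
    \<open>\<delta> * D\<close> dominates both.\<close>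
  define D where "D = 8 * exp (4 * \<Lambda>) * (\<Lambda> + 1) + 1"
  have D: "D > 0" using \<Lambda> by (simp add: D_def add_nonneg_pos)
  define \<delta> where "\<delta> = \<mu> / D"
  have \<delta>: "\<delta> > 0" "\<delta> * D = \<mu>" using \<mu> D by (simp_all add: \<delta>_def)
  have b1: "2 * (\<delta> + \<delta>) * exp (4 * \<Lambda>) \<le> \<mu>"
  proof -
    have "4 * exp (4 * \<Lambda>) \<le> D" using \<Lambda> by (simp add: D_def algebra_simps add_nonneg_nonneg)
    then have "\<delta> * (4 * exp (4 * \<Lambda>)) \<le> \<delta> * D" using \<delta>(1) by (intro mult_left_mono) auto
    moreover have "2 * (\<delta> + \<delta>) * exp (4 * \<Lambda>) = \<delta> * (4 * exp (4 * \<Lambda>))" by simp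
    ultimately show ?thesis using \<delta>(2) by simp
  qed
  have b2: "4 * (\<delta> + \<delta>) * exp (4 * \<Lambda>) * \<Lambda> + \<delta> \<le> \<mu>"
  proof -
    have "8 * exp (4 * \<Lambda>) * \<Lambda> + 1 \<le> D" by (simp add: D_def algebra_simps)
    then have "\<delta> * (8 * exp (4 * \<Lambda>) * \<Lambda> + 1) \<le> \<delta> * D" using \<delta>(1) by (intro mult_left_mono) auto
    moreover have "4 * (\<delta> + \<delta>) * exp (4 * \<Lambda>) * \<Lambda> + \<delta> = \<delta> * (8 * exp (4 * \<Lambda>) * \<Lambda> + 1)"
      by (simp add: algebra_simps)
    ultimately show ?thesis using \<delta>(2) by simp
  qed
  obtain V where V: "openin T V" "G0 \<in> V" and mean: "\<forall>G\<in>V \<inter> H. \<forall>y v. continuous_on {0..c} y \<and>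
       continuous_on {0..c} v \<and> (\<forall>t\<in>{0..c}. norm (y t) \<le> real R \<and> norm (v t) \<le> real R) \<and>
       (\<forall>s t. 0 \<le> s \<and> s \<le> t \<and> t \<le> c \<longrightarrow>
          norm (y t - y s) \<le> integral {s..t} (\<lambda>r. norm (rep_LC G r (y r, v r)))) \<longrightarrow>
       integral {0..c} (\<lambda>r. norm (rep_LC G r (y r, v r) - rep_LC G0 r (y r, v r))) \<le> \<delta>"
    using dep[unfolded mean_continuous_along_solutions_def, rule_format, OF G0 c \<delta>(1), of R]
    by (elim exE conjE)
  show ?thesis
  proof (intro exI[of _ V] exI[of _ \<delta>] conjI ballI impI V \<delta>(1))
    fix G \<phi> assume G: "G \<in> V \<inter> H" and \<phi>: "\<phi> \<in> C11" and \<phi>\<phi>0: "C11_norm (\<lambda>t. \<phi> t - \<phi>0 t) < \<delta>"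
    let ?g = "rep_LC G"
    note g = rep_LC_LC_fun[of G]
    note tg = trunc_LC_fun[OF g R]
    obtain y where cy: "continuous_on UNIV y" and y: "isol (trunc R ?g) \<phi> c y"
      using trunc_isol_exists[OF g R c C11_continuous[OF \<phi>]] by blast
    define Y where "Y t = clip (real R) (y t)" for t
    define v where "v t = clip (real R) (y (t - 1))" for t
    have tr: "trunc R h t (y t, y (t - 1)) = h t (Y t, v t)" for h t
      by (simp add: trunc_def Y_def v_def)
    have cY: "continuous_on S Y" for S
      unfolding Y_def by (rule continuous_on_compose2[OF continuous_clip[OF R, of UNIV] continuous_on_subset[OF cy]]) auto
    have cv: "continuous_on S v" for S
      unfolding v_def
      by (rule continuous_on_compose2[OF continuous_clip[OF R, of UNIV] continuous_on_compose2[OF cy]])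
        (auto intro!: continuous_intros)
    have YR: "norm (Y t) \<le> real R" "norm (v t) \<le> real R" for t
      by (simp_all add: Y_def v_def norm_clip)
    have gi: "(\<lambda>r. rep_LC K r (Y r, v r)) absolutely_integrable_on {s..t}" for K :: "'a LC" and s t
      by (intro LC_fun_curve_integrable[OF rep_LC_LC_fun] continuous_on_Pair cY cv)
    have mean': "integral {0..c} (\<lambda>r. norm (?g r (Y r, v r) - ?h r (Y r, v r))) \<le> \<delta>"
    \<comment> \<open>Clipping does not increase increments, and the derivative of \<open>y\<close>
      is the right-hand side along the clipped curves themselves; hence \<open>Y\<close> satisfies
      the increment condition with its own right-hand side.\<close>
    proof (rule mean[THEN bspec, OF G, THEN spec, THEN spec, THEN mp], intro conjI ballI allI impI cY cv YR)
      fix s t :: real assume "0 \<le> s \<and> s \<le> t \<and> t \<le> c"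
      then have st: "0 \<le> s" "s \<le> t" "t \<le> c" by auto
      have "y t - y s = integral {s..t} (\<lambda>r. ?g r (Y r, v r))"
      proof -
        have "y r = \<phi> 0 + integral {0..r} (\<lambda>r. ?g r (Y r, v r))" if "r \<in> {0..c}" for r
          using y that by (auto simp: isol_def tr)
        moreover have "integral {0..s} (\<lambda>r. ?g r (Y r, v r)) + integral {s..t} (\<lambda>r. ?g r (Y r, v r)) =
            integral {0..t} (\<lambda>r. ?g r (Y r, v r))"
          using st gi[of 0 t G] by (intro Henstock_Kurzweil_Integration.integral_combine) (auto simp: absolutely_integrable_on_def)
        ultimately show ?thesis using st by (simp add: algebra_simps)
      qed
      then have "norm (Y t - Y s) \<le> norm (integral {s..t} (\<lambda>r. ?g r (Y r, v r)))"
        unfolding Y_def using clip_lipschitz[OF R] by metis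
      also have "\<dots> \<le> integral {s..t} (\<lambda>r. norm (?g r (Y r, v r)))"
        by (intro norm_integral_le_integral_norm gi)
      finally show "norm (Y t - Y s) \<le> integral {s..t} (\<lambda>r. norm (?g r (Y r, v r)))" .
    qed
    have cx0: "continuous_on {-1..c} x0" and cy': "continuous_on {-1..c} y"
      using x0 y by (auto simp: isol_def)
    \<comment> \<open>The intermediate term is \<open>G0\<close> along the clipped curves of
      \<open>G\<close>: the Lipschitz bound of \<open>G0\<close> compares it with \<open>x0\<close>,
      and the difference of \<open>G\<close> and \<open>G0\<close> stays as the error.\<close>
    have AE: "AE t in lebesgue. t \<in> {0..c} \<longrightarrow>
      norm (trunc R ?g t (y t, y (t - 1)) - ?h t (x0 t, x0 (t - 1))) \<le>
      l t * (norm (y t - x0 t) + norm (y (t - 1) - x0 (t - 1))) + norm (?g t (Y t, v t) - ?h t (Y t, v t))"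
      using lip
    proof eventually_elim
      case (elim t)
      show ?case
      proof
        assume t: "t \<in> {0..c}"
        have "norm (x0 t) \<le> real R" "norm (x0 (t - 1)) \<le> real R"
          using B(2)[of t] B(2)[of "t - 1"] t RB by auto
        then have x0R: "trunc R ?h t (x0 t, x0 (t - 1)) = ?h t (x0 t, x0 (t - 1))"
          by (simp add: trunc_def clip_self)
        have "norm (trunc R ?h t (y t, y (t - 1)) - trunc R ?h t (x0 t, x0 (t - 1))) \<le>
            l t * norm ((y t, y (t - 1)) - (x0 t, x0 (t - 1)))"
          using elim by blast
        also have "\<dots> \<le> l t * (norm (y t - x0 t) + norm (y (t - 1) - x0 (t - 1)))"
          by (intro mult_left_mono norm_Pair_diff_le l)
        finally have "norm (?h t (Y t, v t) - ?h t (x0 t, x0 (t - 1))) \<le>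
            l t * (norm (y t - x0 t) + norm (y (t - 1) - x0 (t - 1)))"
          by (simp add: x0R tr)
        then show "norm (trunc R ?g t (y t, y (t - 1)) - ?h t (x0 t, x0 (t - 1))) \<le>
          l t * (norm (y t - x0 t) + norm (y (t - 1) - x0 (t - 1))) + norm (?g t (Y t, v t) - ?h t (Y t, v t))"
          using norm_triangle_ineq[of "?g t (Y t, v t) - ?h t (Y t, v t)" "?h t (Y t, v t) - ?h t (x0 t, x0 (t - 1))"]
          by (simp add: tr)
      qed
    qed
    have init: "norm (y t - x0 t) \<le> \<delta>" if "t \<in> {-1..0}" for t
    proof -
      obtain k k0 where "primitive_of k \<phi>" "primitive_of k0 \<phi>0" using \<phi> \<phi>0 by (auto simp: C11_iff)
      from C11_norm_diff_ge(1)[OF this that] have "norm (\<phi> t - \<phi>0 t) \<le> \<delta>" using \<phi>\<phi>0 by simp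
      then show ?thesis using x0 y that by (auto simp: isol_def)
    qed
    have xeq: "x0 t = x0 0 + integral {0..t} (\<lambda>s. ?h s (x0 s, x0 (s - 1)))"
      "y t = y 0 + integral {0..t} (\<lambda>s. trunc R ?g s (y s, y (s - 1)))" if "t \<in> {0..c}" for t
      using x0 y that by (auto simp: isol_def)
    have ei: "(\<lambda>r. norm (?g r (Y r, v r) - ?h r (Y r, v r))) absolutely_integrable_on {0..c}"
      using absolutely_integrable_norm[OF set_integral_diff(1)[OF gi gi]] by (simp add: o_def)
    note cmp = delay_comparison[OF c cx0 cy' xeq(1) isol_integrable[OF g0 cx0] xeq(2) isol_integrable[OF tg cy']
        l ei norm_ge_zero mean' init AE]
    have close: "norm (y t - x0 t) \<le> \<mu>" if "t \<in> {-1..c}" for t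
    proof -
      have "norm (y t - x0 t) \<le> 2 * (\<delta> + \<delta>) * exp (4 * integral {0..c} l)"
        by (rule cmp(1)) (use that in auto)
      then show ?thesis using b1 by (simp add: \<Lambda>_def)
    qed
    have yR: "norm (y t) \<le> real R" if "t \<in> {-1..c}" for t
      using close[OF that] B(2)[OF that] norm_triangle_sub[of "y t" "x0 t"] \<mu>(3) RB by linarith
    then have "isol ?g \<phi> c y" using y isol_trunc_iff[of c y R ?g \<phi>] by blast
    moreover have "\<forall>t\<in>{-1..c}. norm (y t - x0 t) \<le> e" using close \<mu>(2) by force
    moreover have "integral {0..c} (\<lambda>t. norm (?g t (y t, y (t - 1)) - ?h t (x0 t, x0 (t - 1)))) \<le> e"
    proof -
      have "integral {0..c} (\<lambda>t. norm (?g t (y t, y (t - 1)) - ?h t (x0 t, x0 (t - 1)))) =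
        integral {0..c} (\<lambda>t. norm (trunc R ?g t (y t, y (t - 1)) - ?h t (x0 t, x0 (t - 1))))"
        using yR by (intro integral_cong) (auto simp: trunc_def clip_self)
      also have "\<dots> \<le> \<mu>"
        by (rule order_trans[OF cmp(2)]) (use b2 in \<open>auto simp: \<Lambda>_def\<close>)
      finally show ?thesis using \<mu>(2) by simp
    qed
    ultimately show "\<exists>x. isol (rep_LC G) \<phi> c x \<and> (\<forall>t\<in>{-1..c}. norm (x t - x0 t) \<le> e) \<and>
      integral {0..c} (\<lambda>t. norm (rep_LC G t (x t, x (t - 1)) - rep_LC G0 t (x0 t, x0 (t - 1)))) \<le> e"
      by blast
  qed
qed

lemma sol_segment_continuous:
  assumes dep: "mean_continuous_along_solutions T H" and G0: "G0 \<in> H" and \<phi>0: "\<phi>0 \<in> C11"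
    and t0: "0 \<le> t0" "ereal t0 < sol_end G0 \<phi>0" and e: "e > 0"
  shows "\<exists>V \<eta> \<delta>. openin T V \<and> G0 \<in> V \<and> \<eta> > 0 \<and> \<delta> > 0 \<and>
    (\<forall>G\<in>V \<inter> H. \<forall>\<phi>\<in>C11. \<forall>t\<ge>0. C11_norm (\<lambda>t. \<phi> t - \<phi>0 t) < \<eta> \<and> \<bar>t - t0\<bar> < \<delta> \<longrightarrow>
      ereal t < sol_end G \<phi> \<and> C11_norm (\<lambda>s. sol_segment G \<phi> t s - sol_segment G0 \<phi>0 t0 s) < e)"
proof -
  let ?h = "rep_LC G0"
  note g0 = rep_LC_LC_fun[of G0]
  \<comment> \<open>A margin beyond \<open>t0\<close>, so that solutions on \<open>{-1..c}\<close>
    cover all times near \<open>t0\<close>.\<close>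
  obtain c where c: "t0 < c" "ereal c < sol_end G0 \<phi>0"
    using ereal_dense2[OF t0(2)] by auto
  have c0: "0 \<le> c" using c t0 by simp
  let ?z = "sol G0 \<phi>0"
  have x0: "isol ?h \<phi>0 c ?z" by (rule sol_isol[OF C11_continuous[OF \<phi>0] c0 c(2)])
  obtain k0 where k0: "primitive_of k0 \<phi>0" using \<phi>0 by (auto simp: C11_iff)
  let ?w = "velocity ?h k0 ?z"
  note v0 = velocity_integral(1)[OF g0 k0 x0 c0]
  \<comment> \<open>Five contributions of at most \<open>e / 6\<close>: for the values, change of
    the data and displacement in time; for the derivatives, the initial functions, the right-hand
    sides and displacement in time.\<close>
  have e6: "e / 6 > 0" using e by simp
  obtain V \<eta>0 where V: "openin T V" "G0 \<in> V" "\<eta>0 > 0" and dep':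
    "\<forall>G\<in>V \<inter> H. \<forall>\<phi>\<in>C11. C11_norm (\<lambda>t. \<phi> t - \<phi>0 t) < \<eta>0 \<longrightarrow>
    (\<exists>x. isol (rep_LC G) \<phi> c x \<and> (\<forall>t\<in>{-1..c}. norm (x t - ?z t) \<le> e / 6) \<and>
      integral {0..c} (\<lambda>t. norm (rep_LC G t (x t, x (t - 1)) - rep_LC G0 t (?z t, ?z (t - 1)))) \<le> e / 6)"
    using continuous_dependence[OF dep G0 \<phi>0 c0 x0 e6] by blast
  have "uniformly_continuous_on {-1..c} ?z"
    using isol_continuous[OF x0] by (intro compact_uniformly_continuous) auto
  then obtain d1 where d1: "d1 > 0" "\<And>r r'. r \<in> {-1..c} \<Longrightarrow> r' \<in> {-1..c} \<Longrightarrow> dist r' r < d1 \<Longrightarrow>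
      dist (?z r') (?z r) < e / 6"
    using e6 unfolding uniformly_continuous_on_def by meson
  \<comment> \<open>The velocity seen from \<open>t0\<close>, extended by zero because the
    translation theorem asks for integrability on an interval that may stick out of
    \<open>{-1..c}\<close>.\<close>
  define w where "w s = (if s + t0 \<in> {-1..c} then ?w (s + t0) else 0)" for s
  have "(\<lambda>r. if r \<in> {-1..c} then ?w r else 0) absolutely_integrable_on UNIV"
    using v0 by (simp only: absolutely_integrable_restrict_UNIV)
  then have "(\<lambda>r. if r \<in> {-1..c} then ?w r else 0) absolutely_integrable_on {a..b}" for a b
    by (rule set_integrable_subset) auto
  then have "w absolutely_integrable_on {-1 - 1..0 + 1}"
    unfolding w_def by (intro absolutely_integrable_translate)
  then obtain d2 where d2: "0 < d2" "\<And>t. \<bar>t\<bar> < d2 \<Longrightarrow> integral {-1..0} (\<lambda>s. norm (w (s + t) - w s)) < e / 6"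
    using translation_continuous_L1[OF _ e6] by blast
  define \<delta> where "\<delta> = min (c - t0) (min d1 d2)"
  have \<delta>: "\<delta> > 0" using c d1 d2 by (simp add: \<delta>_def)
  show ?thesis
  proof (rule exI[of _ V], rule exI[of _ "min \<eta>0 (e / 6)"], rule exI[of _ \<delta>], intro conjI ballI allI impI)
    fix G \<phi> t assume G: "G \<in> V \<inter> H" and \<phi>: "\<phi> \<in> C11" and t: "0 \<le> t"
      and *: "C11_norm (\<lambda>t. \<phi> t - \<phi>0 t) < min \<eta>0 (e / 6) \<and> \<bar>t - t0\<bar> < \<delta>"
    let ?g = "rep_LC G"
    note g = rep_LC_LC_fun[of G]
    have tc: "t < c" using * by (auto simp: \<delta>_def)
    have "C11_norm (\<lambda>t. \<phi> t - \<phi>0 t) < \<eta>0" using * by simp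
    from dep'[rule_format, OF G \<phi> this] obtain x where x: "isol ?g \<phi> c x" and close: "\<forall>t\<in>{-1..c}. norm (x t - ?z t) \<le> e / 6"
      and mean: "integral {0..c} (\<lambda>t. norm (?g t (x t, x (t - 1)) - ?h t (?z t, ?z (t - 1)))) \<le> e / 6"
      by blast
    have end_c: "ereal c < sol_end G \<phi>"
      using less_sol_end_iff[OF C11_continuous[OF \<phi>] c0] x by blast
    have solx: "sol G \<phi> t = x t" if "t \<in> {-1..c}" for t
      by (rule isol_unique[OF g x sol_isol[OF C11_continuous[OF \<phi>] c0 end_c] that])
    show "ereal t < sol_end G \<phi>" using tc end_c by (intro ereal_le_less_trans[OF _ end_c]) simp
    obtain k where k: "primitive_of k \<phi>" using \<phi> by (auto simp: C11_iff)
    let ?v = "velocity ?g k x"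
    note v = velocity_integral(1)[OF g k x c0]
    have seg: "sol_segment G \<phi> t = (\<lambda>s\<in>{-1..0}. x (t + s))"
      unfolding sol_segment_def using t tc by (intro restrict_ext solx) auto
    have p: "primitive_of (\<lambda>s. ?v (s + t)) (sol_segment G \<phi> t)"
      unfolding seg using tc by (intro segment_primitive[OF g k x t]) auto
    have p0: "primitive_of (\<lambda>s. ?w (s + t0)) (sol_segment G0 \<phi>0 t0)"
      unfolding sol_segment_def using c by (intro segment_primitive[OF g0 k0 x0 t0(1)]) auto
    have "C11_norm (\<lambda>s. sol_segment G \<phi> t s - sol_segment G0 \<phi>0 t0 s) \<le> (e / 6 + e / 6) + (e / 6 + e / 6 + e / 6)"
    proof (rule C11_norm_diff_le[OF p p0])
      fix s :: real assume s: "s \<in> {-1..0}"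
      have "dist (?z (t + s)) (?z (t0 + s)) < e / 6"
        using s t t0 tc c * by (intro d1(2)) (auto simp: dist_real_def \<delta>_def)
      moreover have "norm (x (t + s) - ?z (t + s)) \<le> e / 6"
        using close s t tc by auto
      moreover have "norm (x (t + s) - ?z (t0 + s)) \<le> norm (x (t + s) - ?z (t + s)) + norm (?z (t + s) - ?z (t0 + s))"
        using norm_triangle_ineq[of "x (t + s) - ?z (t + s)" "?z (t + s) - ?z (t0 + s)"] by simp
      ultimately show "norm (sol_segment G \<phi> t s - sol_segment G0 \<phi>0 t0 s) \<le> e / 6 + e / 6"
        using s by (simp add: seg) (simp add: sol_segment_def dist_norm)
    next
      have vi: "(\<lambda>s. ?v (s + t)) absolutely_integrable_on {-1..0}"
        "(\<lambda>s. ?w (s + t)) absolutely_integrable_on {-1..0}"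
        "(\<lambda>s. ?w (s + t0)) absolutely_integrable_on {-1..0}"
        using t tc t0 c by (auto intro!: absolutely_integrable_translate absolutely_integrable_subinterval_Icc[OF v]
            absolutely_integrable_subinterval_Icc[OF v0])
      have dv: "(\<lambda>s. norm (?v s - ?w s)) integrable_on {-1..c}"
        by (intro abs_integrable_norm_Icc set_integral_diff v v0)
      have "integral {-1..0} (\<lambda>s. norm (?v (s + t) - ?w (s + t))) = integral {-1 + t..0 + t} (\<lambda>s. norm (?v s - ?w s))"
        by (rule integral_translate_Icc)
      also have "\<dots> \<le> integral {-1..c} (\<lambda>s. norm (?v s - ?w s))"
        using t tc by (intro integral_subset_Icc_nonneg dv) auto
      also have "\<dots> = integral {-1..0} (\<lambda>s. norm (?v s - ?w s)) + integral {0..c} (\<lambda>s. norm (?v s - ?w s))"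
        using c0 by (intro Henstock_Kurzweil_Integration.integral_combine[symmetric] dv) auto
      also have "integral {-1..0} (\<lambda>s. norm (?v s - ?w s)) = integral {-1..0} (\<lambda>s. norm (k s - k0 s))"
        by (intro integral_cong) (auto simp: velocity_def)
      also have "\<dots> \<le> C11_norm (\<lambda>t. \<phi> t - \<phi>0 t)"
        by (rule C11_norm_diff_ge(2)[OF k k0])
      also have "integral {0..c} (\<lambda>s. norm (?v s - ?w s)) =
          integral {0..c} (\<lambda>t. norm (?g t (x t, x (t - 1)) - ?h t (?z t, ?z (t - 1))))"
        by (rule integral_spike[OF negligible_sing[of 0]]) (auto simp: velocity_def)
      finally have 1: "integral {-1..0} (\<lambda>s. norm (?v (s + t) - ?w (s + t))) \<le> e / 6 + e / 6"
        using mean * by simp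
      have "integral {-1..0} (\<lambda>s. norm (?w (s + t) - ?w (s + t0))) =
          integral {-1..0} (\<lambda>s. norm (w (s + (t - t0)) - w s))"
        using t tc t0 c by (intro integral_cong) (auto simp: w_def)
      also have "\<dots> < e / 6" using * by (intro d2(2)) (auto simp: \<delta>_def)
      finally have 2: "integral {-1..0} (\<lambda>s. norm (?w (s + t) - ?w (s + t0))) \<le> e / 6" by simp
      show "integral {-1..0} (\<lambda>s. norm (?v (s + t) - ?w (s + t0))) \<le> e / 6 + e / 6 + e / 6"
        using integral_norm_triangle[OF vi] 1 2 by linarith
    qed
    also have "\<dots> < e" using e by simp
    finally show "C11_norm (\<lambda>s. sol_segment G \<phi> t s - sol_segment G0 \<phi>0 t0 s) < e" .
  qed (use V \<delta> e in auto)
qed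

section \<open>From continuous dependence to the semiflow\<close>

lemma continuous_map_into_C11:
  assumes "f ` topspace X \<subseteq> C11"
    and "\<And>x e. x \<in> C11 \<Longrightarrow> e > 0 \<Longrightarrow> openin X (f -` {y \<in> C11. C11_norm (\<lambda>t. y t - x t) < e} \<inter> topspace X)"
  shows "continuous_map X C11_topology f"
  unfolding C11_topology_def
proof (rule continuous_on_generated_topo)
  show "f ` topspace X \<subseteq> \<Union> {{y \<in> C11. C11_norm (\<lambda>t. y t - x t) < e} | x e. x \<in> C11 \<and> e > 0}"
    using assms(1) unfolding topspace_C11_topology[unfolded C11_topology_def topology_generated_by_topspace] .
qed (use assms(2) in blast)

text \<open>The topology enters only through the assumptions: \<open>tr\<close> gives continuity of
  the first component, \<open>dep\<close> that of the second and openness of the domain. The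
  semigroup law is concatenation plus uniqueness.\<close>

lemma flow_skew_product_semiflow:
  fixes T :: "'n::finite LC topology" and F :: "'n LC"
  defines "H \<equiv> Hull T F"
  assumes HT: "H \<subseteq> topspace T"
    and tr: "continuous_map (prod_topology (top_of_set {0..}) T) T (\<lambda>(t, G). translate_LC t G)"
    and inv: "\<And>t G. 0 \<le> t \<Longrightarrow> G \<in> H \<Longrightarrow> translate_LC t G \<in> H"
    and dep: "mean_continuous_along_solutions T H"
  shows "continuous_skew_product_semiflow (subtopology T H) C11_topology (flow_domain T F) flow_map"
proof -
  let ?Y = "subtopology T H"
  let ?P = "prod_topology (top_of_set {0::real..}) (prod_topology ?Y (C11_topology :: (real \<Rightarrow> real^'n) topology))"
  let ?U = "flow_domain T F"
  have U: "(t, G, \<phi>) \<in> ?U \<longleftrightarrow> G \<in> H \<and> \<phi> \<in> C11 \<and> 0 \<le> t \<and> ereal t < sol_end G \<phi>" for t G \<phi>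
    by (simp add: flow_domain_def H_def)
  have tY: "topspace ?Y = H" using HT by auto
  define N where "N V t0 \<delta> \<phi>0 \<eta> = ({0..} \<inter> ball t0 \<delta>) \<times> ((V \<inter> H) \<times> {\<phi> \<in> C11. C11_norm (\<lambda>t. \<phi> t - \<phi>0 t) < \<eta>})"
    for V :: "'n LC set" and t0 \<delta> :: real and \<phi>0 :: "real \<Rightarrow> real^'n" and \<eta> :: real
  have oN: "openin ?P (N V t0 \<delta> \<phi>0 \<eta>)" if "openin T V" "\<phi>0 \<in> C11" "\<eta> > 0" for V t0 \<delta> \<phi>0 \<eta>
  proof -
    have "openin ?Y (V \<inter> H)"
      using that(1) by (auto simp: openin_subtopology)
    moreover have "openin (top_of_set {0..}) ({0..} \<inter> ball t0 \<delta>)"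
      by (simp add: openin_open_Int)
    ultimately show ?thesis
      unfolding N_def by (simp add: openin_prod_Times_iff openin_C11_ball that)
  qed
  have N0: "(t0, G0, \<phi>0) \<in> N V t0 \<delta> \<phi>0 \<eta>" if "t0 \<ge> 0" "G0 \<in> V" "G0 \<in> H" "\<phi>0 \<in> C11" "\<eta> > 0" "\<delta> > 0"
    for V t0 \<delta> G0 \<phi>0 \<eta>
    using that by (simp add: N_def C11_norm_zero)
  \<comment> \<open>One neighbourhood serves twice: its inclusion in \<open>?U\<close> gives
    openness of the domain, the estimate on it continuity of the second component.\<close>
  have near: "\<exists>S. openin ?P S \<and> (t0, G0, \<phi>0) \<in> S \<and> S \<subseteq> ?U \<and>
      (\<forall>t G \<phi>. (t, G, \<phi>) \<in> S \<longrightarrow> C11_norm (\<lambda>s. sol_segment G \<phi> t s - sol_segment G0 \<phi>0 t0 s) < e)"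
    if p: "(t0, G0, \<phi>0) \<in> ?U" and e: "e > 0" for t0 G0 \<phi>0 e
  proof -
    have p': "G0 \<in> H" "\<phi>0 \<in> C11" "0 \<le> t0" "ereal t0 < sol_end G0 \<phi>0" using p by (auto simp: U)
    obtain V \<eta> \<delta> where V: "openin T V" "G0 \<in> V" "\<eta> > 0" "\<delta> > 0" and
      *: "\<forall>G\<in>V \<inter> H. \<forall>\<phi>\<in>C11. \<forall>t\<ge>0. C11_norm (\<lambda>t. \<phi> t - \<phi>0 t) < \<eta> \<and> \<bar>t - t0\<bar> < \<delta> \<longrightarrow>
        ereal t < sol_end G \<phi> \<and> C11_norm (\<lambda>s. sol_segment G \<phi> t s - sol_segment G0 \<phi>0 t0 s) < e"
      using sol_segment_continuous[OF dep p'(1,2,3,4) e] by (elim exE conjE)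
    have **: "ereal t < sol_end G \<phi> \<and> C11_norm (\<lambda>s. sol_segment G \<phi> t s - sol_segment G0 \<phi>0 t0 s) < e"
      if "(t, G, \<phi>) \<in> N V t0 \<delta> \<phi>0 \<eta>" for t G \<phi>
      using that by (intro *[rule_format]) (auto simp: N_def dist_real_def)
    show ?thesis
    proof (intro exI[of _ "N V t0 \<delta> \<phi>0 \<eta>"] conjI allI impI)
      show "openin ?P (N V t0 \<delta> \<phi>0 \<eta>)" by (rule oN[OF V(1) p'(2) V(3)])
      show "(t0, G0, \<phi>0) \<in> N V t0 \<delta> \<phi>0 \<eta>" by (rule N0[OF p'(3) V(2) p'(1,2) V(3,4)])
      show "C11_norm (\<lambda>s. sol_segment G \<phi> t s - sol_segment G0 \<phi>0 t0 s) < e"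
        if "(t, G, \<phi>) \<in> N V t0 \<delta> \<phi>0 \<eta>" for t G \<phi>
        using **[OF that] by simp
      show "N V t0 \<delta> \<phi>0 \<eta> \<subseteq> ?U"
      proof (clarify)
        fix t G \<phi> assume "(t, G, \<phi>) \<in> N V t0 \<delta> \<phi>0 \<eta>"
        then show "(t, G, \<phi>) \<in> ?U" using ** by (auto simp: U N_def)
      qed
    qed
  qed
  have oU: "openin ?P ?U"
    unfolding openin_subopen[of ?P ?U]
  proof
    fix p assume p: "p \<in> ?U"
    obtain t G \<phi> where "p = (t, G, \<phi>)" by (cases p) auto
    with near[of t G \<phi> 1] p show "\<exists>S. openin ?P S \<and> p \<in> S \<and> S \<subseteq> ?U" by auto
  qed
  have pos: "0 < sol_end G \<phi>" if "\<phi> \<in> C11" for G \<phi>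
    using less_sol_end_iff[OF C11_continuous[OF that], of 0 G] isol_initial[OF C11_continuous[OF that], of "rep_LC G"]
    by (auto simp: zero_ereal_def)
  have seg_C11: "sol_segment G \<phi> t \<in> C11" if "(t, G, \<phi>) \<in> ?U" for t G \<phi>
    unfolding sol_segment_def
    by (rule segment_C11[OF rep_LC_LC_fun _ sol_isol[OF C11_continuous]]) (use that in \<open>auto simp: U\<close>)
  have contU: "continuous_map (subtopology ?P ?U) (prod_topology ?Y C11_topology) flow_map"
    unfolding continuous_map_pairwise
  proof
    have c1: "continuous_map ?P (prod_topology (top_of_set {0..}) T) (\<lambda>p. (fst p, fst (snd p)))"
      unfolding continuous_map_pairwise o_def fst_conv snd_conv
    proof
      show "continuous_map ?P (top_of_set {0..}) (\<lambda>p. fst p)"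
        by (rule continuous_map_fst)
      have "continuous_map ?P ?Y (fst \<circ> snd)"
        by (rule continuous_map_compose[OF continuous_map_snd continuous_map_fst])
      then show "continuous_map ?P T (\<lambda>p. fst (snd p))"
        by (simp add: continuous_map_in_subtopology o_def)
    qed
    have "continuous_map ?P T ((\<lambda>(t, G). translate_LC t G) \<circ> (\<lambda>p. (fst p, fst (snd p))))"
      by (rule continuous_map_compose[OF c1 tr])
    moreover have "(\<lambda>(t, G). translate_LC t G) \<circ> (\<lambda>p. (fst p, fst (snd p))) =
        fst \<circ> (flow_map :: real \<times> 'n LC \<times> (real \<Rightarrow> real^'n) \<Rightarrow> _)"
      by (auto simp: flow_map_def fun_eq_iff)
    ultimately have "continuous_map (subtopology ?P ?U) T (fst \<circ> flow_map)"
      by (simp only: continuous_map_from_subtopology)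
    then show "continuous_map (subtopology ?P ?U) ?Y (fst \<circ> flow_map)"
      unfolding continuous_map_in_subtopology using inv
      by (auto simp: flow_map_def U)
    show "continuous_map (subtopology ?P ?U) C11_topology (snd \<circ> flow_map)"
    proof (rule continuous_map_into_C11)
      show "(snd \<circ> flow_map) ` topspace (subtopology ?P ?U) \<subseteq> C11"
        using seg_C11 by (auto simp: flow_map_def)
      fix x :: "real \<Rightarrow> real^'n" and r :: real
      assume x: "x \<in> C11" "r > 0"
      let ?B = "{y \<in> C11. C11_norm (\<lambda>t. y t - x t) < r}"
      let ?A = "(snd \<circ> flow_map) -` ?B \<inter> topspace (subtopology ?P ?U)"
      show "openin (subtopology ?P ?U) ?A"
        unfolding openin_subopen[of _ ?A]
      proof
        fix p assume pA: "p \<in> ?A"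
        obtain t0 G0 \<phi>0 where p: "p = (t0, G0, \<phi>0)" by (cases p) auto
        have pU: "(t0, G0, \<phi>0) \<in> ?U" using pA p by auto
        \<comment> \<open>The generating balls have arbitrary centres; \<open>d\<close> is the room
          left around the value at \<open>p\<close> inside the ball about \<open>x\<close>.\<close>
        define d where "d = r - C11_norm (\<lambda>s. sol_segment G0 \<phi>0 t0 s - x s)"
        have d: "d > 0" using pA p by (simp add: d_def flow_map_def)
        obtain S where S: "openin ?P S" "(t0, G0, \<phi>0) \<in> S" "S \<subseteq> ?U" and
          *: "\<forall>t G \<phi>. (t, G, \<phi>) \<in> S \<longrightarrow> C11_norm (\<lambda>s. sol_segment G \<phi> t s - sol_segment G0 \<phi>0 t0 s) < d"
          using near[OF pU d] by (elim exE conjE)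
        show "\<exists>S. openin (subtopology ?P ?U) S \<and> p \<in> S \<and> S \<subseteq> ?A"
        proof (intro exI[of _ S] conjI)
          show "openin (subtopology ?P ?U) S"
            using S by (auto simp: openin_subtopology)
          show "p \<in> S" using S p by simp
          show "S \<subseteq> ?A"
          proof
            fix q assume q: "q \<in> S"
            obtain t G \<phi> where qq: "q = (t, G, \<phi>)" by (cases q) auto
            have qU: "(t, G, \<phi>) \<in> ?U" using q qq S by auto
            have "C11_norm (\<lambda>s. sol_segment G \<phi> t s - x s) \<le>
              C11_norm (\<lambda>s. sol_segment G \<phi> t s - sol_segment G0 \<phi>0 t0 s) + C11_norm (\<lambda>s. sol_segment G0 \<phi>0 t0 s - x s)"
              by (intro C11_norm_triangle seg_C11 qU pU x)
            also have "\<dots> < r" using *[rule_format, of t G \<phi>] q qq by (simp add: d_def)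
            finally show "q \<in> ?A"
              using q qq S(1) openin_subset[OF S(1)] seg_C11[OF qU] qU by (auto simp: flow_map_def)
          qed
        qed
      qed
    qed
  qed
  have flow0: "flow_map (0, G, \<phi>) = (G, \<phi>)" if \<phi>: "\<phi> \<in> C11" for G \<phi>
  proof -
    have "isol (rep_LC G) \<phi> 0 (sol G \<phi>)"
      using pos[OF \<phi>, of G] by (intro sol_isol[OF C11_continuous[OF \<phi>]]) (auto simp: zero_ereal_def)
    then have "sol_segment G \<phi> 0 = restrict \<phi> {-1..0}"
      unfolding sol_segment_def by (intro restrict_ext) (auto simp: isol_def)
    also have "\<dots> = \<phi>"
      using \<phi> by (intro extensional_restrict) (simp add: C11_def)
    finally show ?thesis by (simp add: flow_map_def translate_LC_0)
  qed
  have group: "(t + s, G, \<phi>) \<in> ?U \<and> flow_map (t + s, G, \<phi>) = flow_map (t, flow_map (s, G, \<phi>))"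
    if s: "(s, G, \<phi>) \<in> ?U" and t: "(t, flow_map (s, G, \<phi>)) \<in> ?U" for t s G \<phi>
  proof -
    let ?g = "rep_LC G" and ?G' = "translate_LC s G" and ?\<psi> = "sol_segment G \<phi> s"
    note g = rep_LC_LC_fun[of G]
    have s': "G \<in> H" "\<phi> \<in> C11" "0 \<le> s" "ereal s < sol_end G \<phi>" using s by (auto simp: U)
    have t': "?\<psi> \<in> C11" "0 \<le> t" "ereal t < sol_end ?G' ?\<psi>" using t by (auto simp: U flow_map_def)
    note \<phi>c = C11_continuous[OF s'(2)]
    have x: "isol ?g \<phi> s (sol G \<phi>)" by (rule sol_isol[OF \<phi>c s'(3,4)])
    have y: "isol (rep_LC ?G') ?\<psi> t (sol ?G' ?\<psi>)" by (rule sol_isol[OF C11_continuous[OF t'(1)] t'(2,3)])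
    \<comment> \<open>The representative of the translate agrees with the translate of the
      representative only almost everywhere, which the integral equation does not notice.\<close>
    have y': "isol (time_shift s ?g) ?\<psi> t (sol ?G' ?\<psi>)"
      by (rule isol_cong_AE[OF y]) (use rep_translate_LC_AE[of s G] in \<open>auto elim!: eventually_mono simp: time_shift_def\<close>)
    let ?z = "\<lambda>r. if r \<le> s then sol G \<phi> r else sol ?G' ?\<psi> (r - s)"
    have z: "isol ?g \<phi> (s + t) ?z"
      by (rule isol_concat[OF g s'(3) t'(2) x _ y']) (simp add: sol_segment_def)
    have st: "0 \<le> s + t" using s' t' by simp
    then have end_st: "ereal (s + t) < sol_end G \<phi>"
      using less_sol_end_iff[OF \<phi>c st] z by blast
    have eq: "sol G \<phi> r = ?z r" if "r \<in> {-1..s + t}" for r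
      by (rule isol_unique[OF g z sol_isol[OF \<phi>c st end_st] that])
    have "sol_segment G \<phi> (t + s) = sol_segment ?G' ?\<psi> t"
      unfolding sol_segment_def[of G \<phi> "t + s"] sol_segment_def[of ?G' ?\<psi> t]
    proof (rule restrict_ext)
      fix r :: real assume r: "r \<in> {-1..0}"
      show "sol G \<phi> (t + s + r) = sol ?G' ?\<psi> (t + r)"
      proof (cases "t + r \<le> 0")
        case True
        then have "sol ?G' ?\<psi> (t + r) = ?\<psi> (t + r)" using y r t' by (auto simp: isol_def)
        also have "\<dots> = sol G \<phi> (t + s + r)" using True r t' by (simp add: sol_segment_def algebra_simps)
        finally show ?thesis by simp
      next
        case False
        then show ?thesis using eq[of "t + s + r"] r s' t' by (simp add: algebra_simps)
      qed
    qed
    then show ?thesis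
      using s' t' end_st by (simp add: U flow_map_def translate_LC_add add.commute)
  qed
  have "continuous_semiflow (prod_topology ?Y C11_topology) ?U flow_map"
    unfolding continuous_semiflow_def
  proof (intro conjI)
    show "openin ?P ?U" by (rule oU)
    show "{0} \<times> topspace (prod_topology ?Y C11_topology) \<subseteq> ?U"
      using pos tY by (auto simp: U topspace_C11_topology zero_ereal_def)
    show "continuous_map (subtopology ?P ?U) (prod_topology ?Y C11_topology) flow_map" by (rule contU)
    show "\<forall>x\<in>topspace (prod_topology ?Y C11_topology). flow_map (0, x) = x"
      using flow0 by (auto simp: topspace_C11_topology)
    show "\<forall>t s x. (s, x) \<in> ?U \<and> (t, flow_map (s, x)) \<in> ?U \<longrightarrow>
        (t + s, x) \<in> ?U \<and> flow_map (t + s, x) = flow_map (t, flow_map (s, x))"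
      using group by (metis prod.collapse)
  qed
  then show ?thesis
    unfolding continuous_skew_product_semiflow_def by (simp add: flow_map_def)
qed

subsection \<open>Topologies of mean convergence along curves\<close>

text \<open>Near the sphere the close points of \<open>D\<close> may lie outside
  \<open>cball 0 r\<close>, hence the net is taken in the ball of radius
  \<open>r + 1\<close>.\<close>

lemma finite_cball_net:
  fixes D :: "'a::euclidean_space set"
  assumes D: "closure D = UNIV" and \<eta>: "\<eta> > 0"
  shows "\<exists>F. finite F \<and> F \<subseteq> D \<inter> ball 0 (r + 1) \<and> (\<forall>w\<in>cball 0 r. \<exists>z\<in>F. norm (w - z) \<le> \<eta>)"
proof -
  have cover: "cball 0 r \<subseteq> (\<Union>z\<in>D \<inter> ball 0 (r + 1). ball z \<eta>)"
  proof
    fix w :: 'a assume w: "w \<in> cball 0 r"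
    have "w \<in> closure D" using D by simp
    then obtain z where z: "z \<in> D" "dist z w < min \<eta> 1"
      using \<eta> unfolding closure_approachable by (metis min_less_iff_conj zero_less_one)
    then have "norm z < r + 1"
      using w norm_triangle_sub[of z w] by (simp add: dist_norm)
    then show "w \<in> (\<Union>z\<in>D \<inter> ball 0 (r + 1). ball z \<eta>)" using z by auto
  qed
  obtain F where "F \<subseteq> D \<inter> ball 0 (r + 1)" "finite F" "cball 0 r \<subseteq> (\<Union>z\<in>F. ball z \<eta>)"
    by (rule compactE_image[where S = "cball 0 r" and C = "D \<inter> ball 0 (r + 1)" and f = "\<lambda>z. ball z \<eta>"])
      (use cover in auto)
  then show ?thesis
    by (intro exI[of _ F] conjI ballI) (auto simp: subset_iff dist_norm norm_minus_commute dest!: spec intro: less_imp_le)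
qed

text \<open>The Lipschitz function \<open>l\<close> may vary with \<open>g\<close>; only its
  integral is bounded. In this form the Lipschitz bounds of \<open>f\<close> are shared by all
  members of the hull.\<close>

definition mean_lipschitz :: "real \<Rightarrow> real \<Rightarrow> 'b::real_normed_vector set \<Rightarrow> real \<Rightarrow>
    (real \<Rightarrow> 'b \<Rightarrow> 'a::real_normed_vector) \<Rightarrow> bool" where
  "mean_lipschitz a b S M g \<longleftrightarrow> (\<exists>l. l absolutely_integrable_on {a..b} \<and> (\<forall>s. 0 \<le> l s) \<and> integral {a..b} l \<le> M \<and>
     (AE s in lebesgue. s \<in> {a..b} \<longrightarrow> (\<forall>u\<in>S. \<forall>v\<in>S. norm (g s u - g s v) \<le> l s * norm (u - v))))"

text \<open>The point is that \<open>F\<close> and \<open>\<epsilon>\<close> depend on \<open>g\<close>, \<open>h\<close> and \<open>x\<close> only through \<open>M\<close> and \<open>r\<close>.\<close>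

lemma finite_test_points:
  fixes D :: "'b::euclidean_space set"
  assumes D: "closure D = UNIV" and M: "0 \<le> M" and e: "0 < e"
  shows "\<exists>F \<epsilon>. finite F \<and> F \<subseteq> D \<inter> ball 0 (r + 1) \<and> 0 < \<epsilon> \<and>
    (\<forall>(g :: real \<Rightarrow> 'b \<Rightarrow> 'a::euclidean_space) h x. (\<forall>s\<in>{a..b}. x s \<in> cball 0 r) \<and>
       mean_lipschitz a b (ball 0 (r + 1)) M g \<and> mean_lipschitz a b (ball 0 (r + 1)) M h \<and>
       (\<forall>u. (\<lambda>s. g s u - h s u) absolutely_integrable_on {a..b}) \<and>
       (\<lambda>s. g s (x s) - h s (x s)) absolutely_integrable_on {a..b} \<and>
       (\<forall>u\<in>F. integral {a..b} (\<lambda>s. norm (g s u - h s u)) \<le> \<epsilon>) \<longrightarrow>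
       integral {a..b} (\<lambda>s. norm (g s (x s) - h s (x s))) \<le> e)"
proof -
  \<comment> \<open>Moving from a point of the curve to the net costs at most \<open>\<eta>\<close>
    times the integrals of both Lipschitz functions, that is \<open>\<eta> * (2 * M)\<close>, at
    most half of \<open>e\<close>. The \<open>+ 1\<close> covers \<open>M = 0\<close>.\<close>
  define \<eta> where "\<eta> = e / (2 * (2 * M + 1))"
  have \<eta>: "\<eta> > 0" "\<eta> * (2 * M) \<le> e / 2"
    using e M by (auto simp: \<eta>_def field_simps)
  obtain F where "finite F \<and> F \<subseteq> D \<inter> ball 0 (r + 1) \<and> (\<forall>w\<in>cball 0 r. \<exists>z\<in>F. norm (w - z) \<le> \<eta>)"
    using finite_cball_net[OF D \<eta>(1)] by (rule exE)
  then have F: "finite F" "F \<subseteq> D \<inter> ball 0 (r + 1)" "\<forall>w\<in>cball 0 r. \<exists>z\<in>F. norm (w - z) \<le> \<eta>"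
    by simp_all
  \<comment> \<open>The other half of \<open>e\<close> is shared among the points of
    \<open>F\<close>.\<close>
  define \<epsilon> where "\<epsilon> = e / (2 * (real (card F) + 1))"
  have \<epsilon>: "\<epsilon> > 0" "real (card F) * \<epsilon> \<le> e / 2" using e by (auto simp: \<epsilon>_def field_simps)
  show ?thesis
  proof (rule exI[of _ F], rule exI[of _ \<epsilon>], intro conjI allI impI F(1,2) \<epsilon>(1))
    fix g h :: "real \<Rightarrow> 'b \<Rightarrow> 'a" and x
    let ?f = "\<lambda>s u. g s u - h s u"
    assume *: "(\<forall>s\<in>{a..b}. x s \<in> cball 0 r) \<and>
       mean_lipschitz a b (ball 0 (r + 1)) M g \<and> mean_lipschitz a b (ball 0 (r + 1)) M h \<and>
       (\<forall>u. (\<lambda>s. ?f s u) absolutely_integrable_on {a..b}) \<and>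
       (\<lambda>s. ?f s (x s)) absolutely_integrable_on {a..b} \<and>
       (\<forall>u\<in>F. integral {a..b} (\<lambda>s. norm (?f s u)) \<le> \<epsilon>)"
    have x: "\<And>s. s \<in> {a..b} \<Longrightarrow> x s \<in> cball 0 r" using * by blast
    obtain l where l: "l absolutely_integrable_on {a..b}" "\<forall>s. 0 \<le> l s" "integral {a..b} l \<le> M"
      "AE s in lebesgue. s \<in> {a..b} \<longrightarrow> (\<forall>u\<in>ball 0 (r + 1). \<forall>v\<in>ball 0 (r + 1). norm (g s u - g s v) \<le> l s * norm (u - v))"
      using * unfolding mean_lipschitz_def by blast
    obtain k where k: "k absolutely_integrable_on {a..b}" "\<forall>s. 0 \<le> k s" "integral {a..b} k \<le> M"
      "AE s in lebesgue. s \<in> {a..b} \<longrightarrow> (\<forall>u\<in>ball 0 (r + 1). \<forall>v\<in>ball 0 (r + 1). norm (h s u - h s v) \<le> k s * norm (u - v))"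
      using * unfolding mean_lipschitz_def by blast
    let ?l = "\<lambda>s. l s + k s"
    have "?l absolutely_integrable_on {a..b}" by (intro set_integral_add l k)
    then have li: "(\<lambda>s. \<eta> * ?l s) integrable_on {a..b}"
      unfolding absolutely_integrable_on_def by (intro integrable_on_mult_right) blast
    have fi: "(\<lambda>s. norm (?f s u)) integrable_on {a..b}" for u
      using * by (intro abs_integrable_norm_Icc) blast
    have Fi: "(\<lambda>s. \<Sum>u\<in>F. norm (?f s u)) integrable_on {a..b}"
      by (intro integrable_sum F fi)
    \<comment> \<open>The nearest net point changes with \<open>s\<close>. Summing over all of
      \<open>F\<close> avoids a measurable selection and loses only a factor \<open>card F\<close>,
      which \<open>\<epsilon>\<close> absorbs.\<close>
    have "integral {a..b} (\<lambda>s. norm (?f s (x s))) \<le> integral {a..b} (\<lambda>s. (\<Sum>u\<in>F. norm (?f s u)) + \<eta> * ?l s)"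
    proof (intro integral_mono_AE_Icc integrable_add Fi li)
      show "(\<lambda>s. norm (?f s (x s))) integrable_on {a..b}" using * by (intro abs_integrable_norm_Icc) blast
      show "AE s in lebesgue. s \<in> {a..b} \<longrightarrow> norm (?f s (x s)) \<le> (\<Sum>u\<in>F. norm (?f s u)) + \<eta> * ?l s"
        using l(4) k(4)
      proof eventually_elim
        case (elim s)
        show ?case
        proof
          assume s: "s \<in> {a..b}"
          then obtain u where u: "u \<in> F" "norm (x s - u) \<le> \<eta>" using F(3) x by blast
          have B: "u \<in> ball 0 (r + 1)" "x s \<in> ball 0 (r + 1)" using u(1) F(2) x[OF s] by auto
          have "norm (?f s (x s)) \<le> norm (?f s u) + norm (?f s (x s) - ?f s u)"
            by (rule norm_triangle_sub)
          also have "norm (?f s u) \<le> (\<Sum>u\<in>F. norm (?f s u))"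
            using F(1) u(1) by (intro member_le_sum) auto
          also have "norm (?f s (x s) - ?f s u) \<le> norm (g s (x s) - g s u) + norm (h s (x s) - h s u)"
            using norm_triangle_ineq4[of "g s (x s) - g s u" "h s (x s) - h s u"] by (simp add: algebra_simps)
          also have "\<dots> \<le> l s * norm (x s - u) + k s * norm (x s - u)"
            using elim s B by (intro add_mono) blast+
          also have "\<dots> \<le> l s * \<eta> + k s * \<eta>"
            using l(2) k(2) u(2) by (intro add_mono mult_left_mono) auto
          finally show "norm (?f s (x s)) \<le> (\<Sum>u\<in>F. norm (?f s u)) + \<eta> * ?l s"
            by (simp add: algebra_simps)
        qed
      qed
    qed
    also have "\<dots> = (\<Sum>u\<in>F. integral {a..b} (\<lambda>s. norm (?f s u))) + \<eta> * (integral {a..b} l + integral {a..b} k)"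
      using l(1) k(1)
      by (simp add: Henstock_Kurzweil_Integration.integral_add[OF Fi li] Henstock_Kurzweil_Integration.integral_sum[OF F(1)]
          Henstock_Kurzweil_Integration.integral_add fi absolutely_integrable_on_def)
    also have "\<dots> \<le> (\<Sum>u\<in>F. \<epsilon>) + \<eta> * (M + M)"
      using * l(3) k(3) \<eta>(1) by (intro add_mono sum_mono mult_left_mono) auto
    also have "\<dots> \<le> e" using \<epsilon>(2) \<eta>(2) by simp
    finally show "integral {a..b} (\<lambda>s. norm (?f s (x s))) \<le> e" .
  qed
qed

section \<open>Topologies generated by mean values along curves\<close>

text \<open>The common form of both kinds of seminorms: in \<open>T_D\<close> the set
  \<open>X\<close> consists of one constant curve, in \<open>T_Theta\<close> of the curves
  \<open>(x t, u)\<close> with fixed \<open>u\<close>.\<close>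

definition curve_seminorm :: "real set \<Rightarrow> (real \<Rightarrow> 'z) set \<Rightarrow> (real \<Rightarrow> 'z \<Rightarrow> 'a::real_normed_vector) \<Rightarrow> ennreal" where
  "curve_seminorm I X f = (SUP x\<in>X. \<integral>\<^sup>+t\<in>I. ennreal (norm (f t (x t))) \<partial>lebesgue)"

abbreviation LC_diff :: "'n LC \<Rightarrow> 'n LC \<Rightarrow> real \<Rightarrow> (real^'n) \<times> (real^'n) \<Rightarrow> real^'n" where
  "LC_diff G H \<equiv> (\<lambda>t z. rep_LC G t z - rep_LC H t z)"

text \<open>The common radius \<open>r\<close> lets one Lipschitz function serve all curves of
  \<open>X\<close>. The last clause closes the family under translation: a single pair
  \<open>(J, Z)\<close> must serve all \<open>t\<close> within 1 of \<open>t0\<close>, since joint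
  continuity needs one neighbourhood of functions for a whole range of times.\<close>

definition curve_family :: "(real set \<times> (real \<Rightarrow> (real^'n) \<times> (real^'n)) set) set \<Rightarrow> bool" where
  "curve_family \<F> \<longleftrightarrow> \<F> \<noteq> {} \<and>
     (\<forall>(I, X)\<in>\<F>. (\<exists>a b. I = {a..b}) \<and> (\<exists>r. \<forall>x\<in>X. continuous_on I x \<and> x ` I \<subseteq> cball 0 r)) \<and>
     (\<forall>(I, X)\<in>\<F>. \<forall>t0. \<exists>(J, Z)\<in>\<F>. \<forall>t. \<bar>t - t0\<bar> \<le> 1 \<longrightarrow>
        (\<forall>x\<in>X. \<exists>z\<in>Z. \<forall>s\<in>I. s + t \<in> J \<and> z (s + t) = x s))"

definition curve_topology :: "(real set \<times> (real \<Rightarrow> (real^'n) \<times> (real^'n)) set) set \<Rightarrow> 'n LC topology" where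
  "curve_topology \<F> = seminorm_topology ((\<lambda>(I, X). curve_seminorm I X) ` \<F>)"

lemma openin_curve_ball:
  assumes "(I, X) \<in> \<F>" "e > 0"
  shows "openin (curve_topology \<F>) {G. curve_seminorm I X (LC_diff G H) < ennreal e}"
  unfolding curve_topology_def seminorm_topology_def
  by (intro topology_generated_by_Basis) (use assms in force)

lemma curve_seminorm_zero: "curve_seminorm I X (\<lambda>t z. 0) = 0"
  by (cases "X = {}") (simp_all add: curve_seminorm_def bot_ennreal)

lemma topspace_curve_topology:
  assumes "\<F> \<noteq> {}"
  shows "topspace (curve_topology \<F>) = UNIV"
proof -
  obtain I X where IX: "(I, X) \<in> \<F>" using assms by auto
  have "G \<in> topspace (curve_topology \<F>)" for G :: "'a LC"
    by (rule subsetD[OF openin_subset[OF openin_curve_ball[OF IX zero_less_one, of G]]])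
      (simp add: curve_seminorm_zero)
  then show ?thesis by auto
qed

lemma continuous_map_into_curve_topology:
  assumes ne: "\<F> \<noteq> {}"
    and op: "\<And>I X H e. (I, X) \<in> \<F> \<Longrightarrow> e > 0 \<Longrightarrow>
      openin S (f -` {G. curve_seminorm I X (LC_diff G H) < ennreal e} \<inter> topspace S)"
  shows "continuous_map S (curve_topology \<F>) f"
  unfolding curve_topology_def seminorm_topology_def
proof (rule continuous_on_generated_topo)
  show "f ` topspace S \<subseteq> \<Union> {{G. p (LC_diff G H) < ennreal e} | p H e. p \<in> (\<lambda>(I, X). curve_seminorm I X) ` \<F> \<and> e > 0}"
    using topspace_curve_topology[OF ne]
    unfolding curve_topology_def seminorm_topology_def topology_generated_by_topspace by simp
  fix B assume "B \<in> {{G. p (LC_diff G H) < ennreal e} | p H e. p \<in> (\<lambda>(I, X). curve_seminorm I X) ` \<F> \<and> e > 0}"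
  then obtain I X H e where "(I, X) \<in> \<F>" "e > 0" "B = {G. curve_seminorm I X (LC_diff G H) < ennreal e}"
    by auto
  then show "openin S (f -` B \<inter> topspace S)" using op by simp
qed

lemma LC_diff_integrable:
  "continuous_on {a..b} x \<Longrightarrow> (\<lambda>t. LC_diff G H t (x t)) absolutely_integrable_on {a..b}"
  by (intro set_integral_diff LC_fun_curve_integrable rep_LC_LC_fun)

lemma LC_diff_integrable_const: "(\<lambda>t. LC_diff G H t z) absolutely_integrable_on {a..b}"
  using LC_diff_integrable[of a b "\<lambda>_. z"] by simp

lemma LC_diff_nn_integral:
  "continuous_on {a..b} x \<Longrightarrow> (\<integral>\<^sup>+t\<in>{a..b}. ennreal (norm (LC_diff G H t (x t))) \<partial>lebesgue) =
    ennreal (integral {a..b} (\<lambda>t. norm (LC_diff G H t (x t))))"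
  by (rule set_nn_integral_eq_integral_norm[OF LC_diff_integrable])

lemma curve_seminorm_lessD:
  assumes "curve_seminorm {a..b} X (LC_diff G H) < ennreal e" "x \<in> X" "continuous_on {a..b} x"
  shows "integral {a..b} (\<lambda>t. norm (LC_diff G H t (x t))) < e"
proof -
  have "ennreal (integral {a..b} (\<lambda>t. norm (LC_diff G H t (x t)))) \<le> curve_seminorm {a..b} X (LC_diff G H)"
    unfolding LC_diff_nn_integral[OF assms(3), symmetric] curve_seminorm_def by (rule SUP_upper[OF assms(2)])
  then have "ennreal (integral {a..b} (\<lambda>t. norm (LC_diff G H t (x t)))) < ennreal e"
    using assms(1) by (rule order.strict_trans1)
  then show ?thesis by (meson ennreal_leI leD leI)
qed

lemma curve_seminorm_leI:
  assumes "\<And>x. x \<in> X \<Longrightarrow> continuous_on {a..b} x"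
    and "\<And>x. x \<in> X \<Longrightarrow> integral {a..b} (\<lambda>t. norm (LC_diff G H t (x t))) \<le> e"
  shows "curve_seminorm {a..b} X (LC_diff G H) \<le> ennreal e"
  unfolding curve_seminorm_def
  by (intro SUP_least) (use assms in \<open>auto simp: LC_diff_nn_integral intro!: ennreal_leI\<close>)

lemma curve_seminorm_triangle:
  assumes "\<And>x. x \<in> X \<Longrightarrow> continuous_on {a..b} x"
  shows "curve_seminorm {a..b} X (LC_diff G K) \<le>
    curve_seminorm {a..b} X (LC_diff G H) + curve_seminorm {a..b} X (LC_diff H K)"
  unfolding curve_seminorm_def
proof (rule SUP_least)
  fix x assume x: "x \<in> X"
  note c = assms[OF x]
  have r: "(\<lambda>t. rep_LC L t (x t)) absolutely_integrable_on {a..b}" for L :: "'a LC"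
    by (intro LC_fun_curve_integrable rep_LC_LC_fun c)
  have "(\<integral>\<^sup>+t\<in>{a..b}. ennreal (norm (LC_diff G K t (x t))) \<partial>lebesgue) \<le>
      ennreal (integral {a..b} (\<lambda>t. norm (LC_diff G H t (x t))) + integral {a..b} (\<lambda>t. norm (LC_diff H K t (x t))))"
    unfolding LC_diff_nn_integral[OF c] by (intro ennreal_leI integral_norm_triangle r)
  also have "\<dots> = (\<integral>\<^sup>+t\<in>{a..b}. ennreal (norm (LC_diff G H t (x t))) \<partial>lebesgue) +
      (\<integral>\<^sup>+t\<in>{a..b}. ennreal (norm (LC_diff H K t (x t))) \<partial>lebesgue)"
    unfolding LC_diff_nn_integral[OF c]
    by (intro ennreal_plus integral_nonneg abs_integrable_norm_Icc LC_diff_integrable c) auto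
  also have "\<dots> \<le> (SUP x\<in>X. \<integral>\<^sup>+t\<in>{a..b}. ennreal (norm (LC_diff G H t (x t))) \<partial>lebesgue) +
      (SUP x\<in>X. \<integral>\<^sup>+t\<in>{a..b}. ennreal (norm (LC_diff H K t (x t))) \<partial>lebesgue)"
    by (intro add_mono SUP_upper x)
  finally show "(\<integral>\<^sup>+t\<in>{a..b}. ennreal (norm (LC_diff G K t (x t))) \<partial>lebesgue) \<le>
      (SUP x\<in>X. \<integral>\<^sup>+t\<in>{a..b}. ennreal (norm (LC_diff G H t (x t))) \<partial>lebesgue) +
      (SUP x\<in>X. \<integral>\<^sup>+t\<in>{a..b}. ennreal (norm (LC_diff H K t (x t))) \<partial>lebesgue)" .
qed

section \<open>Continuity of time translation and invariance of the hull\<close>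

lemma translate_integral_diff:
  assumes "continuous_on {a..b} x"
  shows "integral {a..b} (\<lambda>s. norm (LC_diff (translate_LC t G) (translate_LC r H) s (x s))) =
    integral {a..b} (\<lambda>s. norm (rep_LC G (s + t) (x s) - rep_LC H (s + r) (x s)))"
proof (rule integral_cong_AE_Icc)
  show "AE s in lebesgue. s \<in> {a..b} \<longrightarrow> norm (LC_diff (translate_LC t G) (translate_LC r H) s (x s)) =
      norm (rep_LC G (s + t) (x s) - rep_LC H (s + r) (x s))"
    using rep_translate_LC_AE[of t G] rep_translate_LC_AE[of r H] 
    by eventually_elim (simp del: split_paired_All)
qed

text \<open>Uniformity over \<open>X\<close> comes from \<open>finite_test_points\<close> with the
  whole space as dense set: only finitely many constant arguments \<open>z\<close> have to be
  treated, and for these continuity of translations in L1 applies.\<close>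

lemma translate_curve_continuous:
  assumes X: "\<And>x. x \<in> X \<Longrightarrow> continuous_on {a..b} x \<and> x ` {a..b} \<subseteq> cball 0 r" and e: "e > 0"
  shows "\<exists>d>0. \<forall>t. \<bar>t - t0\<bar> < d \<longrightarrow>
    curve_seminorm {a..b} X (LC_diff (translate_LC t G) (translate_LC t0 G)) \<le> ennreal e"
proof -
  let ?g = "rep_LC G"
  note g = rep_LC_LC_fun[of G]
  obtain l where l: "\<And>a b. l absolutely_integrable_on {a..b}" "\<And>t. 0 \<le> l t"
    and lip: "AE t in lebesgue. \<forall>z1\<in>cball 0 (r + 1). \<forall>z2\<in>cball 0 (r + 1). norm (?g t z1 - ?g t z2) \<le> l t * norm (z1 - z2)"
    using LC_bounds[OF g compact_cball[of 0 "r + 1"]] by blast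
  \<comment> \<open>The window is widened by 1 on both sides so that \<open>M\<close> bounds the
    Lipschitz integral of every translate with \<open>\<bar>t - t0\<bar> \<le> 1\<close>.\<close>
  define M where "M = integral {a + t0 - 1..b + t0 + 1} l"
  have li: "l integrable_on {c..d}" for c d using l(1) by (simp add: absolutely_integrable_on_def)
  have M: "0 \<le> M" unfolding M_def by (intro integral_nonneg li l)
  have Lip: "mean_lipschitz a b (ball 0 (r + 1)) M (\<lambda>s. ?g (s + t))" if t: "\<bar>t - t0\<bar> \<le> 1" for t
    unfolding mean_lipschitz_def
  proof (intro exI[of _ "\<lambda>s. l (s + t)"] conjI allI l(2))
    show "(\<lambda>s. l (s + t)) absolutely_integrable_on {a..b}" by (intro absolutely_integrable_translate l)
    show "integral {a..b} (\<lambda>s. l (s + t)) \<le> M"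
      unfolding integral_translate_Icc M_def using t by (intro integral_subset_Icc_nonneg li l) auto
    show "AE s in lebesgue. s \<in> {a..b} \<longrightarrow> (\<forall>u\<in>ball 0 (r + 1). \<forall>v\<in>ball 0 (r + 1).
        norm (?g (s + t) u - ?g (s + t) v) \<le> l (s + t) * norm (u - v))"
      using AE_lebesgue_shift[OF lip, of t] by eventually_elim (use ball_subset_cball in blast)
  qed
  obtain F :: "((real^'a) \<times> (real^'a)) set" and \<epsilon> where F: "finite F" and \<epsilon>: "0 < \<epsilon>" and
    test: "\<forall>(g :: real \<Rightarrow> (real^'a) \<times> (real^'a) \<Rightarrow> real^'a) h x. (\<forall>s\<in>{a..b}. x s \<in> cball 0 r) \<and>
       mean_lipschitz a b (ball 0 (r + 1)) M g \<and> mean_lipschitz a b (ball 0 (r + 1)) M h \<and>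
       (\<forall>u. (\<lambda>s. g s u - h s u) absolutely_integrable_on {a..b}) \<and>
       (\<lambda>s. g s (x s) - h s (x s)) absolutely_integrable_on {a..b} \<and>
       (\<forall>u\<in>F. integral {a..b} (\<lambda>s. norm (g s u - h s u)) \<le> \<epsilon>) \<longrightarrow>
       integral {a..b} (\<lambda>s. norm (g s (x s) - h s (x s))) \<le> e"
    using finite_test_points[OF closure_UNIV M e, of r a b] by (elim exE conjE) (rule that)
  have gz: "(\<lambda>s. ?g s z) absolutely_integrable_on {c..d}" for z c d
    by (intro LC_fun_curve_integrable g) auto
  have "\<exists>d. 0 < d \<and> d \<le> 1 \<and> (\<forall>t. \<bar>t\<bar> < d \<longrightarrow> integral {a..b} (\<lambda>s. norm (?g (s + t + t0) z - ?g (s + t0) z)) < \<epsilon>)" for z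
  proof -
    have "(\<lambda>s. ?g (s + t0) z) absolutely_integrable_on {a - 1..b + 1}"
      by (intro absolutely_integrable_translate gz)
    from translation_continuous_L1[OF this \<epsilon>] obtain d where "0 < d" "d \<le> 1"
      "\<And>t. \<bar>t\<bar> < d \<Longrightarrow> integral {a..b} (\<lambda>s. norm (?g (s + t + t0) z - ?g (s + t0) z)) < \<epsilon>"
      by blast
    then show ?thesis by blast
  qed
  then obtain d where d': "\<forall>z. 0 < d z \<and> d z \<le> 1 \<and> (\<forall>t. \<bar>t\<bar> < d z \<longrightarrow>
      integral {a..b} (\<lambda>s. norm (?g (s + t + t0) z - ?g (s + t0) z)) < \<epsilon>)"
    using choice[of "\<lambda>z d. 0 < d \<and> d \<le> 1 \<and> (\<forall>t. \<bar>t\<bar> < d \<longrightarrow>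
      integral {a..b} (\<lambda>s. norm (?g (s + t + t0) z - ?g (s + t0) z)) < \<epsilon>)"] by presburger
  have d: "d z > 0" "\<bar>t\<bar> < d z \<Longrightarrow> integral {a..b} (\<lambda>s. norm (?g (s + t + t0) z - ?g (s + t0) z)) < \<epsilon>"
    for z t
    using d'[THEN spec[of _ z]] by simp_all
  define \<delta> where "\<delta> = Min (insert 1 (d ` F))"
  have \<delta>: "\<delta> > 0" "\<delta> \<le> 1" "\<And>z. z \<in> F \<Longrightarrow> \<delta> \<le> d z" using F d(1) by (auto simp: \<delta>_def)
  show ?thesis
  proof (intro exI[of _ \<delta>] conjI allI impI \<delta>(1) curve_seminorm_leI)
    fix t x assume t: "\<bar>t - t0\<bar> < \<delta>" and x: "x \<in> X"
    have cx: "continuous_on {a..b} x" using X[OF x] by simp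
    have fi: "(\<lambda>s. ?g (s + t) (y s) - ?g (s + t0) (y s)) absolutely_integrable_on {a..b}" if "continuous_on {a..b} y" for y
      using LC_fun_curve_integrable[OF time_shift_LC_fun[OF g] that, of t]
        LC_fun_curve_integrable[OF time_shift_LC_fun[OF g] that, of t0]
      unfolding time_shift_def by (rule set_integral_diff(1))
    have "integral {a..b} (\<lambda>s. norm (?g (s + t) (x s) - ?g (s + t0) (x s))) \<le> e"
    proof (rule test[THEN spec, THEN spec, THEN spec, THEN mp], intro conjI allI ballI Lip fi cx continuous_on_const)
      show "x s \<in> cball 0 r" if "s \<in> {a..b}" for s using X[OF x] that by blast
      show "integral {a..b} (\<lambda>s. norm (?g (s + t) z - ?g (s + t0) z)) \<le> \<epsilon>" if "z \<in> F" for z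
        using d(2)[of "t - t0" z] t \<delta>(3)[OF that] by simp
    qed (use t \<delta>(2) in auto)
    then show "integral {a..b} (\<lambda>s. norm (LC_diff (translate_LC t G) (translate_LC t0 G) s (x s))) \<le> e"
      unfolding translate_integral_diff[OF cx] .
  qed (use X in auto)
qed

text \<open>The translate of \<open>G\<close> by \<open>t\<close> is compared with that of
  \<open>G0\<close> by \<open>t\<close>, then with that of \<open>G0\<close> by \<open>t0\<close>.
  The first difference is measured on shifted curves, which the pair \<open>(J, Z)\<close> contains
  for all \<open>t\<close> near \<open>t0\<close>; the second is
  \<open>translate_curve_continuous\<close>.\<close>

lemma curve_topology_translate_continuous:
  assumes \<F>: "curve_family \<F>"
  shows "continuous_map (prod_topology (top_of_set {0..}) (curve_topology \<F>)) (curve_topology \<F>)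
    (\<lambda>(t, G). translate_LC t G)"
proof (rule continuous_map_into_curve_topology)
  let ?T = "curve_topology \<F>"
  let ?P = "prod_topology (top_of_set {0::real..}) ?T"
  show ne: "\<F> \<noteq> {}" using \<F> by (simp add: curve_family_def)
  fix I X H e assume IX: "(I, X) \<in> \<F>" and e: "(e::real) > 0"
  let ?A = "(\<lambda>(t, G). translate_LC t G) -` {G. curve_seminorm I X (LC_diff G H) < ennreal e} \<inter> topspace ?P"
  have "(\<exists>a b. I = {a..b}) \<and> (\<exists>r. \<forall>x\<in>X. continuous_on I x \<and> x ` I \<subseteq> cball 0 r)"
    using \<F> IX unfolding curve_family_def by fastforce
  then obtain a b r where I: "I = {a..b}" and X: "\<And>x. x \<in> X \<Longrightarrow> continuous_on {a..b} x \<and> x ` {a..b} \<subseteq> cball 0 r"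
    by blast
  show "openin ?P ?A"
    unfolding openin_subopen[of ?P ?A]
  proof
    fix q assume "q \<in> ?A"
    then obtain t0 G0 where q: "q = (t0, G0)" "0 \<le> t0"
      and d0: "curve_seminorm {a..b} X (LC_diff (translate_LC t0 G0) H) < ennreal e"
      by (auto simp: I)
    obtain d where d: "curve_seminorm {a..b} X (LC_diff (translate_LC t0 G0) H) = ennreal d" "0 \<le> d" "d < e"
      using d0 by (cases "curve_seminorm {a..b} X (LC_diff (translate_LC t0 G0) H)")
        (auto simp: ennreal_less_iff)
    \<comment> \<open>The ball about \<open>H\<close> leaves the room \<open>e - d\<close>; only two
      of its thirds are spent, so the final inequality is strict.\<close>
    define k where "k = (e - d) / 3"
    have k: "k > 0" using d by (simp add: k_def)
    obtain \<delta> where \<delta>: "\<delta> > 0 \<and> (\<forall>t. \<bar>t - t0\<bar> < \<delta> \<longrightarrow>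
        curve_seminorm {a..b} X (LC_diff (translate_LC t G0) (translate_LC t0 G0)) \<le> ennreal k)"
      using translate_curve_continuous[OF X k, where ?t0.0 = t0 and G = G0] by (rule exE)
    have "\<exists>(J, Z)\<in>\<F>. \<forall>t. \<bar>t - t0\<bar> \<le> 1 \<longrightarrow> (\<forall>x\<in>X. \<exists>z\<in>Z. \<forall>s\<in>I. s + t \<in> J \<and> z (s + t) = x s)"
      using \<F> IX unfolding curve_family_def by fastforce
    then obtain p where p: "p \<in> \<F>" "case p of (J, Z) \<Rightarrow> \<forall>t. \<bar>t - t0\<bar> \<le> 1 \<longrightarrow>
        (\<forall>x\<in>X. \<exists>z\<in>Z. \<forall>s\<in>I. s + t \<in> J \<and> z (s + t) = x s)"
      by (rule bexE)
    obtain J Z where pJZ: "p = (J, Z)" by (rule prod.exhaust)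
    have JZ: "(J, Z) \<in> \<F>" and shift: "\<forall>t. \<bar>t - t0\<bar> \<le> 1 \<longrightarrow>
        (\<forall>x\<in>X. \<exists>z\<in>Z. \<forall>s\<in>I. s + t \<in> J \<and> z (s + t) = x s)"
      using p by (simp_all add: pJZ)
    have "(\<exists>a b. J = {a..b}) \<and> (\<exists>r. \<forall>x\<in>Z. continuous_on J x \<and> x ` J \<subseteq> cball 0 r)"
      using \<F> JZ unfolding curve_family_def by fastforce
    then obtain a' b' where J: "J = {a'..b'}" and Z: "\<And>z. z \<in> Z \<Longrightarrow> continuous_on {a'..b'} z"
      by blast
    let ?V = "{G. curve_seminorm J Z (LC_diff G G0) < ennreal k}"
    let ?N = "({0..} \<inter> ball t0 (min \<delta> 1)) \<times> ?V"
    show "\<exists>S. openin ?P S \<and> q \<in> S \<and> S \<subseteq> ?A"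
    proof (intro exI[of _ ?N] conjI)
      show "openin ?P ?N"
        by (simp add: openin_prod_Times_iff openin_open_Int openin_curve_ball[OF JZ k])
      show "q \<in> ?N" using q \<delta> k by (simp add: curve_seminorm_zero)
      show "?N \<subseteq> ?A"
      proof
        fix p assume "p \<in> ?N"
        then obtain t G where p: "p = (t, G)" and t: "t \<in> {0..}" "t \<in> ball t0 (min \<delta> 1)"
          and G: "curve_seminorm J Z (LC_diff G G0) < ennreal k" by blast
        have t': "\<bar>t - t0\<bar> < \<delta>" "\<bar>t - t0\<bar> \<le> 1" using t by (auto simp: dist_real_def)
        have "curve_seminorm {a..b} X (LC_diff (translate_LC t G) (translate_LC t G0)) \<le> ennreal k"
        proof (rule curve_seminorm_leI)
          fix x assume x: "x \<in> X"
          show cx: "continuous_on {a..b} x" using X[OF x] by simp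
          obtain z where z: "z \<in> Z" "\<And>s. s \<in> {a..b} \<Longrightarrow> s + t \<in> {a'..b'} \<and> z (s + t) = x s"
            using shift[rule_format, OF t'(2) x] unfolding I J by blast
          have "integral {a..b} (\<lambda>s. norm (LC_diff (translate_LC t G) (translate_LC t G0) s (x s))) =
            integral {a..b} (\<lambda>s. norm (LC_diff G G0 (s + t) (z (s + t))))"
            unfolding translate_integral_diff[OF cx] by (intro integral_cong) (use z in auto)
          also have "\<dots> = integral {a + t..b + t} (\<lambda>s. norm (LC_diff G G0 s (z s)))"
            by (rule integral_translate_Icc)
          also have "\<dots> \<le> integral {a'..b'} (\<lambda>s. norm (LC_diff G G0 s (z s)))"
          proof (cases "a \<le> b")
            case True
            then show ?thesis
              using z(2)[of a] z(2)[of b]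
              by (intro integral_subset_Icc_nonneg abs_integrable_norm_Icc LC_diff_integrable Z z(1)) auto
          next
            case False
            then show ?thesis
              by (simp add: integral_nonneg abs_integrable_norm_Icc LC_diff_integrable Z z(1))
          qed
          also have "\<dots> \<le> k"
            using curve_seminorm_lessD[OF G[unfolded J] z(1) Z[OF z(1)]] by simp
          finally show "integral {a..b} (\<lambda>s. norm (LC_diff (translate_LC t G) (translate_LC t G0) s (x s))) \<le> k" .
        qed
        note 1 = this \<delta>[THEN conjunct2, rule_format, OF t'(1)]
        have "curve_seminorm {a..b} X (LC_diff (translate_LC t G) H) \<le>
          (curve_seminorm {a..b} X (LC_diff (translate_LC t G) (translate_LC t G0)) +
          curve_seminorm {a..b} X (LC_diff (translate_LC t G0) (translate_LC t0 G0))) +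
          curve_seminorm {a..b} X (LC_diff (translate_LC t0 G0) H)"
          using X by (intro order_trans[OF curve_seminorm_triangle[of X a b "translate_LC t G" H "translate_LC t0 G0"]]
              add_right_mono curve_seminorm_triangle) auto
        also have "\<dots> \<le> (ennreal k + ennreal k) + ennreal d"
          unfolding d(1) by (intro add_mono 1 order_refl)
        also have "\<dots> = ennreal (k + k + d)" using k d by (simp add: ennreal_plus[symmetric] del: ennreal_plus)
        also have "\<dots> < ennreal e" using e d by (intro ennreal_lessI) (auto simp: k_def field_simps)
        finally show "p \<in> ?A" using t by (simp add: p I topspace_curve_topology[OF ne])
      qed
    qed
  qed
qed

text \<open>Each translation maps the orbit of \<open>F\<close> into itself, and a continuous map
  sends the closure of a set into the closure of its image; so the hull is invariant.\<close>

lemma curve_topology_semiflow: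
  fixes F :: "'n::finite LC"
  assumes \<F>: "curve_family \<F>"
    and dep: "mean_continuous_along_solutions (curve_topology \<F>) (Hull (curve_topology \<F>) F)"
  shows "continuous_skew_product_semiflow (subtopology (curve_topology \<F>) (Hull (curve_topology \<F>) F))
    C11_topology (flow_domain (curve_topology \<F>) F) flow_map"
proof (rule flow_skew_product_semiflow[OF _ curve_topology_translate_continuous[OF \<F>] _ dep])
  let ?T = "curve_topology \<F>"
  have ne: "\<F> \<noteq> {}" using \<F> by (simp add: curve_family_def)
  show "Hull ?T F \<subseteq> topspace ?T" by (simp add: topspace_curve_topology[OF ne])
  fix t :: real and G assume t: "0 \<le> t" and G: "G \<in> Hull ?T F"
  have "continuous_map ?T (prod_topology (top_of_set {0..}) ?T) (\<lambda>G. (t, G))"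
    using t by (intro continuous_map_pairedI) auto
  from continuous_map_compose[OF this curve_topology_translate_continuous[OF \<F>]]
  have "continuous_map ?T ?T (translate_LC t)" by (simp add: o_def)
  then have "translate_LC t ` (?T closure_of range (\<lambda>t. translate_LC t F)) \<subseteq>
      ?T closure_of (translate_LC t ` range (\<lambda>t. translate_LC t F))"
    by (rule continuous_map_image_closure_subset)
  also have "\<dots> \<subseteq> ?T closure_of (range (\<lambda>t. translate_LC t F))"
    by (intro closure_of_mono) (auto simp: translate_LC_add)
  finally show "translate_LC t G \<in> Hull ?T F"
    using G by (auto simp: Hull_def)
qed

subsection \<open>Bounds inherited by the hull\<close>

lemma rep_translate_abs_AE:
  assumes "f \<in> LC_fun"
  shows "AE s in lebesgue. \<forall>z. rep_LC (translate_LC \<tau> (abs_LC f)) s z = time_shift \<tau> f s z"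
  using rep_translate_LC_AE[of \<tau> "abs_LC f"] AE_lebesgue_shift[OF rep_abs_LC_AE[OF assms], of \<tau>]
  by eventually_elim (simp add: time_shift_def del: split_paired_All)

text \<open>Finiteness of the integral makes \<open>L\<close> finite almost everywhere on the
  interval, so \<open>enn2real\<close> changes it there only on a null set. This turns suprema of
  quotients into the real Lipschitz functions of \<open>mean_lipschitz\<close>.\<close>

lemma ennreal_integrable_real:
  fixes L :: "real \<Rightarrow> ennreal"
  assumes [measurable]: "L \<in> borel_measurable lebesgue"
    and M: "(\<integral>\<^sup>+s\<in>{a..b}. L s \<partial>lebesgue) \<le> ennreal M" "0 \<le> M"
  shows "\<exists>l. l absolutely_integrable_on {a..b} \<and> (\<forall>s. 0 \<le> l s) \<and> integral {a..b} l \<le> M \<and>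
    (AE s in lebesgue. s \<in> {a..b} \<longrightarrow> L s = ennreal (l s))"
proof -
  let ?l = "\<lambda>s. enn2real (L s)"
  have [measurable]: "{a..b} \<in> sets lebesgue" by simp
  have "(\<integral>\<^sup>+s\<in>{a..b}. L s \<partial>lebesgue) < \<infinity>"
    using M(1) by (rule order.strict_trans1) simp
  then have "AE s in lebesgue. L s * indicator {a..b} s \<noteq> \<infinity>"
    by (intro nn_integral_PInf_AE) auto
  then have eq: "AE s in lebesgue. s \<in> {a..b} \<longrightarrow> L s = ennreal (?l s)"
  proof eventually_elim
    case (elim s)
    then show ?case by (cases "L s") auto
  qed
  have nn: "(\<integral>\<^sup>+s\<in>{a..b}. ennreal (?l s) \<partial>lebesgue) = (\<integral>\<^sup>+s\<in>{a..b}. L s \<partial>lebesgue)"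
    using eq by (intro nn_integral_cong_AE) (auto elim!: eventually_mono simp: indicator_def)
  have "integrable (lebesgue_on {a..b}) ?l"
  proof (rule integrableI_nonneg)
    show "?l \<in> borel_measurable (lebesgue_on {a..b})"
      by (intro measurable_restrict_space1) measurable
    show "(\<integral>\<^sup>+s. ennreal (?l s) \<partial>lebesgue_on {a..b}) < \<infinity>"
      using nn M by (subst nn_integral_restrict_space) (auto intro: order.strict_trans1)
  qed auto
  then have ai: "?l absolutely_integrable_on {a..b}"
    by (simp add: abs_integrable_iff_lebesgue_on)
  have "ennreal (integral {a..b} ?l) \<le> ennreal M"
    using set_nn_integral_eq_integral_norm[OF ai] nn M by simp
  then have "integral {a..b} ?l \<le> M" using M(2) by simp
  then show ?thesis using ai eq by (intro exI[of _ ?l]) auto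
qed

lemma rep_LC_point_measurable: "(\<lambda>s. rep_LC G s p) \<in> borel_measurable lebesgue"
  using LC_fun_slice_measurable[OF rep_LC_LC_fun, of "\<lambda>_. p"] by (intro measurable_completion) simp

text \<open>A supremum over finitely many indices changes little in mean when the function changes
  little at finitely many points, so some \<open>H\<close> in \<open>S\<close> near \<open>G\<close>
  transfers its bound up to \<open>\<epsilon>\<close>; monotone convergence passes to the countable
  supremum. With \<open>a = 0\<close> this covers bounds on values, with \<open>a = 1\<close> bounds
  on difference quotients.\<close>

lemma closure_nn_integral_bound:
  fixes T :: "'n::finite LC topology" and k a :: "'i \<Rightarrow> real"
    and z w :: "'i \<Rightarrow> (real^'n) \<times> (real^'n)"
  assumes J: "countable J" and k: "\<And>i. i \<in> J \<Longrightarrow> 0 \<le> k i"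
    and P: "z ` J \<subseteq> P" "w ` J \<subseteq> P"
    and approx: "\<And>Z e. finite Z \<Longrightarrow> Z \<subseteq> P \<Longrightarrow> e > 0 \<Longrightarrow> \<exists>V. openin T V \<and> G \<in> V \<and>
      (\<forall>H\<in>V. \<forall>z\<in>Z. integral {c..d} (\<lambda>s. norm (LC_diff G H s z)) \<le> e)"
    and G: "G \<in> T closure_of S"
    and S: "\<And>H. H \<in> S \<Longrightarrow> (\<integral>\<^sup>+s\<in>{c..d}. (SUP i\<in>J. ennreal (k i *
      norm (rep_LC H s (z i) - a i *\<^sub>R rep_LC H s (w i)))) \<partial>lebesgue) \<le> M"
  shows "(\<integral>\<^sup>+s\<in>{c..d}. (SUP i\<in>J. ennreal (k i *
      norm (rep_LC G s (z i) - a i *\<^sub>R rep_LC G s (w i)))) \<partial>lebesgue) \<le> M"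
proof (cases "J = {}")
  case True
  then show ?thesis by (simp add: bot_ennreal)
next
  case ne: False
  define Q where "Q H i s = ennreal (k i * norm (rep_LC H s (z i) - a i *\<^sub>R rep_LC H s (w i)))" for H i s
  define e where "e = from_nat_into J"
  have re: "range e = J" unfolding e_def by (rule range_from_nat_into[OF ne J])
  note [measurable] = rep_LC_point_measurable
  have Qm [measurable]: "Q H i \<in> borel_measurable lebesgue" for H i
    unfolding Q_def by measurable
  have SQm: "(\<lambda>s. SUP i\<in>J. Q H i s) \<in> borel_measurable lebesgue" for H
    by (rule borel_measurable_SUP[OF J]) (rule Qm)
  have Im [measurable]: "{c..d} \<in> sets lebesgue" by simp
  define A where "A n s = (SUP m\<in>{..n}. Q G (e m) s)" for n :: nat and s
  have Am [measurable]: "A n \<in> borel_measurable lebesgue" for n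
    unfolding A_def by (rule borel_measurable_SUP) auto
  have A_SUP: "(SUP i\<in>J. Q G i s) = (SUP n. A n s)" for s
  proof (rule antisym)
    show "(SUP i\<in>J. Q G i s) \<le> (SUP n. A n s)"
    proof (rule SUP_least)
      fix i assume "i \<in> J"
      then obtain n where n: "i = e n" using re by auto
      have "Q G i s \<le> A n s" unfolding A_def n by (rule SUP_upper) simp
      also have "\<dots> \<le> (SUP n. A n s)" by (rule SUP_upper) simp
      finally show "Q G i s \<le> (SUP n. A n s)" .
    qed
    show "(SUP n. A n s) \<le> (SUP i\<in>J. Q G i s)"
      unfolding A_def using re by (intro SUP_least SUP_upper) auto
  qed
  have An: "(\<integral>\<^sup>+s\<in>{c..d}. A n s \<partial>lebesgue) \<le> M" for n
  proof (rule ennreal_le_epsilon)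
    fix \<epsilon> :: real assume \<epsilon>: "0 < \<epsilon>"
    \<comment> \<open>\<open>C\<close> adds up the coefficients with which the errors at the points
      \<open>z (e m)\<close> and \<open>w (e m)\<close> enter the terms with
      \<open>m \<le> n\<close>.\<close>
    define C where "C = (\<Sum>m\<le>n. k (e m) * (1 + \<bar>a (e m)\<bar>))"
    have ke: "0 \<le> k (e m)" for m using k[of "e m"] re by auto
    have C: "0 \<le> C" unfolding C_def by (intro sum_nonneg mult_nonneg_nonneg ke) auto
    define \<epsilon>' where "\<epsilon>' = \<epsilon> / (C + 1)"
    have \<epsilon>': "\<epsilon>' > 0" "C * \<epsilon>' \<le> \<epsilon>" using \<epsilon> C by (auto simp: \<epsilon>'_def field_simps)
    let ?Z = "(\<lambda>m. z (e m)) ` {..n} \<union> (\<lambda>m. w (e m)) ` {..n}"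
    have "?Z \<subseteq> P" using P re by auto
    then obtain V where V: "openin T V" "G \<in> V"
      and close: "\<forall>H\<in>V. \<forall>z\<in>?Z. integral {c..d} (\<lambda>s. norm (LC_diff G H s z)) \<le> \<epsilon>'"
      using approx[of ?Z \<epsilon>'] \<epsilon>'(1) by blast
    obtain H where H: "H \<in> S" "H \<in> V" using G V by (auto simp: in_closure_of)
    define R where "R s = (\<Sum>m\<le>n. k (e m) * (norm (LC_diff G H s (z (e m))) + \<bar>a (e m)\<bar> * norm (LC_diff G H s (w (e m)))))" for s
    have R0: "0 \<le> R s" for s unfolding R_def by (intro sum_nonneg mult_nonneg_nonneg ke add_nonneg_nonneg) auto
    have di: "(\<lambda>s. norm (LC_diff G H s p)) absolutely_integrable_on {c..d}" for p
      using absolutely_integrable_norm[OF LC_diff_integrable_const[where G = G and H = H and z = p]] by (simp add: o_def)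
    have di': "(\<lambda>s. norm (LC_diff G H s p)) integrable_on {c..d}" for p
      using di by (simp add: absolutely_integrable_on_def)
    have Ri: "R absolutely_integrable_on {c..d}"
      unfolding R_def by (intro absolutely_integrable_sum set_integrable_mult_right set_integral_add di) auto
    have "integral {c..d} R = (\<Sum>m\<le>n. k (e m) * (integral {c..d} (\<lambda>s. norm (LC_diff G H s (z (e m)))) +
        \<bar>a (e m)\<bar> * integral {c..d} (\<lambda>s. norm (LC_diff G H s (w (e m))))))"
      unfolding R_def
      by (subst Henstock_Kurzweil_Integration.integral_sum)
        (auto simp: Henstock_Kurzweil_Integration.integral_add di' integrable_on_mult_right
          intro!: integrable_on_mult_right integrable_add di')
    also have "\<dots> \<le> (\<Sum>m\<le>n. k (e m) * (\<epsilon>' + \<bar>a (e m)\<bar> * \<epsilon>'))"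
      using close H(2) by (intro sum_mono mult_left_mono add_mono ke) auto
    also have "\<dots> = C * \<epsilon>'" 
      unfolding C_def sum_distrib_right by (intro sum.cong) (simp_all add: algebra_simps)
    finally have R\<epsilon>: "integral {c..d} R \<le> \<epsilon>" using \<epsilon>'(2) by simp
    have nR: "(\<integral>\<^sup>+s\<in>{c..d}. ennreal (R s) \<partial>lebesgue) \<le> ennreal \<epsilon>"
      using set_nn_integral_eq_integral_norm[OF Ri] R0 R\<epsilon> by (simp add: ennreal_leI)
    have Rm [measurable]: "(\<lambda>s. ennreal (R s)) \<in> borel_measurable lebesgue"
      unfolding R_def by measurable
    have "A n s \<le> (SUP i\<in>J. Q H i s) + ennreal (R s)" for s
      unfolding A_def
    proof (rule SUP_least)
      fix m assume m: "m \<in> {..n}"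
      let ?x = "rep_LC G s (z (e m)) - a (e m) *\<^sub>R rep_LC G s (w (e m))"
      let ?y = "rep_LC H s (z (e m)) - a (e m) *\<^sub>R rep_LC H s (w (e m))"
      let ?D = "norm (LC_diff G H s (z (e m))) + \<bar>a (e m)\<bar> * norm (LC_diff G H s (w (e m)))"
      have "norm ?x \<le> norm ?y + norm (?x - ?y)" by (rule norm_triangle_sub)
      also have "?x - ?y = LC_diff G H s (z (e m)) - a (e m) *\<^sub>R LC_diff G H s (w (e m))"
        by (simp add: scaleR_diff_right)
      also have "norm \<dots> \<le> ?D"
        by (rule order_trans[OF norm_triangle_ineq4]) simp
      finally have "k (e m) * norm ?x \<le> k (e m) * norm ?y + k (e m) * ?D"
        using mult_left_mono[OF _ ke[of m]] by (fastforce simp: distrib_left)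
      also have "k (e m) * ?D \<le> R s"
        unfolding R_def using m
        by (intro member_le_sum[where f = "\<lambda>m. k (e m) * (norm (LC_diff G H s (z (e m))) + \<bar>a (e m)\<bar> * norm (LC_diff G H s (w (e m))))"])
          (auto intro!: mult_nonneg_nonneg ke)
      finally have "Q G (e m) s \<le> ennreal (k (e m) * norm ?y + R s)"
        unfolding Q_def by (intro ennreal_leI) simp
      also have "\<dots> = Q H (e m) s + ennreal (R s)"
        unfolding Q_def by (intro ennreal_plus mult_nonneg_nonneg ke R0) auto
      also have "\<dots> \<le> (SUP i\<in>J. Q H i s) + ennreal (R s)"
        using re by (intro add_right_mono SUP_upper) auto
      finally show "Q G (e m) s \<le> (SUP i\<in>J. Q H i s) + ennreal (R s)" .
    qed
    then have "(\<integral>\<^sup>+s\<in>{c..d}. A n s \<partial>lebesgue) \<le>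
        (\<integral>\<^sup>+s. (SUP i\<in>J. Q H i s) * indicator {c..d} s + ennreal (R s) * indicator {c..d} s \<partial>lebesgue)"
      by (intro nn_integral_mono) (auto simp: indicator_def)
    also have "\<dots> = (\<integral>\<^sup>+s\<in>{c..d}. (SUP i\<in>J. Q H i s) \<partial>lebesgue) + (\<integral>\<^sup>+s\<in>{c..d}. ennreal (R s) \<partial>lebesgue)"
      by (intro nn_integral_add borel_measurable_times_ennreal SQm Rm borel_measurable_indicator Im)
    also have "\<dots> \<le> M + ennreal \<epsilon>"
      using S[OF H(1)] nR unfolding Q_def by (rule add_mono)
    finally show "(\<integral>\<^sup>+s\<in>{c..d}. A n s \<partial>lebesgue) \<le> M + ennreal \<epsilon>" .
  qed
  have "(\<integral>\<^sup>+s\<in>{c..d}. (SUP i\<in>J. Q G i s) \<partial>lebesgue) = (\<integral>\<^sup>+s. (SUP n. A n s * indicator {c..d} s) \<partial>lebesgue)"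
    by (intro nn_integral_cong) (simp add: A_SUP SUP_mult_right_ennreal)
  also have "\<dots> = (SUP n. \<integral>\<^sup>+s. A n s * indicator {c..d} s \<partial>lebesgue)"
  proof (rule nn_integral_monotone_convergence_SUP)
    have "A m s \<le> A n s" if "m \<le> n" for m n s
      unfolding A_def using that by (intro SUP_subset_mono) auto
    then show "incseq (\<lambda>n s. A n s * indicator {c..d} s)"
      by (auto simp: incseq_def le_fun_def intro!: mult_right_mono)
  qed measurable
  also have "\<dots> \<le> M" by (intro SUP_least An)
  finally show ?thesis by (simp add: Q_def)
qed

text \<open>The function \<open>l\<close> is the supremum of the quotients itself, made real where
  it is finite. Countability of \<open>J\<close> makes it measurable, and a single null set serves
  all pairs.\<close>

lemma closure_lipschitz_bound:
  fixes T :: "'n::finite LC topology" and k :: "'i \<Rightarrow> real" and z w :: "'i \<Rightarrow> (real^'n) \<times> (real^'n)"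
  assumes J: "countable J" and k: "\<And>i. i \<in> J \<Longrightarrow> 0 < k i" and P: "z ` J \<subseteq> P" "w ` J \<subseteq> P"
    and approx: "\<And>Z e. finite Z \<Longrightarrow> Z \<subseteq> P \<Longrightarrow> e > 0 \<Longrightarrow> \<exists>V. openin T V \<and> G \<in> V \<and>
      (\<forall>H\<in>V. \<forall>z\<in>Z. integral {c..d} (\<lambda>s. norm (LC_diff G H s z)) \<le> e)"
    and G: "G \<in> T closure_of S" and M: "0 \<le> M"
    and S: "\<And>H. H \<in> S \<Longrightarrow> (\<integral>\<^sup>+s\<in>{c..d}. (SUP i\<in>J. ennreal (norm (rep_LC H s (z i) - rep_LC H s (w i)) / k i)) \<partial>lebesgue) \<le> ennreal M"
  shows "\<exists>l. l absolutely_integrable_on {c..d} \<and> (\<forall>s. 0 \<le> l s) \<and> integral {c..d} l \<le> M \<and>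
    (AE s in lebesgue. s \<in> {c..d} \<longrightarrow> (\<forall>i\<in>J. norm (rep_LC G s (z i) - rep_LC G s (w i)) \<le> l s * k i))"
proof -
  let ?L = "\<lambda>H s. SUP i\<in>J. ennreal (norm (rep_LC H s (z i) - rep_LC H s (w i)) / k i)"
  have "(\<integral>\<^sup>+s\<in>{c..d}. (SUP i\<in>J. ennreal ((1 / k i) * norm (rep_LC G s (z i) - 1 *\<^sub>R rep_LC G s (w i)))) \<partial>lebesgue) \<le> ennreal M"
    by (rule closure_nn_integral_bound[OF J _ P approx G]) (use S k in \<open>auto intro: less_imp_le\<close>)
  then have bound: "(\<integral>\<^sup>+s\<in>{c..d}. ?L G s \<partial>lebesgue) \<le> ennreal M" by simp
  have "?L G \<in> borel_measurable lebesgue"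
  proof (rule borel_measurable_SUP[OF J])
    note [measurable] = rep_LC_point_measurable
    show "(\<lambda>s. ennreal (norm (rep_LC G s (z i) - rep_LC G s (w i)) / k i)) \<in> borel_measurable lebesgue" for i by measurable
  qed
  from ennreal_integrable_real[OF this bound M] obtain l where l: "l absolutely_integrable_on {c..d}"
    "\<forall>s. 0 \<le> l s" "integral {c..d} l \<le> M" "AE s in lebesgue. s \<in> {c..d} \<longrightarrow> ?L G s = ennreal (l s)"
    by blast
  have "AE s in lebesgue. s \<in> {c..d} \<longrightarrow> (\<forall>i\<in>J. norm (rep_LC G s (z i) - rep_LC G s (w i)) \<le> l s * k i)"
    using l(4)
  proof eventually_elim
    case (elim s)
    show ?case
    proof (intro impI ballI)
      fix i assume s: "s \<in> {c..d}" and i: "i \<in> J"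
      have "ennreal (norm (rep_LC G s (z i) - rep_LC G s (w i)) / k i) \<le> ?L G s" by (rule SUP_upper[OF i])
      also have "\<dots> = ennreal (l s)" using elim s by blast
      finally have "norm (rep_LC G s (z i) - rep_LC G s (w i)) / k i \<le> l s" using l(2) by simp
      then show "norm (rep_LC G s (z i) - rep_LC G s (w i)) \<le> l s * k i"
        using k[OF i] by (simp add: pos_divide_le_eq)
    qed
  qed
  then show ?thesis using l(1-3) by blast
qed

text \<open>The inequality is a closed condition on pairs. The ball is open, so the dense set
  remains dense in it.\<close>

lemma lipschitz_on_ball_of_dense:
  fixes g :: "'b::euclidean_space \<Rightarrow> 'a::real_normed_vector"
  assumes g: "continuous_on UNIV g" and D: "closure D = UNIV"
    and lip: "\<And>z w. z \<in> D \<inter> ball 0 r \<Longrightarrow> w \<in> D \<inter> ball 0 r \<Longrightarrow> norm (g z - g w) \<le> c * norm (z - w)"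
    and zw: "z \<in> ball 0 r" "w \<in> ball 0 r"
  shows "norm (g z - g w) \<le> c * norm (z - w)"
proof -
  let ?S = "{p. norm (g (fst p) - g (snd p)) \<le> c * norm (fst p - snd p)}"
  have "continuous_on UNIV (\<lambda>p::'b \<times> 'b. g (fst p))" "continuous_on UNIV (\<lambda>p::'b \<times> 'b. g (snd p))"
    by (rule continuous_on_compose2[OF g]; auto intro: continuous_intros)+
  then have cl: "closed ?S"
    by (intro closed_Collect_le continuous_intros)
  have "(D \<inter> ball 0 r) \<times> (D \<inter> ball 0 r) \<subseteq> ?S" using lip by auto
  from closure_minimal[OF this cl] have "closure (D \<inter> ball 0 r) \<times> closure (D \<inter> ball 0 r) \<subseteq> ?S"
    by (simp only: closure_Times)
  moreover have "ball 0 r \<subseteq> closure (D \<inter> ball 0 r)"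
    using open_Int_closure_subset[OF open_ball, of 0 r D] D by (simp add: Int_commute)
  ultimately have "(z, w) \<in> ?S" using zw by blast
  then show ?thesis by simp
qed

subsection \<open>Bounded Lipschitz constants: pointwise mean convergence\<close>

definition point_family :: "'z set \<Rightarrow> (real set \<times> (real \<Rightarrow> 'z) set) set" where
  "point_family D = {(I, {\<lambda>_. z}) | I z. I \<in> rat_intervals \<and> z \<in> D}"

lemma T_D_eq:
  fixes D :: "((real^'n) \<times> (real^'n)) set"
  shows "T_D D = curve_topology (point_family D)"
proof -
  have "{\<lambda>f :: real \<Rightarrow> (real^'n) \<times> (real^'n) \<Rightarrow> real^'n. \<integral>\<^sup>+t\<in>I. ennreal (norm (f t z)) \<partial>lebesgue | I z.
      I \<in> rat_intervals \<and> z \<in> D} = (\<lambda>(I, X). curve_seminorm I X) ` point_family D"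
    unfolding point_family_def by (force simp: curve_seminorm_def[abs_def] image_iff)
  then show ?thesis by (simp only: T_D_def curve_topology_def)
qed

lemma rat_interval_superset: "\<exists>q1\<in>\<rat>. \<exists>q2\<in>\<rat>. q1 \<le> q2 \<and> {a..b::real} \<subseteq> {q1..q2}"
proof (intro bexI conjI)
  show "{a..b} \<subseteq> {real_of_int \<lfloor>min a b\<rfloor>..real_of_int \<lceil>max a b\<rceil>}"
    by (auto; linarith)
  show "real_of_int \<lfloor>min a b\<rfloor> \<le> real_of_int \<lceil>max a b\<rceil>"
    by (rule order_trans[OF of_int_floor_le order_trans[OF _ le_of_int_ceiling]]) simp
qed simp_all

text \<open>This provides the hypothesis \<open>approx\<close> of the closure lemmas: a finite
  intersection of balls is open, and a curve equal to \<open>z\<close> on \<open>{c..d}\<close>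
  makes the seminorm dominate the mean value at \<open>z\<close>.\<close>

lemma curve_topology_approx:
  assumes \<F>: "curve_family \<F>"
    and P: "\<And>z. z \<in> P \<Longrightarrow> \<exists>I X. (I, X) \<in> \<F> \<and> {c..d} \<subseteq> I \<and> (\<exists>x\<in>X. \<forall>s\<in>{c..d}. x s = z)"
    and Z: "finite Z" "Z \<subseteq> P" and e: "e > 0"
  shows "\<exists>V. openin (curve_topology \<F>) V \<and> G \<in> V \<and>
    (\<forall>H\<in>V. \<forall>z\<in>Z. integral {c..d} (\<lambda>s. norm (LC_diff G H s z)) \<le> e)"
proof -
  have ne: "\<F> \<noteq> {}" using \<F> by (simp add: curve_family_def)
  have "\<forall>z\<in>P. \<exists>p. p \<in> \<F> \<and> {c..d} \<subseteq> fst p \<and> (\<exists>x\<in>snd p. \<forall>s\<in>{c..d}. x s = z)"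
    using P by fastforce
  from bchoice[OF this] obtain p where p: "\<forall>z\<in>P. p z \<in> \<F> \<and> {c..d} \<subseteq> fst (p z) \<and> (\<exists>x\<in>snd (p z). \<forall>s\<in>{c..d}. x s = z)"
    by (rule exE)
  let ?B = "\<lambda>z. {H. curve_seminorm (fst (p z)) (snd (p z)) (LC_diff H G) < ennreal e}"
  let ?V = "(\<Inter>z\<in>Z. ?B z) \<inter> topspace (curve_topology \<F>)"
  show ?thesis
  proof (intro exI[of _ ?V] conjI ballI)
    show "openin (curve_topology \<F>) ?V"
      using p Z e by (intro openin_INT openin_curve_ball) auto
    show "G \<in> ?V" using e by (simp add: curve_seminorm_zero topspace_curve_topology[OF ne])
    fix H z assume H: "H \<in> ?V" and z: "z \<in> Z"
    obtain I X where pz: "p z = (I, X)" by (rule prod.exhaust)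
    then have IX: "(I, X) \<in> \<F>" "{c..d} \<subseteq> I" and "\<exists>x\<in>X. \<forall>s\<in>{c..d}. x s = z"
      using p z Z by force+
    then obtain x where x: "x \<in> X" "\<forall>s\<in>{c..d}. x s = z" by blast
    have "(\<exists>a b. I = {a..b}) \<and> (\<exists>r. \<forall>x\<in>X. continuous_on I x \<and> x ` I \<subseteq> cball 0 r)"
      using \<F> IX(1) unfolding curve_family_def by fastforce
    then obtain a b where I: "I = {a..b}" and cx: "continuous_on {a..b} x" using x(1) by blast
    have "curve_seminorm {a..b} X (LC_diff H G) < ennreal e" using H z pz I by auto
    from curve_seminorm_lessD[OF this x(1) cx]
    have "integral {a..b} (\<lambda>s. norm (LC_diff H G s (x s))) < e" .
    moreover have "integral {c..d} (\<lambda>s. norm (LC_diff H G s (x s))) \<le> integral {a..b} (\<lambda>s. norm (LC_diff H G s (x s)))"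
      using IX(2) unfolding I by (intro integral_subset_Icc_nonneg abs_integrable_norm_Icc LC_diff_integrable cx) auto
    moreover have "integral {c..d} (\<lambda>s. norm (LC_diff H G s (x s))) = integral {c..d} (\<lambda>s. norm (LC_diff G H s z))"
      using x(2) by (intro integral_cong) (auto simp: norm_minus_commute)
    ultimately show "integral {c..d} (\<lambda>s. norm (LC_diff G H s z)) \<le> e" by simp
  qed
qed

lemma rat_intervalI: "q1 \<in> \<rat> \<Longrightarrow> q2 \<in> \<rat> \<Longrightarrow> q1 \<le> q2 \<Longrightarrow> {q1..q2} \<in> rat_intervals"
  unfolding rat_intervals_def by blast

lemma rat_intervals_not_empty: "rat_intervals \<noteq> {}"
  using rat_intervalI[OF Rats_0 Rats_0 order_refl] by blast

lemma rat_interval_cover: "\<exists>I\<in>rat_intervals. {a..b} \<subseteq> I"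
  using rat_interval_superset[of a b] rat_intervalI by blast

lemma curve_family_point_family:
  fixes D :: "((real^'n) \<times> (real^'n)) set"
  assumes "D \<noteq> {}"
  shows "curve_family (point_family D)"
  unfolding curve_family_def
proof (intro conjI ballI)
  show "point_family D \<noteq> {}" using assms rat_intervals_not_empty by (auto simp: point_family_def)
  fix p assume "p \<in> point_family D"
  then obtain I z where p: "p = (I, {\<lambda>_. z})" "I \<in> rat_intervals" "z \<in> D" by (auto simp: point_family_def)
  then obtain a b where I: "I = {a..b}" by (auto simp: rat_intervals_def)
  have "\<exists>r. \<forall>x\<in>{\<lambda>_. z}. continuous_on I x \<and> x ` I \<subseteq> cball 0 r"
    by (intro exI[of _ "norm z"]) auto
  then show "case p of (I, X) \<Rightarrow> (\<exists>a b. I = {a..b}) \<and> (\<exists>r. \<forall>x\<in>X. continuous_on I x \<and> x ` I \<subseteq> cball 0 r)"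
    unfolding p prod.case using I by blast
  show "case p of (I, X) \<Rightarrow> \<forall>t0. \<exists>(J, Z)\<in>point_family D. \<forall>t. \<bar>t - t0\<bar> \<le> 1 \<longrightarrow>
      (\<forall>x\<in>X. \<exists>z\<in>Z. \<forall>s\<in>I. s + t \<in> J \<and> z (s + t) = x s)"
    unfolding p prod.case
  proof
    fix t0
    obtain J where J: "J \<in> rat_intervals" "{a + t0 - 1..b + t0 + 1} \<subseteq> J"
      using rat_interval_cover by blast
    have "s + t \<in> J" if "\<bar>t - t0\<bar> \<le> 1" "s \<in> I" for s t
      using that J(2) by (auto simp: I subset_iff abs_le_iff)
    then have "\<forall>t. \<bar>t - t0\<bar> \<le> 1 \<longrightarrow> (\<forall>x\<in>{\<lambda>_. z}. \<exists>y\<in>{\<lambda>_. z}. \<forall>s\<in>I. s + t \<in> J \<and> y (s + t) = x s)" by auto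
    moreover have "(J, {\<lambda>_. z}) \<in> point_family D"
      unfolding point_family_def using J(1) p(3) by blast
    ultimately show "\<exists>(J, Z)\<in>point_family D. \<forall>t. \<bar>t - t0\<bar> \<le> 1 \<longrightarrow>
      (\<forall>x\<in>{\<lambda>_. z}. \<exists>z\<in>Z. \<forall>s\<in>I. s + t \<in> J \<and> z (s + t) = x s)"
      by (intro bexI[of _ "(J, {\<lambda>_. z})"]) simp_all
  qed
qed

lemma dense_nonempty: "closure D = UNIV \<Longrightarrow> D \<noteq> {}"
  by auto

lemma point_family_approx:
  fixes D :: "((real^'n::finite) \<times> (real^'n)) set"
  assumes "closure D = UNIV" "finite Z" "Z \<subseteq> D" "e > 0"
  shows "\<exists>V. openin (curve_topology (point_family D)) V \<and> G \<in> V \<and>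
    (\<forall>H\<in>V. \<forall>z\<in>Z. integral {c..d} (\<lambda>s. norm (LC_diff G H s z)) \<le> e)"
proof (rule curve_topology_approx[OF curve_family_point_family[OF dense_nonempty[OF assms(1)]] _ assms(2-4)])
  fix z assume z: "z \<in> D"
  obtain I where I: "I \<in> rat_intervals" "{c..d} \<subseteq> I" using rat_interval_cover by blast
  then show "\<exists>I X. (I, X) \<in> point_family D \<and> {c..d} \<subseteq> I \<and> (\<exists>x\<in>X. \<forall>s\<in>{c..d}. x s = z)"
    using z by (intro exI[of _ I] exI[of _ "{\<lambda>_. z}"]) (auto simp: point_family_def simp del: split_paired_Ex)
qed

text \<open>Difference quotients over pairs from \<open>D\<close> involve only points that the
  topology controls, so their integral bound passes from the translates to the hull; continuity in
  \<open>z\<close> extends it from \<open>D\<close> to the ball. Hence one \<open>M\<close> serves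
  the whole hull.\<close>

lemma hull_mean_lipschitz:
  fixes D :: "((real^'n::finite) \<times> (real^'n)) set"
  assumes f: "f \<in> LC_fun" and bl: "bounded_l_bounds f" and D: "countable D" "closure D = UNIV" and c: "0 \<le> c"
  shows "\<exists>M\<ge>0. \<forall>G\<in>Hull (curve_topology (point_family D)) (abs_LC f).
    mean_lipschitz 0 c (ball 0 (real j)) M (rep_LC G)"
proof -
  define J where "J = {(z, w). z \<in> D \<inter> ball 0 (real j) \<and> w \<in> D \<inter> ball 0 (real j) \<and> z \<noteq> w}"
  let ?q = "\<lambda>G s i. ennreal (norm (rep_LC G s (fst i) - rep_LC G s (snd i)) / norm (fst i - snd i))"
  have J: "countable J"
    unfolding J_def by (rule countable_subset[of _ "D \<times> D"]) (use D in auto)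
  \<comment> \<open>\<open>c + 1\<close> because the bound is available for positive radii and
    \<open>c\<close> may be 0.\<close>
  define M where "M = (SUP \<tau>. \<integral>\<^sup>+t\<in>{- (c + 1)..c + 1}. l_bound (time_shift \<tau> f) j t \<partial>lebesgue)"
  have "M < \<infinity>"
    unfolding M_def by (rule bl[unfolded bounded_l_bounds_def, rule_format]) (use c in simp)
  then obtain M' where M': "M = ennreal M'" "0 \<le> M'" by (cases M) auto
  have translates: "(\<integral>\<^sup>+s\<in>{0..c}. (SUP i\<in>J. ?q (translate_LC \<tau> (abs_LC f)) s i) \<partial>lebesgue) \<le> M" for \<tau>
  proof -
    have "(\<integral>\<^sup>+s\<in>{0..c}. (SUP i\<in>J. ?q (translate_LC \<tau> (abs_LC f)) s i) \<partial>lebesgue) \<le>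
        (\<integral>\<^sup>+t\<in>{- (c + 1)..c + 1}. l_bound (time_shift \<tau> f) j t \<partial>lebesgue)"
    proof (rule nn_integral_mono_AE)
      show "AE s in lebesgue. (SUP i\<in>J. ?q (translate_LC \<tau> (abs_LC f)) s i) * indicator {0..c} s \<le>
        l_bound (time_shift \<tau> f) j s * indicator {- (c + 1)..c + 1} s"
        using rep_translate_abs_AE[OF f, of \<tau>]
      proof eventually_elim
        case (elim s)
        have "(SUP i\<in>J. ?q (translate_LC \<tau> (abs_LC f)) s i) \<le> l_bound (time_shift \<tau> f) j s"
        proof (rule SUP_least)
          fix i assume "i \<in> J"
          then have "i \<in> {(z1, z2). z1 \<in> cball 0 (real j) \<and> z2 \<in> cball 0 (real j) \<and> z1 \<noteq> z2}" by (auto simp: J_def)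
          then have "(case i of (z1, z2) \<Rightarrow> ennreal (norm (time_shift \<tau> f s z1 - time_shift \<tau> f s z2) / norm (z1 - z2)))
            \<le> l_bound (time_shift \<tau> f) j s"
            unfolding l_bound_def by (rule SUP_upper)
          then show "?q (translate_LC \<tau> (abs_LC f)) s i \<le> l_bound (time_shift \<tau> f) j s"
            using elim by (simp add: case_prod_unfold del: split_paired_All)
        qed
        then show ?case using c by (auto simp: indicator_def)
      qed
    qed
    also have "\<dots> \<le> M" unfolding M_def by (rule SUP_upper) simp
    finally show ?thesis .
  qed
  have "mean_lipschitz 0 c (ball 0 (real j)) M' (rep_LC G)"
    if G: "G \<in> Hull (curve_topology (point_family D)) (abs_LC f)" for G
  proof -
    have "\<exists>l. l absolutely_integrable_on {0..c} \<and> (\<forall>s. 0 \<le> l s) \<and> integral {0..c} l \<le> M' \<and>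
      (AE s in lebesgue. s \<in> {0..c} \<longrightarrow> (\<forall>i\<in>J. norm (rep_LC G s (fst i) - rep_LC G s (snd i)) \<le> l s * norm (fst i - snd i)))"
    proof (rule closure_lipschitz_bound[OF J _ _ _ point_family_approx[OF D(2)] G[unfolded Hull_def] M'(2)])
      show "fst ` J \<subseteq> D" "snd ` J \<subseteq> D" by (auto simp: J_def)
    qed (use translates in \<open>auto simp: J_def M'(1)\<close>)
    then obtain l where l: "l absolutely_integrable_on {0..c}" "\<forall>s. 0 \<le> l s" "integral {0..c} l \<le> M'"
      "AE s in lebesgue. s \<in> {0..c} \<longrightarrow> (\<forall>i\<in>J. norm (rep_LC G s (fst i) - rep_LC G s (snd i)) \<le> l s * norm (fst i - snd i))"
      by blast
    have "AE s in lebesgue. s \<in> {0..c} \<longrightarrow>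
      (\<forall>z\<in>ball 0 (real j). \<forall>w\<in>ball 0 (real j). norm (rep_LC G s z - rep_LC G s w) \<le> l s * norm (z - w))"
      using l(4) LC_fun_AE_continuous[OF rep_LC_LC_fun[of G]]
    proof eventually_elim
      case (elim s)
      show ?case
      proof (intro impI ballI)
        fix z' w' :: "(real^'n) \<times> (real^'n)"
        assume s: "s \<in> {0..c}" and "z' \<in> ball 0 (real j)" "w' \<in> ball 0 (real j)"
        then show "norm (rep_LC G s z' - rep_LC G s w') \<le> l s * norm (z' - w')"
        proof (rule_tac lipschitz_on_ball_of_dense[OF elim(2) D(2)])
          fix z w assume zw: "z \<in> D \<inter> ball 0 (real j)" "w \<in> D \<inter> ball 0 (real j)"
          show "norm (rep_LC G s z - rep_LC G s w) \<le> l s * norm (z - w)"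
          proof (cases "z = w")
            case False
            then have "(z, w) \<in> J" using zw by (auto simp: J_def)
            with elim(1) s show ?thesis by fastforce
          qed simp
        qed
      qed
    qed
    then show ?thesis using l(1-3) unfolding mean_lipschitz_def by blast
  qed
  then show ?thesis using M'(2) by blast
qed

text \<open>The pair \<open>(y, v)\<close> is one curve in the ball of radius
  \<open>2 * real R\<close>, and the hull is Lipschitz in mean in both arguments jointly; so
  closeness at finitely many points of \<open>D\<close> suffices for all such curves.\<close>

lemma mean_continuous_point_topology:
  fixes D :: "((real^'n::finite) \<times> (real^'n)) set"
  assumes f: "f \<in> LC_fun" and bl: "bounded_l_bounds f" and D: "countable D" "closure D = UNIV"
  shows "mean_continuous_along_solutions (curve_topology (point_family D)) (Hull (curve_topology (point_family D)) (abs_LC f))"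
    (is "mean_continuous_along_solutions ?T ?H")
  unfolding mean_continuous_along_solutions_def
proof (intro ballI allI impI)
  fix G0 and R :: nat and c e :: real
  assume G0: "G0 \<in> ?H" and c: "0 \<le> c" and e: "0 < e"
  let ?r = "2 * real R"
  have r1: "real (2 * R + 1) = ?r + 1" by simp
  obtain M where M: "M \<ge> 0" and lip: "\<forall>G\<in>?H. mean_lipschitz 0 c (ball 0 (?r + 1)) M (rep_LC G)"
    using hull_mean_lipschitz[OF assms c, of "2 * R + 1"] unfolding r1 by blast
  obtain F \<epsilon> where F: "finite F" "F \<subseteq> D \<inter> ball 0 (?r + 1)" and \<epsilon>: "0 < \<epsilon>" and
    test: "\<forall>(g :: real \<Rightarrow> (real^'n) \<times> (real^'n) \<Rightarrow> real^'n) h x. (\<forall>s\<in>{0..c}. x s \<in> cball 0 ?r) \<and>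
       mean_lipschitz 0 c (ball 0 (?r + 1)) M g \<and> mean_lipschitz 0 c (ball 0 (?r + 1)) M h \<and>
       (\<forall>u. (\<lambda>s. g s u - h s u) absolutely_integrable_on {0..c}) \<and>
       (\<lambda>s. g s (x s) - h s (x s)) absolutely_integrable_on {0..c} \<and>
       (\<forall>u\<in>F. integral {0..c} (\<lambda>s. norm (g s u - h s u)) \<le> \<epsilon>) \<longrightarrow>
       integral {0..c} (\<lambda>s. norm (g s (x s) - h s (x s))) \<le> e"
    using finite_test_points[OF D(2) M e, of ?r 0 c] by (elim exE conjE) (rule that)
  have "F \<subseteq> D" using F by blast
  then obtain V where V: "openin ?T V" "G0 \<in> V"
    and close: "\<forall>H\<in>V. \<forall>z\<in>F. integral {0..c} (\<lambda>s. norm (LC_diff G0 H s z)) \<le> \<epsilon>"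
    using point_family_approx[OF D(2) F(1) _ \<epsilon>, of G0 0 c] by blast
  show "\<exists>V. openin ?T V \<and> G0 \<in> V \<and> (\<forall>G\<in>V \<inter> ?H. \<forall>y v. continuous_on {0..c} y \<and> continuous_on {0..c} v \<and>
       (\<forall>t\<in>{0..c}. norm (y t) \<le> real R \<and> norm (v t) \<le> real R) \<and>
       (\<forall>s t. 0 \<le> s \<and> s \<le> t \<and> t \<le> c \<longrightarrow>
          norm (y t - y s) \<le> integral {s..t} (\<lambda>r. norm (rep_LC G r (y r, v r)))) \<longrightarrow>
       integral {0..c} (\<lambda>r. norm (rep_LC G r (y r, v r) - rep_LC G0 r (y r, v r))) \<le> e)"
  proof (intro exI[of _ V] conjI ballI allI impI V)
    fix G and y v :: "real \<Rightarrow> real^'n"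
    assume G: "G \<in> V \<inter> ?H" and yv: "continuous_on {0..c} y \<and> continuous_on {0..c} v \<and>
       (\<forall>t\<in>{0..c}. norm (y t) \<le> real R \<and> norm (v t) \<le> real R) \<and>
       (\<forall>s t. 0 \<le> s \<and> s \<le> t \<and> t \<le> c \<longrightarrow>
          norm (y t - y s) \<le> integral {s..t} (\<lambda>r. norm (rep_LC G r (y r, v r))))"
    show "integral {0..c} (\<lambda>r. norm (rep_LC G r (y r, v r) - rep_LC G0 r (y r, v r))) \<le> e"
    proof (rule test[THEN spec[of _ "rep_LC G"], THEN spec[of _ "rep_LC G0"], THEN spec[of _ "\<lambda>s. (y s, v s)"], THEN mp],
        intro conjI allI ballI)
      show "(\<lambda>s. LC_diff G G0 s u) absolutely_integrable_on {0..c}" for u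
        by (rule LC_diff_integrable_const)
      show "(y s, v s) \<in> cball 0 ?r" if "s \<in> {0..c}" for s
      proof -
        have "norm (y s, v s) \<le> norm (y s) + norm (v s)" by (rule norm_Pair_le)
        also have "\<dots> \<le> real R + real R" using yv that by (intro add_mono) auto
        finally show ?thesis by simp
      qed
      show "(\<lambda>s. LC_diff G G0 s (y s, v s)) absolutely_integrable_on {0..c}"
        using yv by (intro LC_diff_integrable continuous_on_Pair) auto
      show "integral {0..c} (\<lambda>s. norm (LC_diff G G0 s z)) \<le> \<epsilon>" if "z \<in> F" for z
      proof -
        have "(\<lambda>r. norm (LC_diff G G0 r z)) = (\<lambda>r. norm (LC_diff G0 G r z))"
          by (rule ext) (rule norm_minus_commute)
        then show ?thesis using close that G by simp
      qed
    qed (use lip G G0 in blast)+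
  qed
qed

subsection \<open>Moduli of continuity from the m-bounds\<close>

lemma ennreal_norm_le_closure:
  fixes g :: "'b::topological_space \<Rightarrow> 'a::real_normed_vector"
  assumes "continuous_on UNIV g" "\<And>z. z \<in> Q \<Longrightarrow> ennreal (norm (g z)) \<le> C" "z \<in> closure Q"
  shows "ennreal (norm (g z)) \<le> C"
proof -
  have "closed {z. ennreal (norm (g z)) \<le> C}"
    by (intro closed_Collect_le continuous_on_ennreal continuous_on_norm assms(1) continuous_on_const)
  then have "closure Q \<subseteq> {z. ennreal (norm (g z)) \<le> C}"
    using assms(2) by (intro closure_minimal) auto
  then show ?thesis using assms(3) by blast
qed

text \<open>The supremum in \<open>m_bound\<close> is uncountable. Off a null set of
  \<open>t\<close> continuity reduces it to a countable dense subset of the ball, which gives the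
  measurability that additivity and substitution in the integral require.\<close>

lemma m_bound_AE_measurable:
  assumes f: "f \<in> LC_fun"
  shows "\<exists>h\<in>borel_measurable borel. AE t in lebesgue. m_bound f j t = h t"
proof -
  obtain Q :: "((real^'a) \<times> (real^'a)) set"
    where Q: "countable Q" "Q \<subseteq> cball 0 (real j)" "cball 0 (real j) \<subseteq> closure Q"
    by (rule separable)
  let ?h = "\<lambda>t. SUP z\<in>Q. ennreal (norm (f t z))"
  have "?h \<in> borel_measurable borel"
  proof (rule borel_measurable_SUP[OF Q(1)])
    fix z
    have [measurable]: "(\<lambda>t. f t z) \<in> borel_measurable borel"
      using LC_fun_slice_measurable[OF f, of "\<lambda>_. z"] by simp
    show "(\<lambda>t. ennreal (norm (f t z))) \<in> borel_measurable borel" by measurable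
  qed
  moreover have "AE t in lebesgue. m_bound f j t = ?h t"
    using LC_fun_AE_continuous[OF f]
  proof eventually_elim
    case (elim t)
    show ?case
    proof (rule antisym)
      show "m_bound f j t \<le> ?h t"
        unfolding m_bound_def
      proof (rule SUP_least)
        fix z :: "(real^'a) \<times> (real^'a)" assume "z \<in> cball 0 (real j)"
        then have "z \<in> closure Q" using Q(3) by blast
        then show "ennreal (norm (f t z)) \<le> ?h t"
          by (rule ennreal_norm_le_closure[OF elim, rotated]) (rule SUP_upper)
      qed
      show "?h t \<le> m_bound f j t"
        unfolding m_bound_def using Q(2) by (intro SUP_subset_mono) auto
    qed
  qed
  ultimately show ?thesis by (intro bexI[of _ ?h])
qed

lemma nn_integral_m_bound_shift:
  assumes f: "f \<in> LC_fun"
  shows "(\<integral>\<^sup>+u\<in>{s..t}. m_bound (time_shift \<tau> f) j u \<partial>lebesgue) = (\<integral>\<^sup>+u\<in>{s + \<tau>..t + \<tau>}. m_bound f j u \<partial>lebesgue)"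
proof -
  obtain h where [measurable]: "h \<in> borel_measurable borel" and h: "AE t in lebesgue. m_bound f j t = h t"
    using m_bound_AE_measurable[OF f] by blast
  have "(\<integral>\<^sup>+u\<in>{s..t}. m_bound (time_shift \<tau> f) j u \<partial>lebesgue) = (\<integral>\<^sup>+u. h (\<tau> + 1 * u) * indicator {s + \<tau>..t + \<tau>} (\<tau> + 1 * u) \<partial>lebesgue)"
    using AE_lebesgue_shift[OF h, of \<tau>]
    by (intro nn_integral_cong_AE) (auto elim!: eventually_mono simp: m_bound_def time_shift_def indicator_def add.commute)
  also have "\<dots> = (\<integral>\<^sup>+u. h u * indicator {s + \<tau>..t + \<tau>} u \<partial>lborel)"
    using nn_integral_real_affine[of "\<lambda>u. h u * indicator {s + \<tau>..t + \<tau>} u" 1 \<tau>]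
    by (simp add: nn_integral_completion)
  also have "\<dots> = (\<integral>\<^sup>+u\<in>{s + \<tau>..t + \<tau>}. h u \<partial>lebesgue)"
    by (simp add: nn_integral_completion)
  also have "\<dots> = (\<integral>\<^sup>+u\<in>{s + \<tau>..t + \<tau>}. m_bound f j u \<partial>lebesgue)"
    using h by (intro nn_integral_cong_AE) (auto elim!: eventually_mono)
  finally show ?thesis .
qed

text \<open>The supremum in \<open>m_moduli\<close> before its conversion to a real number, which
  would send an infinite value to 0; finiteness is proved on this level.\<close>

definition m_sup :: "(real \<Rightarrow> (real^'n) \<times> (real^'n) \<Rightarrow> real^'n) \<Rightarrow> nat \<Rightarrow> real \<Rightarrow> ennreal" where
  "m_sup f j s = (SUP t. \<integral>\<^sup>+u\<in>{t..t + s}. m_bound f j u \<partial>lebesgue)"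

lemma m_moduli_eq: "m_moduli f I j s = enn2real (m_sup f j s)"
  by (simp add: m_moduli_def m_sup_def)

lemma m_sup_mono: "s \<le> s' \<Longrightarrow> m_sup f j s \<le> m_sup f j s'"
  unfolding m_sup_def by (intro SUP_mono bexI nn_integral_mono mult_left_mono) (auto simp: indicator_def)

lemma m_sup_mono_ball: "i \<le> j \<Longrightarrow> m_sup f i s \<le> m_sup f j s"
  unfolding m_sup_def m_bound_def
  by (intro SUP_mono bexI nn_integral_mono mult_right_mono SUP_subset_mono) auto

text \<open>Each interval \<open>{t..t + (s + r)}\<close> is cut at \<open>t + s\<close>. Finiteness
  for all \<open>s\<close> and continuity of the moduli both follow from this subadditivity and
  smallness near 0.\<close>

lemma m_sup_add:
  assumes f: "f \<in> LC_fun" and "0 \<le> s" "0 \<le> r"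
  shows "m_sup f j (s + r) \<le> m_sup f j s + m_sup f j r"
  unfolding m_sup_def[of f j "s + r"]
proof (rule SUP_least)
  fix t
  obtain h where h[measurable]: "h \<in> borel_measurable borel" and hm: "AE t in lebesgue. m_bound f j t = h t"
    using m_bound_AE_measurable[OF f] by blast
  have hl: "h \<in> borel_measurable lebesgue" by (intro measurable_completion) simp
  have hI: "(\<integral>\<^sup>+u\<in>I. m_bound f j u \<partial>lebesgue) = (\<integral>\<^sup>+u\<in>I. h u \<partial>lebesgue)" for I
    using hm by (intro nn_integral_cong_AE) (auto elim!: eventually_mono)
  have "(\<integral>\<^sup>+u\<in>{t..t + (s + r)}. h u \<partial>lebesgue) \<le>
      (\<integral>\<^sup>+u. h u * indicator {t..t + s} u + h u * indicator {t + s..t + s + r} u \<partial>lebesgue)"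
    by (intro nn_integral_mono) (auto simp: indicator_def)
  also have "\<dots> = (\<integral>\<^sup>+u\<in>{t..t + s}. h u \<partial>lebesgue) + (\<integral>\<^sup>+u\<in>{t + s..t + s + r}. h u \<partial>lebesgue)"
    by (intro nn_integral_add borel_measurable_times_ennreal borel_measurable_indicator hl) auto
  also have "\<dots> \<le> m_sup f j s + m_sup f j r"
    unfolding m_sup_def hI[symmetric] by (intro add_mono SUP_upper) auto
  finally show "(\<integral>\<^sup>+u\<in>{t..t + (s + r)}. m_bound f j u \<partial>lebesgue) \<le> m_sup f j s + m_sup f j r"
    by (simp add: hI)
qed

definition theta_family :: "(real \<Rightarrow> (real^'n) \<times> (real^'n) \<Rightarrow> real^'n) \<Rightarrow> (real^'n) set \<Rightarrow>
    (real set \<times> (real \<Rightarrow> (real^'n) \<times> (real^'n)) set) set" where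
  "theta_family f D' = {(I, (\<lambda>x t. (x t, u)) ` moduli_set (m_moduli f) I j) | I j u. I \<in> rat_intervals \<and> u \<in> D'}"

lemma theta_familyI:
  "I \<in> rat_intervals \<Longrightarrow> u \<in> D' \<Longrightarrow> (I, (\<lambda>x t. (x t, u)) ` moduli_set (m_moduli f) I j) \<in> theta_family f D'"
  unfolding theta_family_def by blast

lemma T_Theta_eq: "T_Theta (m_moduli f) D' = curve_topology (theta_family f D')"
proof -
  have eq: "(\<lambda>g :: real \<Rightarrow> (real^'n) \<times> (real^'n) \<Rightarrow> real^'n. SUP x\<in>moduli_set (m_moduli f) I j.
      \<integral>\<^sup>+t\<in>I. ennreal (norm (g t (x t, u))) \<partial>lebesgue) =
    curve_seminorm I ((\<lambda>x t. (x t, u)) ` moduli_set (m_moduli f) I j)" for I j u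
    by (simp add: curve_seminorm_def[abs_def] image_image)
  show ?thesis
    unfolding T_Theta_def curve_topology_def eq
    by (rule arg_cong[of _ _ seminorm_topology]) (auto simp: theta_family_def image_iff)
qed

context
  fixes f :: "real \<Rightarrow> (real^'n) \<times> (real^'n) \<Rightarrow> real^'n"
  assumes f: "f \<in> LC_fun" and em: "equicontinuous_m_bounds f"
begin

text \<open>A supremum over starting points is a supremum over translates on the fixed interval
  \<open>{0..s}\<close>, to which equicontinuity with \<open>r = 1\<close> applies.\<close>

lemma m_sup_small:
  assumes "e > 0"
  shows "\<exists>d>0. \<forall>s. 0 \<le> s \<and> s < d \<longrightarrow> m_sup f j s \<le> ennreal e"
proof -
  obtain d where d: "d > 0" and *: "\<forall>s t. - 1 \<le> s \<and> s \<le> t \<and> t \<le> 1 \<and> t - s < d \<longrightarrow>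
      (SUP \<tau>. \<integral>\<^sup>+u\<in>{s..t}. m_bound (time_shift \<tau> f) j u \<partial>lebesgue) < ennreal e"
    using em[unfolded equicontinuous_m_bounds_def, rule_format, of 1 e j] assms by auto
  show ?thesis
  proof (intro exI[of _ "min d 1"] conjI allI impI)
    fix s :: real assume s: "0 \<le> s \<and> s < min d 1"
    have "m_sup f j s = (SUP \<tau>. \<integral>\<^sup>+u\<in>{0..s}. m_bound (time_shift \<tau> f) j u \<partial>lebesgue)"
      by (simp add: m_sup_def nn_integral_m_bound_shift[OF f] add.commute)
    also have "\<dots> < ennreal e" using s by (intro *[rule_format]) auto
    finally show "m_sup f j s \<le> ennreal e" by simp
  qed (use d in auto)
qed

text \<open>Finitely many steps of length \<open>d / 2\<close>, each with finite supremum, reach any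
  \<open>s\<close>.\<close>

lemma m_sup_finite: "m_sup f j s < \<infinity>"
proof -
  obtain d where d: "d > 0" "\<forall>s. 0 \<le> s \<and> s < d \<longrightarrow> m_sup f j s \<le> ennreal 1"
    using m_sup_small[of 1 j] by auto
  have fin: "m_sup f j (real n * (d / 2)) < \<infinity>" for n
  proof (induction n)
    case 0
    show ?case using d by (auto intro: order.strict_trans1)
  next
    case (Suc n)
    have "m_sup f j (real n * (d / 2) + d / 2) \<le> m_sup f j (real n * (d / 2)) + m_sup f j (d / 2)"
      using d by (intro m_sup_add f) auto
    also have "m_sup f j (d / 2) \<le> ennreal 1" using d by auto
    also have "m_sup f j (real n * (d / 2)) + ennreal 1 < \<infinity>" using Suc by (simp add: less_top)
    finally have "m_sup f j (real n * (d / 2) + d / 2) < \<infinity>" by simp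
    moreover have "real (Suc n) * (d / 2) = real n * (d / 2) + d / 2" by (simp add: field_simps)
    ultimately show ?case by (simp only:)
  qed
  obtain n :: nat where "s / (d / 2) \<le> real n" using real_arch_simple by blast
  then have "s \<le> real n * (d / 2)" using d by (simp add: pos_divide_le_eq)
  then show ?thesis using m_sup_mono fin order.strict_trans1 by blast
qed

lemma ennreal_m_moduli: "ennreal (m_moduli f I j s) = m_sup f j s"
  using m_sup_finite[of j s] by (simp add: m_moduli_eq)

lemma m_moduli_mono: "s \<le> s' \<Longrightarrow> m_moduli f I j s \<le> m_moduli f J j s'"
  unfolding m_moduli_eq using m_sup_finite by (intro enn2real_mono m_sup_mono) auto

lemma m_moduli_nonneg: "0 \<le> m_moduli f I j s"
  by (simp add: m_moduli_eq)

lemma m_moduli_add: "0 \<le> s \<Longrightarrow> 0 \<le> r \<Longrightarrow> m_moduli f I j (s + r) \<le> m_moduli f I j s + m_moduli f I j r"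
proof -
  assume "0 \<le> s" "0 \<le> r"
  then have "ennreal (m_moduli f I j (s + r)) \<le> ennreal (m_moduli f I j s + m_moduli f I j r)"
    using m_sup_add[OF f] by (simp add: ennreal_m_moduli ennreal_plus m_moduli_nonneg)
  then show ?thesis by (simp add: m_moduli_nonneg del: ennreal_plus)
qed

lemma m_moduli_small:
  assumes "e > 0"
  shows "\<exists>d>0. \<forall>s. 0 \<le> s \<and> s < d \<longrightarrow> m_moduli f I j s \<le> e"
proof -
  obtain d where "d > 0" "\<forall>s. 0 \<le> s \<and> s < d \<longrightarrow> m_sup f j s \<le> ennreal e"
    using m_sup_small[OF assms] by blast
  then show ?thesis
    using assms by (intro exI[of _ d]) (auto simp: ennreal_m_moduli[of I, symmetric])
qed

text \<open>By subadditivity and monotonicity the increment of a modulus from \<open>a\<close> to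
  \<open>b\<close> is at most its value at \<open>b - a\<close>, so smallness near 0 gives
  continuity everywhere.\<close>

lemma suitable_m_moduli: "suitable_moduli (m_moduli f)"
  unfolding suitable_moduli_def
proof (intro conjI ballI allI impI)
  fix I j
  show "m_moduli f I j \<in> {0..} \<rightarrow> {0..}" using m_moduli_nonneg by auto
  show "mono_on {0..} (m_moduli f I j)" by (intro mono_onI m_moduli_mono)
  show "continuous_on {0..} (m_moduli f I j)"
    unfolding continuous_on_iff
  proof (intro ballI allI impI)
    fix s e :: real assume s: "s \<in> {0..}" and e: "0 < e"
    obtain d where d: "d > 0" "\<forall>s. 0 \<le> s \<and> s < d \<longrightarrow> m_moduli f I j s \<le> e / 2"
      using m_moduli_small[of "e / 2" I j] e by auto
    have *: "\<bar>m_moduli f I j b - m_moduli f I j a\<bar> \<le> e / 2" if "0 \<le> a" "a \<le> b" "b - a < d" for a b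
      using m_moduli_add[of a "b - a" I j] m_moduli_mono[of a b I j I] d(2)[rule_format, of "b - a"] that by simp
    show "\<exists>d>0. \<forall>s'\<in>{0..}. dist s' s < d \<longrightarrow> dist (m_moduli f I j s') (m_moduli f I j s) < e"
    proof (intro exI[of _ d] conjI ballI impI d(1))
      fix s' assume s': "s' \<in> {0..}" "dist s' s < d"
      have "\<bar>m_moduli f I j s' - m_moduli f I j s\<bar> \<le> e / 2"
        using *[of s s'] *[of s' s] s s' by (cases "s \<le> s'") (auto simp: dist_real_def abs_minus_commute)
      then show "dist (m_moduli f I j s') (m_moduli f I j s) < e" using e by (simp add: dist_real_def)
    qed
  qed
  show "m_moduli f I j 0 = 0"
  proof (rule antisym[OF field_le_epsilon m_moduli_nonneg])
    fix e :: real assume "0 < e"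
    then show "m_moduli f I j 0 \<le> 0 + e" using m_moduli_small[of e I j] by auto
  qed
next
  fix I1 I2 :: "real set" and j1 j2 :: nat and s :: real
  assume "I1 \<subseteq> I2 \<and> j1 \<le> j2" "0 \<le> s"
  then show "m_moduli f I1 j1 s \<le> m_moduli f I2 j2 s"
    unfolding m_moduli_eq using m_sup_finite by (intro enn2real_mono m_sup_mono_ball) auto
qed

text \<open>Clamping the time extends a curve by constants, and \<open>p\<close> shifts it. The
  clamp is non-decreasing and does not increase distances, while the moduli are non-decreasing and
  independent of the interval; so any \<open>J\<close> may replace \<open>I\<close>.\<close>

lemma clamped_in_moduli_set:
  assumes x: "continuous_on {a..b} x" "a \<le> b" and j: "\<And>t. t \<in> {a..b} \<Longrightarrow> norm (x t) \<le> real j"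
    and mod: "\<And>s t. a \<le> s \<Longrightarrow> s \<le> t \<Longrightarrow> t \<le> b \<Longrightarrow> norm (x t - x s) \<le> m_moduli f I j (t - s)"
  shows "(\<lambda>r. x (max a (min b (r - p)))) \<in> moduli_set (m_moduli f) J j"
proof -
  let ?k = "\<lambda>r. max a (min b (r - p))"
  have k: "?k r \<in> {a..b}" for r using x(2) by auto
  have ordered: "norm (x (?k t) - x (?k s)) \<le> m_moduli f J j \<bar>t - s\<bar>" if "s \<le> t" for s t
  proof -
    have "norm (x (?k t) - x (?k s)) \<le> m_moduli f I j (?k t - ?k s)"
      using k[of s] k[of t] that by (intro mod) auto
    also have "\<dots> \<le> m_moduli f J j \<bar>t - s\<bar>"
      using that by (intro m_moduli_mono) (auto simp: max_def min_def)
    finally show ?thesis .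
  qed
  have "norm (x (?k t) - x (?k s)) \<le> m_moduli f J j \<bar>t - s\<bar>" for s t
    using ordered[of s t] ordered[of t s]
    by (cases "s \<le> t") (auto simp: norm_minus_commute abs_minus_commute)
  moreover have "continuous_on J (\<lambda>r. x (?k r))"
    by (rule continuous_on_compose2[OF x(1)]) (use k in \<open>auto intro!: continuous_intros\<close>)
  ultimately show ?thesis
    using j[OF k] by (auto simp: moduli_set_def)
qed

text \<open>For the translation clause, shifted curves are extended by constants to a rational
  interval \<open>J\<close> that contains all translates of \<open>I\<close> in question;
  \<open>clamped_in_moduli_set\<close> keeps their moduli.\<close>

lemma curve_family_theta_family:
  assumes "D' \<noteq> {}"
  shows "curve_family (theta_family f D')"
  unfolding curve_family_def
proof (intro conjI ballI)
  show "theta_family f D' \<noteq> {}" using assms rat_intervals_not_empty by (auto simp: theta_family_def)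
  fix p assume "p \<in> theta_family f D'"
  then obtain I j u where p: "p = (I, (\<lambda>x t. (x t, u)) ` moduli_set (m_moduli f) I j)" "I \<in> rat_intervals" "u \<in> D'"
    unfolding theta_family_def by blast
  then obtain a b where I: "I = {a..b}" "a \<le> b" by (auto simp: rat_intervals_def)
  have "continuous_on I z \<and> z ` I \<subseteq> cball 0 (real j + norm u)"
    if zX: "z \<in> (\<lambda>x t. (x t, u)) ` moduli_set (m_moduli f) I j" for z
  proof -
    obtain x where z: "z = (\<lambda>t. (x t, u))" and x: "x \<in> moduli_set (m_moduli f) I j" using zX by blast
    have "norm (x t, u) \<le> real j + norm u" if "t \<in> I" for t
      using x that norm_Pair_le[of "x t" u] by (force simp: moduli_set_def)
    moreover have "continuous_on I z" using x unfolding z moduli_set_def by (auto intro: continuous_intros)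
    ultimately show ?thesis by (auto simp: z)
  qed
  then show "case p of (I, X) \<Rightarrow> (\<exists>a b. I = {a..b}) \<and> (\<exists>r. \<forall>x\<in>X. continuous_on I x \<and> x ` I \<subseteq> cball 0 r)"
    unfolding p prod.case using I by blast
  show "case p of (I, X) \<Rightarrow> \<forall>t0. \<exists>(J, Z)\<in>theta_family f D'. \<forall>t. \<bar>t - t0\<bar> \<le> 1 \<longrightarrow>
      (\<forall>x\<in>X. \<exists>z\<in>Z. \<forall>s\<in>I. s + t \<in> J \<and> z (s + t) = x s)"
    unfolding p prod.case
  proof
    fix t0
    obtain J where J: "J \<in> rat_intervals" "{a + t0 - 1..b + t0 + 1} \<subseteq> J"
      using rat_interval_cover by blast
    let ?Z = "(\<lambda>x t. (x t, u)) ` moduli_set (m_moduli f) J j"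
    have "\<exists>z\<in>?Z. \<forall>s\<in>I. s + t \<in> J \<and> z (s + t) = w s"
      if t: "\<bar>t - t0\<bar> \<le> 1" and w: "w \<in> (\<lambda>x t. (x t, u)) ` moduli_set (m_moduli f) I j" for t w
    proof -
      obtain x where wx: "w = (\<lambda>t. (x t, u))" and x: "x \<in> moduli_set (m_moduli f) I j" using w by blast
      let ?y = "\<lambda>r. x (max a (min b (r - t)))"
      have "?y \<in> moduli_set (m_moduli f) J j"
      proof (rule clamped_in_moduli_set[OF _ I(2)])
        show "norm (x t - x s) \<le> m_moduli f I j (t - s)" if "a \<le> s" "s \<le> t" "t \<le> b" for s t
        proof -
          have "t \<in> I" "s \<in> I" using that by (auto simp: I)
          then have "norm (x t - x s) \<le> m_moduli f I j \<bar>t - s\<bar>"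
            using x unfolding moduli_set_def by blast
          then show ?thesis using that by simp
        qed
        show "continuous_on {a..b} x" using x unfolding moduli_set_def I by blast
        show "norm (x t) \<le> real j" if "t \<in> {a..b}" for t
        proof -
          have "x t \<in> cball 0 (real j)" using x that unfolding moduli_set_def I by blast
          then show ?thesis by simp
        qed
      qed
      moreover have "s + t \<in> J \<and> (?y (s + t), u) = w s" if "s \<in> I" for s
        using that t J(2) by (auto simp: I subset_iff abs_le_iff wx max_def min_def)
      ultimately show ?thesis by (intro bexI[of _ "\<lambda>t. (?y t, u)"]) auto
    qed
    moreover have "(J, ?Z) \<in> theta_family f D'" using J(1) p(3) by (rule theta_familyI)
    ultimately show "\<exists>(J, Z)\<in>theta_family f D'. \<forall>t. \<bar>t - t0\<bar> \<le> 1 \<longrightarrow>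
      (\<forall>x\<in>(\<lambda>x t. (x t, u)) ` moduli_set (m_moduli f) I j. \<exists>z\<in>Z. \<forall>s\<in>I. s + t \<in> J \<and> z (s + t) = x s)"
      by (intro bexI[of _ "(J, ?Z)"]) (unfold prod.case, blast)
  qed
qed

end

section \<open>Hull bounds and mean continuity for the topology of the m-bounds\<close>

context
  fixes f :: "real \<Rightarrow> (real^'n::finite) \<times> (real^'n) \<Rightarrow> real^'n" and D' :: "(real^'n) set"
  assumes f: "f \<in> LC_fun" and em: "equicontinuous_m_bounds f"
    and D': "countable D'" "closure D' = UNIV"
begin

text \<open>Constant curves satisfy every modulus of continuity. The seminorms therefore control the
  mean value at \<open>(x, u)\<close> for arbitrary \<open>x\<close>, with \<open>u\<close> in
  \<open>D'\<close>.\<close>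

lemma theta_family_approx:
  assumes Z: "finite Z" "Z \<subseteq> UNIV \<times> D'" "e > 0"
  shows "\<exists>V. openin (curve_topology (theta_family f D')) V \<and> G \<in> V \<and>
    (\<forall>H\<in>V. \<forall>z\<in>Z. integral {c..d} (\<lambda>s. norm (LC_diff G H s z)) \<le> e)"
proof (rule curve_topology_approx[OF curve_family_theta_family[OF f em dense_nonempty[OF D'(2)]] _ Z])
  fix z :: "(real^'n) \<times> (real^'n)" assume z: "z \<in> UNIV \<times> D'"
  obtain I where I: "I \<in> rat_intervals" "{c..d} \<subseteq> I" using rat_interval_cover by blast
  obtain j :: nat where "norm (fst z) \<le> real j" using real_arch_simple by blast
  then have "(\<lambda>_. fst z) \<in> moduli_set (m_moduli f) I j"
    using m_moduli_nonneg[OF f em] by (auto simp: moduli_set_def)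
  then have z_in: "(\<lambda>_. z) \<in> (\<lambda>x t. (x t, snd z)) ` moduli_set (m_moduli f) I j"
    by (intro image_eqI[of _ _ "\<lambda>_. fst z"]) auto
  have fam: "(I, (\<lambda>x t. (x t, snd z)) ` moduli_set (m_moduli f) I j) \<in> theta_family f D'"
    by (rule theta_familyI[OF I(1)]) (use z in auto)
  show "\<exists>I X. (I, X) \<in> theta_family f D' \<and> {c..d} \<subseteq> I \<and> (\<exists>x\<in>X. \<forall>s\<in>{c..d}. x s = z)"
  proof (intro exI conjI)
    show "\<exists>x\<in>(\<lambda>x t. (x t, snd z)) ` moduli_set (m_moduli f) I j. \<forall>s\<in>{c..d}. x s = z"
      by (rule bexI[OF _ z_in]) simp
  qed (use fam I(2) in auto)
qed

lemma dense_first_components: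
  obtains X :: "(real^'n) set" where "countable X" "closure X = UNIV"
proof -
  obtain X :: "(real^'n) set" where "countable X" "X \<subseteq> UNIV" "UNIV \<subseteq> closure X"
    by (rule separable)
  then show ?thesis using that by blast
qed

text \<open>The m-bounds of the translates of \<open>f\<close> have integral over
  \<open>{s..t}\<close> at most the modulus at \<open>t - s\<close>, and this passes to the hull. It
  is what places the clipped solution of any \<open>G\<close> in the hull into
  \<open>moduli_set\<close>.\<close>

lemma hull_m_bound:
  assumes G: "G \<in> Hull (curve_topology (theta_family f D')) (abs_LC f)"
    and yv: "continuous_on {s..t} y" "continuous_on {s..t} v" and st: "s \<le> t"
    and R: "\<And>r. r \<in> {s..t} \<Longrightarrow> norm (y r) \<le> real R \<and> norm (v r) \<le> real R"
  shows "integral {s..t} (\<lambda>r. norm (rep_LC G r (y r, v r))) \<le> m_moduli f I (2 * R + 1) (t - s)"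
proof -
  let ?j = "2 * R + 1"
  obtain X :: "(real^'n) set" where X: "countable X" "closure X = UNIV" by (rule dense_first_components)
  \<comment> \<open>\<open>theta_family_approx\<close> controls points with second component in
    \<open>D'\<close>; the auxiliary dense \<open>X\<close> keeps the first components countable.
    The radius \<open>2 * R + 1\<close> strictly exceeds \<open>norm (y r, v r)\<close>, so density
    in the open ball reaches the curve.\<close>
  define Q where "Q = (X \<times> D') \<inter> ball 0 (real ?j)"
  have Q: "countable Q" unfolding Q_def using X D' by (intro countable_Int1 countable_SIGMA) auto
  have "ball 0 (real ?j) \<subseteq> closure Q"
    unfolding Q_def using open_Int_closure_subset[OF open_ball, of 0 "real ?j" "X \<times> D'"]
    by (simp add: closure_Times X D' Int_commute)
  note dense = subsetD[OF this]
  \<comment> \<open>Written with the coefficient 0 to match \<open>closure_nn_integral_bound\<close>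
    in its form for bounds on values.\<close>
  let ?L = "\<lambda>G s. SUP z\<in>Q. ennreal (1 * norm (rep_LC G s z - 0 *\<^sub>R rep_LC G s z))"
  have "(\<integral>\<^sup>+r\<in>{s..t}. ?L (translate_LC \<tau> (abs_LC f)) r \<partial>lebesgue) \<le> m_sup f ?j (t - s)" for \<tau>
  proof -
    have "(\<integral>\<^sup>+r\<in>{s..t}. ?L (translate_LC \<tau> (abs_LC f)) r \<partial>lebesgue) \<le>
        (\<integral>\<^sup>+r\<in>{s..t}. m_bound (time_shift \<tau> f) ?j r \<partial>lebesgue)"
    proof (rule nn_integral_mono_AE)
      show "AE r in lebesgue. ?L (translate_LC \<tau> (abs_LC f)) r * indicator {s..t} r \<le>
        m_bound (time_shift \<tau> f) ?j r * indicator {s..t} r"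
        using rep_translate_abs_AE[OF f, of \<tau>]
      proof eventually_elim
        case (elim r)
        have "?L (translate_LC \<tau> (abs_LC f)) r \<le> m_bound (time_shift \<tau> f) ?j r"
        proof (rule SUP_least)
          fix z assume "z \<in> Q"
          then have "z \<in> cball 0 (real ?j)" by (auto simp: Q_def)
          then have "ennreal (norm (time_shift \<tau> f r z)) \<le> m_bound (time_shift \<tau> f) ?j r"
            unfolding m_bound_def by (rule SUP_upper)
          then show "ennreal (1 * norm (rep_LC (translate_LC \<tau> (abs_LC f)) r z - 0 *\<^sub>R rep_LC (translate_LC \<tau> (abs_LC f)) r z))
            \<le> m_bound (time_shift \<tau> f) ?j r"
            using elim by (simp del: split_paired_All)
        qed
        then show ?case by (auto simp: indicator_def)
      qed
    qed
    also have "\<dots> = (\<integral>\<^sup>+r\<in>{s + \<tau>..(s + \<tau>) + (t - s)}. m_bound f ?j r \<partial>lebesgue)"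
      by (simp add: nn_integral_m_bound_shift[OF f] add.commute)
    also have "\<dots> \<le> m_sup f ?j (t - s)"
      unfolding m_sup_def by (rule SUP_upper) simp
    finally show ?thesis .
  qed
  then have le1: "(\<integral>\<^sup>+r\<in>{s..t}. ?L G r \<partial>lebesgue) \<le> m_sup f ?j (t - s)"
    by (intro closure_nn_integral_bound[OF Q _ _ _ theta_family_approx G[unfolded Hull_def]]) (auto simp: Q_def)
  have le2: "(\<integral>\<^sup>+r\<in>{s..t}. ennreal (norm (rep_LC G r (y r, v r))) \<partial>lebesgue) \<le> (\<integral>\<^sup>+r\<in>{s..t}. ?L G r \<partial>lebesgue)"
  proof (rule nn_integral_mono_AE)
    show "AE r in lebesgue. ennreal (norm (rep_LC G r (y r, v r))) * indicator {s..t} r \<le> ?L G r * indicator {s..t} r"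
      using LC_fun_AE_continuous[OF rep_LC_LC_fun[of G]]
    proof eventually_elim
      case (elim r)
      have "ennreal (norm (rep_LC G r (y r, v r))) \<le> ?L G r" if r: "r \<in> {s..t}"
      proof (rule ennreal_norm_le_closure[OF elim _ dense])
        show "ennreal (norm (rep_LC G r z)) \<le> ?L G r" if "z \<in> Q" for z
          using SUP_upper[OF that, of "\<lambda>z. ennreal (1 * norm (rep_LC G r z - 0 *\<^sub>R rep_LC G r z))"] by simp
        show "(y r, v r) \<in> ball 0 (real ?j)"
          using norm_Pair_le[of "y r" "v r"] R[OF r] by simp
      qed
      then show ?case by (auto simp: indicator_def)
    qed
  qed
  have ai: "(\<lambda>r. rep_LC G r (y r, v r)) absolutely_integrable_on {s..t}"
    by (intro LC_fun_curve_integrable rep_LC_LC_fun continuous_on_Pair yv)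
  have "ennreal (integral {s..t} (\<lambda>r. norm (rep_LC G r (y r, v r)))) \<le> ennreal (m_moduli f I ?j (t - s))"
    unfolding set_nn_integral_eq_integral_norm[OF ai, symmetric] ennreal_m_moduli[OF f em] by (rule order_trans[OF le2 le1])
  then show ?thesis using m_moduli_nonneg[OF f em] by simp
qed

text \<open>Both points of each quotient have the same first component, so the l2-bounds suffice.
  The resulting \<open>l\<close> serves all first components at once and may therefore be used along
  any curve \<open>y\<close>.\<close>

lemma hull_mean_lipschitz_delay:
  assumes bl: "bounded_l2_bounds f" and c: "0 \<le> c"
  shows "\<exists>M\<ge>0. \<forall>G\<in>Hull (curve_topology (theta_family f D')) (abs_LC f). \<forall>y.
    (\<forall>s\<in>{0..c}. y s \<in> ball 0 (real k)) \<longrightarrow> mean_lipschitz 0 c (ball 0 (real k)) M (\<lambda>s u. rep_LC G s (y s, u))"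
proof -
  \<comment> \<open>Pairs whose components have norm below \<open>k\<close> lie in the ball of
    radius \<open>2 * k\<close>.\<close>
  let ?j = "2 * k"
  obtain X :: "(real^'n) set" where X: "countable X" "closure X = UNIV" by (rule dense_first_components)
  define J where "J = {(z, w). z \<in> (X \<times> D') \<inter> cball 0 (real ?j) \<and> w \<in> (X \<times> D') \<inter> cball 0 (real ?j) \<and>
    fst z = fst w \<and> snd z \<noteq> snd w}"
  let ?q = "\<lambda>G s i. ennreal (norm (rep_LC G s (fst i) - rep_LC G s (snd i)) / norm (snd (fst i) - snd (snd i)))"
  have J: "countable J"
    unfolding J_def by (rule countable_subset[of _ "(X \<times> D') \<times> (X \<times> D')"]) (use X D' in auto)
  define M where "M = (SUP \<tau>. \<integral>\<^sup>+t\<in>{- (c + 1)..c + 1}. l2_bound (time_shift \<tau> f) ?j t \<partial>lebesgue)"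
  have "M < \<infinity>"
    unfolding M_def by (rule bl[unfolded bounded_l2_bounds_def, rule_format]) (use c in simp)
  then obtain M' where M': "M = ennreal M'" "0 \<le> M'" by (cases M) auto
  have translates: "(\<integral>\<^sup>+s\<in>{0..c}. (SUP i\<in>J. ?q (translate_LC \<tau> (abs_LC f)) s i) \<partial>lebesgue) \<le> M" for \<tau>
  proof -
    have "(\<integral>\<^sup>+s\<in>{0..c}. (SUP i\<in>J. ?q (translate_LC \<tau> (abs_LC f)) s i) \<partial>lebesgue) \<le>
        (\<integral>\<^sup>+t\<in>{- (c + 1)..c + 1}. l2_bound (time_shift \<tau> f) ?j t \<partial>lebesgue)"
    proof (rule nn_integral_mono_AE)
      show "AE s in lebesgue. (SUP i\<in>J. ?q (translate_LC \<tau> (abs_LC f)) s i) * indicator {0..c} s \<le>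
        l2_bound (time_shift \<tau> f) ?j s * indicator {- (c + 1)..c + 1} s"
        using rep_translate_abs_AE[OF f, of \<tau>]
      proof eventually_elim
        case (elim s)
        have "(SUP i\<in>J. ?q (translate_LC \<tau> (abs_LC f)) s i) \<le> l2_bound (time_shift \<tau> f) ?j s"
        proof (rule SUP_least)
          fix i assume i: "i \<in> J"
          then obtain x u v where iu: "i = ((x, u), (x, v))" and
            xuv: "(x, u) \<in> cball 0 (real ?j)" "(x, v) \<in> cball 0 (real ?j)" "u \<noteq> v"
            by (auto simp: J_def)
          then have "(x, u, v) \<in> {(x, u1, u2). (x, u1) \<in> cball 0 (real ?j) \<and> (x, u2) \<in> cball 0 (real ?j) \<and> u1 \<noteq> u2}"
            by simp
          then have "(case (x, u, v) of (x, u1, u2) \<Rightarrow>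
              ennreal (norm (time_shift \<tau> f s (x, u1) - time_shift \<tau> f s (x, u2)) / norm (u1 - u2)))
            \<le> l2_bound (time_shift \<tau> f) ?j s"
            unfolding l2_bound_def by (rule SUP_upper)
          then show "?q (translate_LC \<tau> (abs_LC f)) s i \<le> l2_bound (time_shift \<tau> f) ?j s"
            using elim by (simp add: iu)
        qed
        then show ?case using c by (auto simp: indicator_def)
      qed
    qed
    also have "\<dots> \<le> M" unfolding M_def by (rule SUP_upper) simp
    finally show ?thesis .
  qed
  have "mean_lipschitz 0 c (ball 0 (real k)) M' (\<lambda>s u. rep_LC G s (y s, u))"
    if G: "G \<in> Hull (curve_topology (theta_family f D')) (abs_LC f)" and y: "\<forall>s\<in>{0..c}. y s \<in> ball 0 (real k)" for G y
  proof -
    have "\<exists>l. l absolutely_integrable_on {0..c} \<and> (\<forall>s. 0 \<le> l s) \<and> integral {0..c} l \<le> M' \<and>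
      (AE s in lebesgue. s \<in> {0..c} \<longrightarrow> (\<forall>i\<in>J. norm (rep_LC G s (fst i) - rep_LC G s (snd i)) \<le> l s * norm (snd (fst i) - snd (snd i))))"
    proof (rule closure_lipschitz_bound[OF J _ _ _ theta_family_approx G[unfolded Hull_def] M'(2)])
      show "fst ` J \<subseteq> UNIV \<times> D'" "snd ` J \<subseteq> UNIV \<times> D'" by (auto simp: J_def)
    qed (use translates in \<open>auto simp: J_def M'(1)\<close>)
    then obtain l where l: "l absolutely_integrable_on {0..c}" "\<forall>s. 0 \<le> l s" "integral {0..c} l \<le> M'"
      "AE s in lebesgue. s \<in> {0..c} \<longrightarrow> (\<forall>i\<in>J. norm (rep_LC G s (fst i) - rep_LC G s (snd i)) \<le> l s * norm (snd (fst i) - snd (snd i)))"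
      by blast
    have "AE s in lebesgue. s \<in> {0..c} \<longrightarrow> (\<forall>u\<in>ball 0 (real k). \<forall>v\<in>ball 0 (real k).
        norm (rep_LC G s (y s, u) - rep_LC G s (y s, v)) \<le> l s * norm (u - v))"
      using l(4) LC_fun_AE_continuous[OF rep_LC_LC_fun[of G]]
    proof eventually_elim
      case (elim s)
      let ?g = "rep_LC G s"
      have cg: "continuous_on UNIV (\<lambda>y. ?g (y, u))" "continuous_on UNIV (\<lambda>u. ?g (y, u))" for y u
        by (rule continuous_on_compose2[OF elim(2)]; auto intro: continuous_intros)+
      show ?case
      proof (intro impI ballI)
        fix u v :: "real^'n"
        assume s: "s \<in> {0..c}" and uv: "u \<in> ball 0 (real k)" "v \<in> ball 0 (real k)"
        have on_X: "norm (?g (x, u) - ?g (x, v)) \<le> l s * norm (u - v)" if x: "x \<in> X \<inter> ball 0 (real k)" for x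
        proof (rule lipschitz_on_ball_of_dense[OF cg(2) D'(2) _ uv])
          fix u v assume uv: "u \<in> D' \<inter> ball 0 (real k)" "v \<in> D' \<inter> ball 0 (real k)"
          show "norm (?g (x, u) - ?g (x, v)) \<le> l s * norm (u - v)"
          proof (cases "u = v")
            case False
            have "norm (x, u) \<le> real ?j" "norm (x, v) \<le> real ?j"
              using x uv norm_Pair_le[of x u] norm_Pair_le[of x v] by auto
            then have "((x, u), (x, v)) \<in> J" using x uv False by (auto simp: J_def)
            with elim(1) s show ?thesis by fastforce
          qed simp
        qed
        \<comment> \<open>With \<open>u\<close> and \<open>v\<close> fixed, the inequality is closed
          in the first component and passes from the dense \<open>X\<close> to
          \<open>y s\<close>.\<close>
        let ?S = "{y. norm (?g (y, u) - ?g (y, v)) \<le> l s * norm (u - v)}"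
        have cl: "closed ?S" by (intro closed_Collect_le continuous_intros cg)
        have "X \<inter> ball 0 (real k) \<subseteq> ?S" using on_X by blast
        from closure_minimal[OF this cl] have "closure (X \<inter> ball 0 (real k)) \<subseteq> ?S" .
        moreover have "ball 0 (real k) \<subseteq> closure (X \<inter> ball 0 (real k))"
          using open_Int_closure_subset[OF open_ball, of 0 "real k" X] X(2) by (simp add: Int_commute)
        ultimately show "norm (?g (y s, u) - ?g (y s, v)) \<le> l s * norm (u - v)" using y s by blast
      qed
    qed
    then show ?thesis using l(1-3) unfolding mean_lipschitz_def by blast
  qed
  then show ?thesis using M'(2) by blast
qed

text \<open>No mean Lipschitz bound in the first variable is assumed to be shared by the hull, so a
  finite net cannot replace \<open>y\<close>, which is unknown when the neighbourhood is chosen.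
  Instead \<open>hull_m_bound\<close> puts every admissible \<open>y\<close> into one set of curves
  over which the seminorms take the supremum; a net is needed for the delayed variable only.\<close>

lemma mean_continuous_theta_topology:
  assumes bl: "bounded_l2_bounds f"
  shows "mean_continuous_along_solutions (curve_topology (theta_family f D')) (Hull (curve_topology (theta_family f D')) (abs_LC f))"
    (is "mean_continuous_along_solutions ?T ?H")
  unfolding mean_continuous_along_solutions_def
proof (intro ballI allI impI)
  fix G0 and R :: nat and c e :: real
  assume G0: "G0 \<in> ?H" and c: "0 \<le> c" and e: "0 < e"
  let ?j = "2 * R + 1"
  have \<F>: "curve_family (theta_family f D')"
    by (rule curve_family_theta_family[OF f em dense_nonempty[OF D'(2)]])
  then have ne: "theta_family f D' \<noteq> {}" by (simp add: curve_family_def)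
  have R1: "real (R + 1) = real R + 1" by simp
  obtain M where M: "M \<ge> 0" and lip: "\<forall>G\<in>?H. \<forall>y. (\<forall>s\<in>{0..c}. y s \<in> ball 0 (real R + 1)) \<longrightarrow>
    mean_lipschitz 0 c (ball 0 (real R + 1)) M (\<lambda>s u. rep_LC G s (y s, u))"
    using hull_mean_lipschitz_delay[OF bl c, of "R + 1"] unfolding R1 by blast
  obtain F \<epsilon> where F: "finite F" "F \<subseteq> D' \<inter> ball 0 (real R + 1)" and \<epsilon>: "0 < \<epsilon>" and
    test: "\<forall>(g :: real \<Rightarrow> real^'n \<Rightarrow> real^'n) h x. (\<forall>s\<in>{0..c}. x s \<in> cball 0 (real R)) \<and>
       mean_lipschitz 0 c (ball 0 (real R + 1)) M g \<and> mean_lipschitz 0 c (ball 0 (real R + 1)) M h \<and>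
       (\<forall>u. (\<lambda>s. g s u - h s u) absolutely_integrable_on {0..c}) \<and>
       (\<lambda>s. g s (x s) - h s (x s)) absolutely_integrable_on {0..c} \<and>
       (\<forall>u\<in>F. integral {0..c} (\<lambda>s. norm (g s u - h s u)) \<le> \<epsilon>) \<longrightarrow>
       integral {0..c} (\<lambda>s. norm (g s (x s) - h s (x s))) \<le> e"
    using finite_test_points[OF D'(2) M e, of "real R" 0 c] by (elim exE conjE) (rule that)
  obtain q1 q2 where q: "q1 \<in> \<rat>" "q2 \<in> \<rat>" "q1 \<le> q2" "{0..c} \<subseteq> {q1..q2}"
    using rat_interval_superset by blast
  have qI: "{q1..q2} \<in> rat_intervals" by (rule rat_intervalI[OF q(1-3)])
  \<comment> \<open>The index \<open>2 * R + 1\<close> is the one at which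
    \<open>hull_m_bound\<close> bounds the increments of \<open>y\<close>.\<close>
  let ?X = "\<lambda>u. (\<lambda>x t. (x t, u)) ` moduli_set (m_moduli f) {q1..q2} ?j"
  let ?V = "(\<Inter>u\<in>F. {G. curve_seminorm {q1..q2} (?X u) (LC_diff G G0) < ennreal \<epsilon>}) \<inter> topspace ?T"
  have V: "openin ?T ?V"
    using F \<epsilon> by (intro openin_INT openin_curve_ball theta_familyI[OF qI]) auto
  have G0V: "G0 \<in> ?V" using \<epsilon> by (simp add: curve_seminorm_zero topspace_curve_topology[OF ne])
  show "\<exists>V. openin ?T V \<and> G0 \<in> V \<and> (\<forall>G\<in>V \<inter> ?H. \<forall>y v. continuous_on {0..c} y \<and> continuous_on {0..c} v \<and>
       (\<forall>t\<in>{0..c}. norm (y t) \<le> real R \<and> norm (v t) \<le> real R) \<and>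
       (\<forall>s t. 0 \<le> s \<and> s \<le> t \<and> t \<le> c \<longrightarrow>
          norm (y t - y s) \<le> integral {s..t} (\<lambda>r. norm (rep_LC G r (y r, v r)))) \<longrightarrow>
       integral {0..c} (\<lambda>r. norm (rep_LC G r (y r, v r) - rep_LC G0 r (y r, v r))) \<le> e)"
  proof (intro exI[of _ ?V] conjI ballI allI impI V G0V)
    fix G and y v :: "real \<Rightarrow> real^'n"
    assume G: "G \<in> ?V \<inter> ?H" and yv: "continuous_on {0..c} y \<and> continuous_on {0..c} v \<and>
       (\<forall>t\<in>{0..c}. norm (y t) \<le> real R \<and> norm (v t) \<le> real R) \<and>
       (\<forall>s t. 0 \<le> s \<and> s \<le> t \<and> t \<le> c \<longrightarrow>
          norm (y t - y s) \<le> integral {s..t} (\<lambda>r. norm (rep_LC G r (y r, v r))))"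
    have GH: "G \<in> ?H" using G by blast
    have cy: "continuous_on {0..c} y" and cv: "continuous_on {0..c} v" using yv by auto
    have yR: "norm (y s) \<le> real R" "norm (v s) \<le> real R" if "s \<in> {0..c}" for s using yv that by auto
    \<comment> \<open>The curve is extended by constants from \<open>{0..c}\<close> to the rational
      interval; the shift by 0 is written out to match \<open>clamped_in_moduli_set\<close>.\<close>
    let ?y = "\<lambda>r. y (max 0 (min c (r - 0)))"
    have ymod: "?y \<in> moduli_set (m_moduli f) {q1..q2} ?j"
    proof (rule clamped_in_moduli_set[OF f em cy c])
      show "norm (y t) \<le> real ?j" if "t \<in> {0..c}" for t using yR[OF that] by simp
      fix s t :: real assume st: "0 \<le> s" "s \<le> t" "t \<le> c"
      have "norm (y t - y s) \<le> integral {s..t} (\<lambda>r. norm (rep_LC G r (y r, v r)))"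
        using yv st by blast
      also have "\<dots> \<le> m_moduli f {q1..q2} ?j (t - s)"
        using st yR by (intro hull_m_bound[OF GH] continuous_on_subset[OF cy] continuous_on_subset[OF cv]) auto
      finally show "norm (y t - y s) \<le> m_moduli f {q1..q2} ?j (t - s)" .
    qed
    have close: "integral {0..c} (\<lambda>r. norm (LC_diff G G0 r (y r, u))) \<le> \<epsilon>" if u: "u \<in> F" for u
    proof -
      have cyu: "continuous_on {q1..q2} (\<lambda>r. (?y r, u))"
        using ymod by (intro continuous_on_Pair continuous_on_const) (simp add: moduli_set_def)
      have "curve_seminorm {q1..q2} (?X u) (LC_diff G G0) < ennreal \<epsilon>" using G u by blast
      from curve_seminorm_lessD[OF this imageI[OF ymod] cyu]
      have "integral {q1..q2} (\<lambda>r. norm (LC_diff G G0 r (?y r, u))) < \<epsilon>" .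
      moreover have "integral {0..c} (\<lambda>r. norm (LC_diff G G0 r (?y r, u))) \<le> integral {q1..q2} (\<lambda>r. norm (LC_diff G G0 r (?y r, u)))"
        by (intro integral_subset_Icc_nonneg abs_integrable_norm_Icc LC_diff_integrable[OF cyu] q(4)) auto
      moreover have "integral {0..c} (\<lambda>r. norm (LC_diff G G0 r (?y r, u))) = integral {0..c} (\<lambda>r. norm (LC_diff G G0 r (y r, u)))"
        by (intro integral_cong) (auto simp: max_def min_def)
      ultimately show ?thesis by simp
    qed
    have yB: "\<forall>s\<in>{0..c}. y s \<in> ball 0 (real R + 1)" using yR(1) by fastforce
    show "integral {0..c} (\<lambda>r. norm (rep_LC G r (y r, v r) - rep_LC G0 r (y r, v r))) \<le> e"
    \<comment> \<open>With \<open>y\<close> frozen, \<open>G\<close> and \<open>G0\<close> become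
      functions of time and delayed state, and \<open>v\<close> is the curve to be tested.\<close>
    proof (rule test[THEN spec[of _ "\<lambda>s u. rep_LC G s (y s, u)"], THEN spec[of _ "\<lambda>s u. rep_LC G0 s (y s, u)"],
          THEN spec[of _ v], THEN mp], intro conjI allI ballI close)
      show "v s \<in> cball 0 (real R)" if "s \<in> {0..c}" for s using yR(2)[OF that] by simp
      show "(\<lambda>s. LC_diff G G0 s (y s, v s)) absolutely_integrable_on {0..c}"
        by (intro LC_diff_integrable continuous_on_Pair cy cv)
      show "(\<lambda>s. LC_diff G G0 s (y s, u)) absolutely_integrable_on {0..c}" for u
        by (intro LC_diff_integrable continuous_on_Pair cy continuous_on_const)
    qed (use lip GH G0 yB in blast)+
  qed
qed

end

theorem theorem4p8:
  fixes f :: "real \<Rightarrow> (real^'n) \<times> (real^'n) \<Rightarrow> real^'n"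
    and D' :: "(real^'n) set"
    and D :: "((real^'n) \<times> (real^'n)) set"
  assumes "f \<in> LC_fun"
    and "countable D'" and "closure D' = UNIV"
    and "countable D" and "closure D = UNIV"
  shows "(equicontinuous_m_bounds f \<and> bounded_l2_bounds f \<longrightarrow>
      suitable_moduli (m_moduli f) \<and>
      continuous_skew_product_semiflow
        (subtopology (T_Theta (m_moduli f) D') (Hull (T_Theta (m_moduli f) D') (abs_LC f)))
        C11_topology
        (flow_domain (T_Theta (m_moduli f) D') (abs_LC f))
        flow_map)
    \<and> (bounded_l_bounds f \<longrightarrow>
      continuous_skew_product_semiflow
        (subtopology (T_D D) (Hull (T_D D) (abs_LC f)))
        C11_topology
        (flow_domain (T_D D) (abs_LC f))
        flow_map)"
proof (intro conjI impI)
  assume i: "equicontinuous_m_bounds f \<and> bounded_l2_bounds f"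
  then have em: "equicontinuous_m_bounds f" and bl: "bounded_l2_bounds f" by auto
  show "suitable_moduli (m_moduli f)" by (rule suitable_m_moduli[OF assms(1) em])
  show "continuous_skew_product_semiflow
        (subtopology (T_Theta (m_moduli f) D') (Hull (T_Theta (m_moduli f) D') (abs_LC f)))
        C11_topology (flow_domain (T_Theta (m_moduli f) D') (abs_LC f)) flow_map"
    unfolding T_Theta_eq
    by (intro curve_topology_semiflow curve_family_theta_family[OF assms(1) em dense_nonempty[OF assms(3)]]
        mean_continuous_theta_topology[OF assms(1) em assms(2,3) bl])
next
  assume "bounded_l_bounds f"
  then show "continuous_skew_product_semiflow (subtopology (T_D D) (Hull (T_D D) (abs_LC f)))
        C11_topology (flow_domain (T_D D) (abs_LC f)) flow_map"
    unfolding T_D_eq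
    by (intro curve_topology_semiflow curve_family_point_family dense_nonempty[OF assms(5)]
        mean_continuous_point_topology assms)
qed

end
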